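(* Let $(M,\boldsymbol{c})$ be a conformal manifold of dimension $n\ge 3$ and $\Sigma\hookrightarrow M$ a submanifold of codimension $d$ and dimension $m=n-d$, $1\le m\le n-1$. Then the following are equivalent: 1. $\mathbb{L}_{iJ}{}^{C}=0$ (the tractor second fundamental form of $\Sigma$ vanishes); 2. $\nabla_i \mathrm{N}^{A_1}_{A_2}=0$; 3. $\nabla_i N_{A_1A_2\cdots A_d}=0$; 4. $\nabla_i \star N^{A_1A_2\cdots A_{m+2}}=0$, where $\nabla_i$ is the pullback to $\Sigma$ of the ambient tractor connection, $\mathrm{N}^A_B$ is the orthogonal projection onto the normal tractor bundle, and $N_{A_1\cdots A_d}$ is the tractor normal form of $\Sigma$ with tractor Hodge dual $\star N$.
   Context: Conformal tractors. $(M,\boldsymbol{c})$ is a smooth connected oriented $n$-manifold with a class $\boldsymbol{c}$ of conformally related Riemannian metrics ($g,\hat g\in\boldsymbol{c}$ iff $\hat g=\Omega^2g$, $\Omega>0$ smooth). Sections of the density bundle $\mathcal{E}[w]$ are classes of pairs $(g,f)\sim(\Omega^2g,\Omega^wf)$; $\mathcal{B}[w]:=\mathcal{B}\otimes\mathcal{E}[w]$; the conformal metric $\boldsymbol{g}\in\Gamma(S^2T^*M[2])$ is the class of $(g,g)$ and raises and lowers indices. For $g\in\boldsymbol{c}$, $\nabla$ is the Levi-Civita connection (also acting on densities), $(\nabla_a\nabla_b-\nabla_b\nabla_a)v^c=R_{ab}{}^c{}_dv^d$, $R_{ab}=R_{ca}{}^c{}_b$, and the Schouten tensor $P_{ab}$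 is defined by $R_{ab}=(n-2)P_{ab}+J\boldsymbol{g}_{ab}$, $J=\boldsymbol{g}^{ab}P_{ab}$. The standard tractor bundle $\mathcal{T}$ (rank $n+2$, abstract indices $A,B,\dots$) is identified by a choice of $g\in\boldsymbol{c}$ with $\mathcal{E}[1]\oplus T^*M[1]\oplus\mathcal{E}[-1]$, $V=(\sigma,\mu_a,\rho)$, where for $\hat g=\Omega^2g$ and $\Upsilon_a=\Omega^{-1}\nabla_a\Omega$ the triple becomes $(\sigma,\ \mu_a+\Upsilon_a\sigma,\ \rho-\Upsilon^b\mu_b-\tfrac12\Upsilon^b\Upsilon_b\sigma)$. The tractor metric $h(V,V)=2\sigma\rho+\boldsymbol{g}^{ab}\mu_a\mu_b$ identifies $\mathcal{T}\cong\mathcal{T}^*$, and the tractor connection is $\nabla_a(\sigma,\mu_b,\rho)=(\nabla_a\sigma-\mu_a,\ \nabla_a\mu_b+P_{ab}\sigma+\boldsymbol{g}_{ab}\rho,\ \nabla_a\rho-P_{ab}\mu^b)$; both are conformally invariant. The tractor volume form $\varepsilon_{A_1\cdots A_{n+2}}$ is the parallel section of $\Lambda^{n+2}\mathcal{T}^*$ determined by the orientation with $\varepsilon^{A_1\cdots A_{n+2}}\varepsilon_{A_1\cdots A_{n+2}}=-(n+2)!$; for a tractor $k$-form, $\star\Psi_{B_1\cdots B_{n+2-k}}=\frac1{k!}\varepsilon^{A_1\cdots A_k}{}_{B_1\cdots B_{n+2-k}}\Psi_{A_1\cdots A_k}$. Submanifolds. $\Sigma$ is a smoothly embedded oriented submanifold;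 indices $i,j$ refer to $T\Sigma$, $\Pi^a_i:T\Sigma\to TM|_\Sigma$ is the inclusion. For $g\in\boldsymbol{c}$ the second fundamental form $I\!I_{ij}{}^c$ is defined by $\nabla_i(\Pi^c_jV^j)=\Pi^c_jD_iV^j+I\!I_{ij}{}^cV^j$ ($D$ the Levi-Civita connection of $g|_\Sigma$), and $H^c=\frac1m\boldsymbol{g}^{ij}I\!I_{ij}{}^c$ is the mean curvature. The normal tractor bundle $\mathcal{N}\subset\mathcal{T}|_\Sigma$ is the (conformally invariant) image of $N\Sigma[-1]$ under $n^a\mapsto(0,n_a,n_cH^c)$. Then $\mathcal{T}|_\Sigma=\mathcal{N}^\perp\oplus\mathcal{N}$ orthogonally, with projection $\mathrm{N}^A_B$ onto $\mathcal{N}$, and $\mathcal{N}^\perp$ is canonically identified with the tractor bundle $\mathcal{T}\Sigma$ of $\Sigma$ (indices $I,J,\dots$; inclusion $\Pi^A_J:\mathcal T\Sigma\to\mathcal T|_\Sigma$). The tractor second fundamental form $\mathbb{L}_{iJ}{}^C\in\Gamma(T^*\Sigma\otimes\mathcal{T}^*\Sigma\otimes\mathcal{N})$ is defined by $\mathbb{L}_{iJ}{}^CV^J=\mathrm{N}^C_A\nabla_i(\Pi^A_JV^J)$ for all $V\in\Gamma(\mathcal{T}\Sigma)$. The tractor normal form $N_{A_1\cdots A_d}$ is the section of $\Lambda^d\mathcal{N}^*$ compatible with the orientations of $\Sigma$ and $M$ with $N^{A_1\cdots A_d}N_{A_1\cdots A_d}=d!$. *)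

theory Defs
  imports "HOL-Analysis.Analysis"
begin

section \<open>Calculus on open subsets of Euclidean space\<close>

abbreviation dir_deriv ::
    "('v::real_normed_vector \<Rightarrow> 'w::real_normed_vector) \<Rightarrow> 'v \<Rightarrow> 'v \<Rightarrow> 'w"
  where "dir_deriv f x u \<equiv> frechet_derivative f (at x) u"

primrec Ck_on ::
    "nat \<Rightarrow> 'v::euclidean_space set \<Rightarrow> ('v \<Rightarrow> 'w::real_normed_vector) \<Rightarrow> bool"
where
  "Ck_on 0 S f \<longleftrightarrow> continuous_on S f"
| "Ck_on (Suc k) S f \<longleftrightarrow>
     (\<forall>x\<in>S. f differentiable (at x)) \<and> (\<forall>u. Ck_on k S (\<lambda>x. dir_deriv f x u))"

text \<open>Only used for open \<open>S\<close>.\<close>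

definition smooth_on ::
    "'v::euclidean_space set \<Rightarrow> ('v \<Rightarrow> 'w::real_normed_vector) \<Rightarrow> bool"
  where "smooth_on S f \<longleftrightarrow> (\<forall>k. Ck_on k S f)"


section \<open>Oriented smooth manifolds and embeddings\<close>

text \<open>
  The underlying space of a manifold is a (Hausdorff, second countable) type; a chart is a pair of
  its domain and its coordinate map. Atlases are not required to be maximal.
\<close>

type_synonym ('a, 'n) chart = "'a set \<times> ('a \<Rightarrow> real ^ 'n)"

definition chart_inv :: "('a, 'n::finite) chart \<Rightarrow> real ^ 'n \<Rightarrow> 'a"
  where "chart_inv \<kappa> = inv_into (fst \<kappa>) (snd \<kappa>)"

definition is_chart :: "('a::topological_space, 'n::finite) chart \<Rightarrow> bool"
  where "is_chart \<kappa> \<longleftrightarrow> open (fst \<kappa>) \<and> open (snd \<kappa> ` fst \<kappa>) \<and>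
           homeomorphism (fst \<kappa>) (snd \<kappa> ` fst \<kappa>) (snd \<kappa>) (chart_inv \<kappa>)"

definition jacobian :: "('a, 'n::finite) chart \<Rightarrow> ('a, 'n) chart \<Rightarrow> 'a \<Rightarrow> real ^ 'n ^ 'n"
  where "jacobian \<kappa> \<kappa>' p = matrix (dir_deriv (snd \<kappa>' \<circ> chart_inv \<kappa>) (snd \<kappa> p))"

definition oriented_atlas :: "('a::topological_space, 'n::finite) chart set \<Rightarrow> bool"
  where "oriented_atlas A \<longleftrightarrow>
    (\<forall>\<kappa>\<in>A. is_chart \<kappa>) \<and> (\<Union>\<kappa>\<in>A. fst \<kappa>) = UNIV \<and>
    (\<forall>\<kappa>\<in>A. \<forall>\<kappa>'\<in>A.
       smooth_on (snd \<kappa> ` (fst \<kappa> \<inter> fst \<kappa>')) (snd \<kappa>' \<circ> chart_inv \<kappa>) \<and>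
       (\<forall>p\<in>fst \<kappa> \<inter> fst \<kappa>'. det (jacobian \<kappa> \<kappa>' p) > 0))"

definition loc_map ::
    "('b \<Rightarrow> 'a) \<Rightarrow> ('a, 'n::finite) chart \<Rightarrow> ('b, 'm::finite) chart \<Rightarrow> real ^ 'm \<Rightarrow> real ^ 'n"
  where "loc_map f \<kappa> \<psi> = snd \<kappa> \<circ> f \<circ> chart_inv \<psi>"

definition loc_dom ::
    "('b \<Rightarrow> 'a) \<Rightarrow> ('a, 'n::finite) chart \<Rightarrow> ('b, 'm::finite) chart \<Rightarrow> (real ^ 'm) set"
  where "loc_dom f \<kappa> \<psi> = snd \<psi> ` (fst \<psi> \<inter> f -` fst \<kappa>)"

definition smooth_embedding ::
    "('a::topological_space, 'n::finite) chart set \<Rightarrow> ('b::topological_space, 'm::finite) chart set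
      \<Rightarrow> ('b \<Rightarrow> 'a) \<Rightarrow> bool"
  where "smooth_embedding A B f \<longleftrightarrow>
    (\<exists>r. homeomorphism UNIV (range f) f r) \<and>
    (\<forall>\<kappa>\<in>A. \<forall>\<psi>\<in>B. smooth_on (loc_dom f \<kappa> \<psi>) (loc_map f \<kappa> \<psi>) \<and>
       (\<forall>x\<in>loc_dom f \<kappa> \<psi>. inj (dir_deriv (loc_map f \<kappa> \<psi>) x)))"

definition smooth_fun :: "('a, 'n::finite) chart set \<Rightarrow> ('a \<Rightarrow> real) \<Rightarrow> bool"
  where "smooth_fun A F \<longleftrightarrow> (\<forall>\<kappa>\<in>A. smooth_on (snd \<kappa> ` fst \<kappa>) (F \<circ> chart_inv \<kappa>))"

text \<open>
  The index type \<open>'n\<close> carries no order. The enumeration \<open>from_nat_into UNIV\<close> is the fixed reference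
  order of the coordinates: a chart of the oriented atlas is positively oriented for the coordinates
  taken in this order.
\<close>

definition coord_frame :: "(real ^ 'n::finite) list"
  where "coord_frame = map (\<lambda>k. axis (from_nat_into UNIV k) 1) [0..<CARD('n)]"

definition list_det :: "(real ^ 'n::finite) list \<Rightarrow> real"
  where "list_det vs = det (\<chi> i. vs ! to_nat_on UNIV i)"


section \<open>Conformal classes of Riemannian metrics\<close>

text \<open>A metric is given by its matrix of components in every chart.\<close>

type_synonym ('a, 'n) metric = "('a, 'n) chart \<Rightarrow> 'a \<Rightarrow> real ^ 'n ^ 'n"

definition riemannian_metric :: "('a, 'n::finite) chart set \<Rightarrow> ('a, 'n) metric \<Rightarrow> bool"
  where "riemannian_metric A g \<longleftrightarrow>
    (\<forall>\<kappa>\<in>A. smooth_on (snd \<kappa> ` fst \<kappa>) (g \<kappa> \<circ> chart_inv \<kappa>) \<and>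
      (\<forall>p\<in>fst \<kappa>. transpose (g \<kappa> p) = g \<kappa> p \<and> (\<forall>v. v \<noteq> 0 \<longrightarrow> v \<bullet> (g \<kappa> p *v v) > 0)) \<and>
      (\<forall>\<kappa>'\<in>A. \<forall>p\<in>fst \<kappa> \<inter> fst \<kappa>'.
         g \<kappa> p = transpose (jacobian \<kappa> \<kappa>' p) ** g \<kappa>' p ** jacobian \<kappa> \<kappa>' p))"

definition conformal_factor ::
    "('a, 'n::finite) chart set \<Rightarrow> ('a \<Rightarrow> real) \<Rightarrow> ('a, 'n) metric \<Rightarrow> ('a, 'n) metric \<Rightarrow> bool"
  where "conformal_factor A \<Omega> g g' \<longleftrightarrow>
    smooth_fun A \<Omega> \<and> (\<forall>p. \<Omega> p > 0) \<and> (\<forall>\<kappa>\<in>A. \<forall>p\<in>fst \<kappa>. g' \<kappa> p = (\<Omega> p)\<^sup>2 *\<^sub>R g \<kappa> p)"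

definition conformal_class :: "('a, 'n::finite) chart set \<Rightarrow> ('a, 'n) metric set \<Rightarrow> bool"
  where "conformal_class A c \<longleftrightarrow> c \<noteq> {} \<and>
    (\<forall>g\<in>c. riemannian_metric A g \<and>
      (\<forall>g'. g' \<in> c \<longleftrightarrow> riemannian_metric A g' \<and> (\<exists>\<Omega>. conformal_factor A \<Omega> g g')))"

definition loc_metric ::
    "('a, 'n::finite) metric \<Rightarrow> ('a, 'n) chart \<Rightarrow> real ^ 'n \<Rightarrow> real ^ 'n ^ 'n"
  where "loc_metric g \<kappa> = g \<kappa> \<circ> chart_inv \<kappa>"


section \<open>Levi-Civita connection and curvature in coordinates\<close>

text \<open>In this section \<open>G\<close> is the component matrix of a metric as a function of the coordinates.\<close>

abbreviation pderiv_at ::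
    "(real ^ 'n::finite \<Rightarrow> 'w::real_normed_vector) \<Rightarrow> real ^ 'n \<Rightarrow> 'n \<Rightarrow> 'w"
  where "pderiv_at f x a \<equiv> dir_deriv f x (axis a 1)"

text \<open>\<open>christoffel G x c a b\<close> is $\Gamma^c_{ab}$.\<close>

definition christoffel ::
    "(real ^ 'n::finite \<Rightarrow> real ^ 'n ^ 'n) \<Rightarrow> real ^ 'n \<Rightarrow> 'n \<Rightarrow> 'n \<Rightarrow> 'n \<Rightarrow> real"
  where "christoffel G x c a b = 1 / 2 * (\<Sum>d\<in>UNIV. matrix_inv (G x) $ c $ d *
     (pderiv_at (\<lambda>z. G z $ b $ d) x a + pderiv_at (\<lambda>z. G z $ a $ d) x b
      - pderiv_at (\<lambda>z. G z $ a $ b) x d))"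

text \<open>
  \<open>riemann G x a b c d\<close> is $R_{ab}{}^c{}_d$, with the sign convention
  $(\nabla_a\nabla_b-\nabla_b\nabla_a)v^c=R_{ab}{}^c{}_dv^d$.
\<close>

definition riemann ::
    "(real ^ 'n::finite \<Rightarrow> real ^ 'n ^ 'n) \<Rightarrow> real ^ 'n \<Rightarrow> 'n \<Rightarrow> 'n \<Rightarrow> 'n \<Rightarrow> 'n \<Rightarrow> real"
  where "riemann G x a b c d =
     pderiv_at (\<lambda>z. christoffel G z c b d) x a - pderiv_at (\<lambda>z. christoffel G z c a d) x b
     + (\<Sum>e\<in>UNIV. christoffel G x c a e * christoffel G x e b d
          - christoffel G x c b e * christoffel G x e a d)"

definition ricci :: "(real ^ 'n::finite \<Rightarrow> real ^ 'n ^ 'n) \<Rightarrow> real ^ 'n \<Rightarrow> real ^ 'n ^ 'n"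
  where "ricci G x = (\<chi> a b. \<Sum>c\<in>UNIV. riemann G x c a c b)"

definition metric_trace :: "real ^ 'n ^ 'n \<Rightarrow> real ^ 'n ^ 'n::finite \<Rightarrow> real"
  where "metric_trace g S = (\<Sum>a\<in>UNIV. \<Sum>b\<in>UNIV. matrix_inv g $ a $ b * S $ a $ b)"

text \<open>
  The Schouten tensor is the solution $P$ of $R_{ab}=(n-2)P_{ab}+Jg_{ab}$, $J=g^{ab}P_{ab}$; see
  lemma \<open>schouten_iff\<close>.
\<close>

definition schouten :: "(real ^ 'n::finite \<Rightarrow> real ^ 'n ^ 'n) \<Rightarrow> real ^ 'n \<Rightarrow> real ^ 'n ^ 'n"
  where "schouten G x = (1 / (real CARD('n) - 2)) *\<^sub>R
     (ricci G x - (metric_trace (G x) (ricci G x) / (2 * (real CARD('n) - 1))) *\<^sub>R G x)"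

lemma matrix_inv_inverse:
  fixes g :: "real ^ 'n ^ 'n::finite"
  assumes "invertible g"
  shows "g ** matrix_inv g = mat 1" and "matrix_inv g ** g = mat 1"
  using someI_ex[OF assms[unfolded invertible_def]] unfolding matrix_inv_def by blast+

lemma metric_trace_self:
  fixes g :: "real ^ 'n ^ 'n::finite"
  assumes "invertible g" "transpose g = g"
  shows "metric_trace g g = real CARD('n)"
proof -
  have inv: "matrix_inv g ** g = mat 1"
    using assms(1) by (rule matrix_inv_inverse(2))
  have sym: "g $ a $ b = g $ b $ a" for a b
    using arg_cong[OF assms(2), of "\<lambda>h. h $ a $ b"] by (simp add: transpose_def)
  have "(\<Sum>b\<in>UNIV. matrix_inv g $ a $ b * g $ a $ b) = 1" for a
  proof -
    have "(\<Sum>b\<in>UNIV. matrix_inv g $ a $ b * g $ a $ b)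
        = (\<Sum>b\<in>UNIV. matrix_inv g $ a $ b * g $ b $ a)"
      by (rule sum.cong[OF refl]) (simp only: sym[of a])
    also have "\<dots> = (matrix_inv g ** g) $ a $ a"
      by (simp add: matrix_matrix_mult_def)
    finally show ?thesis by (simp add: inv mat_def)
  qed
  then show ?thesis by (simp add: metric_trace_def)
qed

lemma metric_trace_lincomb:
  "metric_trace g (s *\<^sub>R S + t *\<^sub>R T) = s * metric_trace g S + t * metric_trace g T"
  by (simp add: metric_trace_def sum_distrib_left sum.distrib algebra_simps)

lemma schouten_iff:
  fixes G :: "real ^ 'n \<Rightarrow> real ^ 'n ^ 'n::finite"
  assumes "invertible (G x)" "transpose (G x) = G x" "CARD('n) \<ge> 3"
  shows "ricci G x = (real CARD('n) - 2) *\<^sub>R P + metric_trace (G x) P *\<^sub>R G x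
           \<longleftrightarrow> P = schouten G x"
proof -
  define n where "n = real CARD('n)"
  define R where "R = ricci G x"
  let ?tr = "metric_trace (G x)"
  have n: "n \<ge> 3" using assms(3) by (simp add: n_def)
  have trG: "?tr (G x) = n" using metric_trace_self[OF assms(1,2)] by (simp add: n_def)
  have sch: "schouten G x = (1 / (n - 2)) *\<^sub>R (R - (?tr R / (2 * (n - 1))) *\<^sub>R G x)"
    by (simp add: schouten_def n_def R_def)
  show ?thesis
    unfolding n_def[symmetric] R_def[symmetric]
  proof
    assume R: "R = (n - 2) *\<^sub>R P + ?tr P *\<^sub>R G x"
    then have "?tr R = (n - 2) * ?tr P + ?tr P * n"
      by (metis metric_trace_lincomb trG)
    then have "?tr R = 2 * (n - 1) * ?tr P" by (simp add: algebra_simps)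
    then have "?tr R / (2 * (n - 1)) = ?tr P" using n by simp
    then show "P = schouten G x" using n by (simp add: sch R)
  next
    assume P: "P = schouten G x"
    let ?q = "?tr R / (2 * (n - 1))"
    have "P = (1 / (n - 2)) *\<^sub>R R + (- ?q / (n - 2)) *\<^sub>R G x"
      unfolding P sch by (simp add: algebra_simps)
    then have "?tr P = (1 / (n - 2)) * ?tr R + (- ?q / (n - 2)) * n"
      by (metis metric_trace_lincomb trG)
    also have "\<dots> = ?q"
    proof -
      define q where "q = ?q"
      have "?tr R = 2 * (n - 1) * q" using n by (simp add: q_def)
      then have "(1 / (n - 2)) * ?tr R + (- q / (n - 2)) * n = (2 * (n - 1) * q - q * n) / (n - 2)"
        by (simp only: diff_divide_distrib) simp
      also have "2 * (n - 1) * q - q * n = q * (n - 2)" by (simp add: algebra_simps)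
      finally show ?thesis using n by (simp add: q_def)
    qed
    finally have "?tr P = ?q" .
    then show "R = (n - 2) *\<^sub>R P + ?tr P *\<^sub>R G x"
      using n unfolding P sch by simp
  qed
qed


section \<open>Tractors\<close>

text \<open>
  A scale \<open>g\<close> of the conformal class trivialises the density bundles and a chart trivialises
  $T^*M$, so that a pair of chart and scale identifies a fibre of $\mathcal{T}$ with triples
  $(\sigma,\mu_a,\rho)$. Tractor objects are families over all charts and scales. In the scale
  \<open>g\<close>, sections of $\mathcal{E}[w]$ are functions, the conformal metric is \<open>g\<close>, and the
  Levi-Civita connection on densities is the differential.
\<close>

type_synonym 'n tractor = "real \<times> (real ^ 'n) \<times> real"

text \<open>
  Passage from chart \<open>\<kappa>\<close> and scale \<open>g\<close> to \<open>\<kappa>'\<close> and $\hat g=\Omega^2g$. The outer powers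
  of $\Omega$ come from the weights, as a section of $\mathcal{E}[w]$ represented by \<open>f\<close> in the
  scale \<open>g\<close> is represented by $\Omega^wf$ in the scale $\hat g$.
\<close>

definition tractor_change ::
    "('a, 'n::finite) chart \<Rightarrow> ('a, 'n) chart \<Rightarrow> real ^ 'n ^ 'n \<Rightarrow> ('a \<Rightarrow> real) \<Rightarrow> 'a
      \<Rightarrow> 'n tractor \<Rightarrow> 'n tractor"
  where "tractor_change \<kappa> \<kappa>' G \<Omega> p = (\<lambda>(\<sigma>, \<mu>, \<rho>).
     let \<Upsilon> = (1 / \<Omega> p) *\<^sub>R (\<chi> a. pderiv_at (\<Omega> \<circ> chart_inv \<kappa>) (snd \<kappa> p) a)
     in (\<Omega> p * \<sigma>,
         \<Omega> p *\<^sub>R (transpose (jacobian \<kappa>' \<kappa> p) *v (\<mu> + \<sigma> *\<^sub>R \<Upsilon>)),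
         (\<rho> - \<Upsilon> \<bullet> (matrix_inv G *v \<mu>) - 1 / 2 * (\<Upsilon> \<bullet> (matrix_inv G *v \<Upsilon>)) * \<sigma>) / \<Omega> p))"

definition tractor_metric :: "real ^ 'n ^ 'n \<Rightarrow> 'n tractor \<Rightarrow> 'n::finite tractor \<Rightarrow> real"
  where "tractor_metric G = (\<lambda>(\<sigma>, \<mu>, \<rho>) (\<sigma>', \<mu>', \<rho>').
     \<sigma> * \<rho>' + \<rho> * \<sigma>' + \<mu> \<bullet> (matrix_inv G *v \<mu>'))"

text \<open>The inverse tractor metric; see lemma \<open>tractor_metric_sharp\<close>.\<close>

definition tractor_sharp :: "real ^ 'n ^ 'n \<Rightarrow> 'n tractor \<Rightarrow> 'n::finite tractor"
  where "tractor_sharp G = (\<lambda>(\<sigma>, \<mu>, \<rho>). (\<rho>, G *v \<mu>, \<sigma>))"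

lemma tractor_metric_sharp:
  fixes G :: "real ^ 'n ^ 'n::finite"
  assumes "invertible G" "transpose G = G"
  shows "tractor_metric G (tractor_sharp G E) V = E \<bullet> V"
proof -
  have "(G *v \<mu>) \<bullet> (matrix_inv G *v \<nu>) = \<mu> \<bullet> \<nu>" for \<mu> \<nu> :: "real ^ 'n"
  proof -
    have "(G *v \<mu>) \<bullet> (matrix_inv G *v \<nu>) = (\<mu> v* G) \<bullet> (matrix_inv G *v \<nu>)"
      using transpose_matrix_vector[of G \<mu>] by (simp only: assms(2))
    also have "\<dots> = \<mu> \<bullet> ((G ** matrix_inv G) *v \<nu>)"
      by (simp only: dot_lmul_matrix matrix_vector_mul_assoc)
    also have "\<dots> = \<mu> \<bullet> \<nu>"
      by (simp only: matrix_inv_inverse(1)[OF assms(1)] matrix_vector_mul_lid)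
    finally show ?thesis .
  qed
  then show ?thesis
    by (cases E rule: prod_cases3, cases V rule: prod_cases3)
      (simp add: tractor_metric_def tractor_sharp_def)
qed

text \<open>
  The pullback of the tractor connection along a map with coordinate expression \<open>y\<close>, applied to
  the section \<open>V\<close> along \<open>y\<close> at the point \<open>x\<close> in the direction \<open>u\<close>; \<open>w\<close> is the image of \<open>u\<close>.
\<close>

definition tractor_nabla ::
    "(real ^ 'n \<Rightarrow> real ^ 'n ^ 'n) \<Rightarrow> (real ^ 'm \<Rightarrow> real ^ 'n) \<Rightarrow> (real ^ 'm \<Rightarrow> 'n tractor)
      \<Rightarrow> real ^ 'm::finite \<Rightarrow> real ^ 'm \<Rightarrow> 'n::finite tractor"
  where "tractor_nabla G y V x u =
    (let w = dir_deriv y x u; P = schouten G (y x);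
         \<sigma> = (\<lambda>z. fst (V z)); \<mu> = (\<lambda>z. fst (snd (V z))); \<rho> = (\<lambda>z. snd (snd (V z)))
     in (dir_deriv \<sigma> x u - w \<bullet> \<mu> x,
         (\<chi> b. dir_deriv (\<lambda>z. \<mu> z $ b) x u
            - (\<Sum>a\<in>UNIV. \<Sum>c\<in>UNIV. christoffel G (y x) c a b * w $ a * \<mu> x $ c)
            + (\<Sum>a\<in>UNIV. P $ a $ b * w $ a) * \<sigma> x
            + (\<Sum>a\<in>UNIV. G (y x) $ a $ b * w $ a) * \<rho> x),
         dir_deriv \<rho> x u
            - (\<Sum>a\<in>UNIV. \<Sum>b\<in>UNIV. P $ a $ b * w $ a * (matrix_inv (G (y x)) *v \<mu> x) $ b)))"


section \<open>Tractor forms\<close>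

text \<open>
  Forms are alternating multilinear functions on argument lists of length \<open>k\<close>. They are covariant;
  as $h$ identifies $\mathcal{T}$ with $\mathcal{T}^*$ the position of indices is immaterial.
\<close>

type_synonym 'n tform = "'n tractor list \<Rightarrow> real"

definition alternating_form :: "nat \<Rightarrow> ('v::real_vector list \<Rightarrow> real) \<Rightarrow> bool"
  where "alternating_form k \<omega> \<longleftrightarrow> (\<forall>Vs. length Vs = k \<longrightarrow>
     (\<forall>j<k. linear (\<lambda>X. \<omega> (Vs[j := X]))) \<and>
     (\<forall>i<k. \<forall>j<k. i \<noteq> j \<longrightarrow> Vs ! i = Vs ! j \<longrightarrow> \<omega> Vs = 0))"

definition basis_lists :: "nat \<Rightarrow> 'v::euclidean_space list set"
  where "basis_lists k = {es. set es \<subseteq> Basis \<and> length es = k}"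

text \<open>The full contraction $\Psi^{A_1\cdots A_k}\Psi_{A_1\cdots A_k}$.\<close>

definition form_norm2 :: "real ^ 'n ^ 'n \<Rightarrow> nat \<Rightarrow> 'n::finite tform \<Rightarrow> real"
  where "form_norm2 G k \<Psi> = (\<Sum>es\<in>basis_lists k. \<Psi> (map (tractor_sharp G) es) * \<Psi> es)"

definition tractor_hodge ::
    "real ^ 'n ^ 'n \<Rightarrow> 'n::finite tform \<Rightarrow> nat \<Rightarrow> 'n tform \<Rightarrow> 'n tform"
  where "tractor_hodge G eps k \<Psi> Bs =
     1 / fact k * (\<Sum>es\<in>basis_lists k. eps (map (tractor_sharp G) es @ Bs) * \<Psi> es)"

text \<open>
  Leibniz rule, for arguments with constant components in the given trivialisation:
  $(\nabla_u\Psi)(V_1,\dots,V_k)=u(\Psi(V_1,\dots,V_k))-\sum_j\Psi(V_1,\dots,\nabla_uV_j,\dots,V_k)$.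
\<close>

definition form_nabla ::
    "(real ^ 'n \<Rightarrow> real ^ 'n ^ 'n) \<Rightarrow> (real ^ 'm \<Rightarrow> real ^ 'n) \<Rightarrow> (real ^ 'm \<Rightarrow> 'n tform)
      \<Rightarrow> real ^ 'm::finite \<Rightarrow> real ^ 'm \<Rightarrow> 'n::finite tform"
  where "form_nabla G y \<Psi> x u Vs =
     dir_deriv (\<lambda>z. \<Psi> z Vs) x u
     - (\<Sum>j<length Vs. \<Psi> x (Vs[j := tractor_nabla G y (\<lambda>_. Vs ! j) x u]))"

text \<open>Families of forms along a map into the manifold, indexed by chart and scale.\<close>

type_synonym ('a, 'n, 'b) tform_field = "('a, 'n) chart \<Rightarrow> ('a, 'n) metric \<Rightarrow> 'b \<Rightarrow> 'n tform"

text \<open>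
  Smooth sections of $f^*\Lambda^k\mathcal{T}^*$, for \<open>f\<close> from the manifold with atlas \<open>B\<close> to the
  conformal manifold with atlas \<open>A\<close>.
\<close>

definition tform_section ::
    "('a, 'n::finite) chart set \<Rightarrow> ('a, 'n) metric set \<Rightarrow> ('b, 'm::finite) chart set \<Rightarrow> ('b \<Rightarrow> 'a)
      \<Rightarrow> nat \<Rightarrow> ('a, 'n, 'b) tform_field \<Rightarrow> bool"
  where "tform_section A c B f k \<Psi> \<longleftrightarrow> (\<forall>g\<in>c. \<forall>\<kappa>\<in>A.
     (\<forall>q\<in>f -` fst \<kappa>. alternating_form k (\<Psi> \<kappa> g q)) \<and>
     (\<forall>\<psi>\<in>B. \<forall>Vs. length Vs = k \<longrightarrow>
        smooth_on (loc_dom f \<kappa> \<psi>) (\<lambda>x. \<Psi> \<kappa> g (chart_inv \<psi> x) Vs)) \<and>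
     (\<forall>g'\<in>c. \<forall>\<Omega>. conformal_factor A \<Omega> g g' \<longrightarrow>
        (\<forall>\<kappa>'\<in>A. \<forall>q\<in>f -` (fst \<kappa> \<inter> fst \<kappa>'). \<forall>Vs. length Vs = k \<longrightarrow>
           \<Psi> \<kappa>' g' q (map (tractor_change \<kappa> \<kappa>' (g \<kappa> (f q)) \<Omega> (f q)) Vs) = \<Psi> \<kappa> g q Vs)))"

definition tform_parallel ::
    "('a, 'n::finite) chart set \<Rightarrow> ('a, 'n) metric set \<Rightarrow> ('b, 'm::finite) chart set \<Rightarrow> ('b \<Rightarrow> 'a)
      \<Rightarrow> nat \<Rightarrow> ('a, 'n, 'b) tform_field \<Rightarrow> bool"
  where "tform_parallel A c B f k \<Psi> \<longleftrightarrow>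
     (\<forall>g\<in>c. \<forall>\<kappa>\<in>A. \<forall>\<psi>\<in>B. \<forall>x\<in>loc_dom f \<kappa> \<psi>. \<forall>u Vs. length Vs = k \<longrightarrow>
        form_nabla (loc_metric g \<kappa>) (loc_map f \<kappa> \<psi>) (\<lambda>z. \<Psi> \<kappa> g (chart_inv \<psi> z)) x u Vs = 0)"

text \<open>
  The orientation of $\mathcal{T}$ induced by that of \<open>M\<close> is only a convention; here the frame
  consisting of the $\sigma$-slot, the coordinate covectors and the $\rho$-slot is positive.
\<close>

definition tractor_volume_form ::
    "('a, 'n::finite) chart set \<Rightarrow> ('a, 'n) metric set \<Rightarrow> ('a, 'n, 'a) tform_field \<Rightarrow> bool"
  where "tractor_volume_form A c eps \<longleftrightarrow>
     tform_section A c A id (CARD('n) + 2) eps \<and>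
     tform_parallel A c A id (CARD('n) + 2) eps \<and>
     (\<forall>g\<in>c. \<forall>\<kappa>\<in>A. \<forall>p\<in>fst \<kappa>.
        form_norm2 (g \<kappa> p) (CARD('n) + 2) (eps \<kappa> g p) = - fact (CARD('n) + 2) \<and>
        eps \<kappa> g p ([(1, 0, 0)] @ map (\<lambda>e. (0, e, 0)) coord_frame @ [(0, 0, 1)]) > 0)"


section \<open>Submanifolds\<close>

text \<open>
  In this section \<open>y\<close> is the coordinate expression of an immersion and \<open>G\<close> the ambient metric in
  coordinates.
\<close>

definition induced_metric ::
    "(real ^ 'n \<Rightarrow> real ^ 'n ^ 'n) \<Rightarrow> (real ^ 'm \<Rightarrow> real ^ 'n::finite) \<Rightarrow> real ^ 'm::finite \<Rightarrow> real ^ 'm ^ 'm"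
  where "induced_metric G y x = (\<chi> i j. pderiv_at y x i \<bullet> (G (y x) *v pderiv_at y x j))"

text \<open>$I\!I_{ij}{}^c=\nabla_i(\Pi^c_jV^j)-\Pi^c_jD_iV^j$ for \<open>V\<close> the \<open>j\<close>-th coordinate field.\<close>

definition second_ff ::
    "(real ^ 'n \<Rightarrow> real ^ 'n ^ 'n) \<Rightarrow> (real ^ 'm \<Rightarrow> real ^ 'n::finite) \<Rightarrow> real ^ 'm::finite
      \<Rightarrow> 'm \<Rightarrow> 'm \<Rightarrow> real ^ 'n"
  where "second_ff G y x i j =
     (\<chi> c. pderiv_at (\<lambda>z. pderiv_at y z j $ c) x i
        + (\<Sum>a\<in>UNIV. \<Sum>b\<in>UNIV. christoffel G (y x) c a b * pderiv_at y x i $ a * pderiv_at y x j $ b))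
     - (\<Sum>k\<in>UNIV. christoffel (induced_metric G y) x k i j *\<^sub>R pderiv_at y x k)"

definition mean_curvature ::
    "(real ^ 'n \<Rightarrow> real ^ 'n ^ 'n) \<Rightarrow> (real ^ 'm \<Rightarrow> real ^ 'n::finite) \<Rightarrow> real ^ 'm::finite \<Rightarrow> real ^ 'n"
  where "mean_curvature G y x = (1 / real CARD('m)) *\<^sub>R
     (\<Sum>i\<in>UNIV. \<Sum>j\<in>UNIV. matrix_inv (induced_metric G y x) $ i $ j *\<^sub>R second_ff G y x i j)"

definition normal_vectors ::
    "(real ^ 'n \<Rightarrow> real ^ 'n ^ 'n) \<Rightarrow> (real ^ 'm \<Rightarrow> real ^ 'n::finite) \<Rightarrow> real ^ 'm::finite \<Rightarrow> (real ^ 'n) set"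
  where "normal_vectors G y x = {v. \<forall>u. v \<bullet> (G (y x) *v dir_deriv y x u) = 0}"

definition normal_tractor ::
    "(real ^ 'n \<Rightarrow> real ^ 'n ^ 'n) \<Rightarrow> (real ^ 'm \<Rightarrow> real ^ 'n::finite) \<Rightarrow> real ^ 'm::finite
      \<Rightarrow> real ^ 'n \<Rightarrow> 'n tractor"
  where "normal_tractor G y x v = (0, G (y x) *v v, v \<bullet> (G (y x) *v mean_curvature G y x))"

definition normal_tractors ::
    "(real ^ 'n \<Rightarrow> real ^ 'n ^ 'n) \<Rightarrow> (real ^ 'm \<Rightarrow> real ^ 'n::finite) \<Rightarrow> real ^ 'm::finite \<Rightarrow> 'n tractor set"
  where "normal_tractors G y x = normal_tractor G y x ` normal_vectors G y x"

definition normal_tractors_perp ::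
    "(real ^ 'n \<Rightarrow> real ^ 'n ^ 'n) \<Rightarrow> (real ^ 'm \<Rightarrow> real ^ 'n::finite) \<Rightarrow> real ^ 'm::finite \<Rightarrow> 'n tractor set"
  where "normal_tractors_perp G y x =
     {V. \<forall>Z\<in>normal_tractors G y x. tractor_metric (G (y x)) V Z = 0}"

definition normal_proj ::
    "(real ^ 'n \<Rightarrow> real ^ 'n ^ 'n) \<Rightarrow> (real ^ 'm \<Rightarrow> real ^ 'n::finite) \<Rightarrow> real ^ 'm::finite
      \<Rightarrow> 'n tractor \<Rightarrow> 'n tractor"
  where "normal_proj G y x V =
     (THE W. W \<in> normal_tractors G y x \<and> V - W \<in> normal_tractors_perp G y x)"

text \<open>
  The canonical isometric identification of $\mathcal{T}\Sigma$ with $\mathcal{N}^\perp$. In a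
  minimal scale it is $(\sigma,\nu_i,\rho)\mapsto(\sigma,\Pi^i_a\nu_i,\rho)$; in a general scale the
  transformation laws of both tractor bundles and of \<open>H\<close> turn this into
  $(\sigma,\ \Pi^i_a\nu_i-H_a\sigma,\ \rho-\tfrac12H^bH_b\sigma)$.
\<close>

definition tractor_incl ::
    "(real ^ 'n \<Rightarrow> real ^ 'n ^ 'n) \<Rightarrow> (real ^ 'm \<Rightarrow> real ^ 'n::finite) \<Rightarrow> real ^ 'm::finite
      \<Rightarrow> 'm tractor \<Rightarrow> 'n tractor"
  where "tractor_incl G y x = (\<lambda>(\<sigma>, \<nu>, \<rho>).
     let H = mean_curvature G y x
     in (\<sigma>,
         G (y x) *v dir_deriv y x (matrix_inv (induced_metric G y x) *v \<nu>) - \<sigma> *\<^sub>R (G (y x) *v H),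
         \<rho> - 1 / 2 * (H \<bullet> (G (y x) *v H)) * \<sigma>))"

text \<open>
  $u^iX^J\mathbb{L}_{iJ}{}^C$ at \<open>x\<close>: the common value of
  $\mathrm{N}^C_A\,u^i\nabla_i(\Pi^A_JV^J)$ for all smooth sections \<open>V\<close> of $\mathcal{T}\Sigma$ over the
  coordinate domain \<open>S\<close> with value \<open>X\<close> at \<open>x\<close>. Sections of $\mathcal{T}\Sigma$ are written in the
  splitting given by the induced metric.
\<close>

definition tractor_second_ff ::
    "(real ^ 'n \<Rightarrow> real ^ 'n ^ 'n) \<Rightarrow> (real ^ 'm \<Rightarrow> real ^ 'n::finite) \<Rightarrow> (real ^ 'm) set
      \<Rightarrow> real ^ 'm::finite \<Rightarrow> real ^ 'm \<Rightarrow> 'm tractor \<Rightarrow> 'n tractor"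
  where "tractor_second_ff G y S x u X = (THE Y. \<forall>V. smooth_on S V \<and> V x = X \<longrightarrow>
     Y = normal_proj G y x (tractor_nabla G y (\<lambda>z. tractor_incl G y z (V z)) x u))"

text \<open>
  The covariant derivative of a field \<open>E\<close> of endomorphisms of the tractor bundle, applied to \<open>X\<close>
  (extended with constant components).
\<close>

definition endo_nabla ::
    "(real ^ 'n \<Rightarrow> real ^ 'n ^ 'n) \<Rightarrow> (real ^ 'm \<Rightarrow> real ^ 'n)
      \<Rightarrow> (real ^ 'm \<Rightarrow> 'n tractor \<Rightarrow> 'n tractor)
      \<Rightarrow> real ^ 'm::finite \<Rightarrow> real ^ 'm \<Rightarrow> 'n::finite tractor \<Rightarrow> 'n tractor"
  where "endo_nabla G y E x u X =
     tractor_nabla G y (\<lambda>z. E z X) x u - E x (tractor_nabla G y (\<lambda>_. X) x u)"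

definition tractor_second_ff_zero ::
    "('a, 'n::finite) chart set \<Rightarrow> ('a, 'n) metric set \<Rightarrow> ('b, 'm::finite) chart set \<Rightarrow> ('b \<Rightarrow> 'a) \<Rightarrow> bool"
  where "tractor_second_ff_zero A c B f \<longleftrightarrow>
     (\<forall>g\<in>c. \<forall>\<kappa>\<in>A. \<forall>\<psi>\<in>B. \<forall>x\<in>loc_dom f \<kappa> \<psi>. \<forall>u X.
        tractor_second_ff (loc_metric g \<kappa>) (loc_map f \<kappa> \<psi>) (loc_dom f \<kappa> \<psi>) x u X = 0)"

definition normal_proj_parallel ::
    "('a, 'n::finite) chart set \<Rightarrow> ('a, 'n) metric set \<Rightarrow> ('b, 'm::finite) chart set \<Rightarrow> ('b \<Rightarrow> 'a) \<Rightarrow> bool"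
  where "normal_proj_parallel A c B f \<longleftrightarrow>
     (\<forall>g\<in>c. \<forall>\<kappa>\<in>A. \<forall>\<psi>\<in>B. \<forall>x\<in>loc_dom f \<kappa> \<psi>. \<forall>u X.
        endo_nabla (loc_metric g \<kappa>) (loc_map f \<kappa> \<psi>)
          (normal_proj (loc_metric g \<kappa>) (loc_map f \<kappa> \<psi>)) x u X = 0)"

text \<open>
  Compatibility with the orientations: $N$ is positive on the normal tractors of $n_1,\dots,n_d$
  if a positive frame of $T\Sigma$ followed by $n_1,\dots,n_d$ is a positive frame of $TM$.
\<close>

definition tractor_normal_form ::
    "('a, 'n::finite) chart set \<Rightarrow> ('a, 'n) metric set \<Rightarrow> ('b, 'm::finite) chart set \<Rightarrow> ('b \<Rightarrow> 'a)
      \<Rightarrow> ('a, 'n, 'b) tform_field \<Rightarrow> bool"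
  where "tractor_normal_form A c B f N \<longleftrightarrow>
     (let d = CARD('n) - CARD('m) in
      tform_section A c B f d N \<and>
      (\<forall>g\<in>c. \<forall>\<kappa>\<in>A. \<forall>\<psi>\<in>B. \<forall>q\<in>fst \<psi> \<inter> f -` fst \<kappa>.
        let G = loc_metric g \<kappa>; y = loc_map f \<kappa> \<psi>; x = snd \<psi> q in
        (\<forall>Vs. length Vs = d \<longrightarrow> set Vs \<inter> normal_tractors_perp G y x \<noteq> {} \<longrightarrow> N \<kappa> g q Vs = 0) \<and>
        form_norm2 (G (y x)) d (N \<kappa> g q) = fact d \<and>
        (\<forall>ns. length ns = d \<longrightarrow> set ns \<subseteq> normal_vectors G y x \<longrightarrow>
           list_det (map (dir_deriv y x) coord_frame @ ns) > 0 \<longrightarrow>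
           N \<kappa> g q (map (normal_tractor G y x) ns) > 0)))"

definition normal_form_star ::
    "('b \<Rightarrow> 'a) \<Rightarrow> ('a, 'n::finite, 'a) tform_field \<Rightarrow> nat \<Rightarrow> ('a, 'n, 'b) tform_field
      \<Rightarrow> ('a, 'n, 'b) tform_field"
  where "normal_form_star f eps d N =
     (\<lambda>\<kappa> g q. tractor_hodge (g \<kappa> (f q)) (eps \<kappa> g (f q)) d (N \<kappa> g q))"

end

theory Submission
  imports Defs
begin

text \<open>
  Everything is checked at a point, in a chart and a scale. There the pulled back tractor connection
  is $\nabla_u V=dV(u)+AV$ and a field $E$ of endomorphisms has the covariant derivative
  $E'=dE(u)+AE-EA$. Let $E$ be the projection onto the normal tractors. Differentiating $E^2=E$ shows
  that $E'$ exchanges $\mathcal{N}$ and $\mathcal{N}^\perp$; as the tractor metric is parallel, $E'$ is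
  self-adjoint, so it vanishes as soon as it vanishes on $\mathcal{N}^\perp$. Differentiating
  $E\,\Pi V=0$ gives $\mathbb{L}=-E'\circ\Pi$, hence 1 and 2 are equivalent.

  Differentiating $N(X,\dots)=0$ for $X$ in $\mathcal{N}^\perp$ gives
  $(\nabla N)(X,\dots)=N(E'X,\dots)$ for such $X$. If $\nabla N=0$, nondegeneracy of $N$ on
  $\mathcal{N}$ yields $E'=0$ on $\mathcal{N}^\perp$. Conversely, if $E'=0$ then $\nabla N$ is a form of
  top degree on $\mathcal{N}$, so $\nabla N=\lambda N$, and $\lambda=0$ as $N$ has constant length.
  Finally $\nabla\star N=\star\nabla N$ because the volume form and the metric are parallel, and
  $\star$ is injective.
\<close>

section \<open>Alternating forms\<close>

text \<open>For a fixed direction u the equivalences are linear algebra once three product rules are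
  available: for fields of linear maps, for forms with varying arguments, and for contractions of
  forms. Forms are functions on argument lists, with no tensor algebra behind them. Contractions are
  therefore sums over lists of vectors of the auxiliary Euclidean basis, and signs of permutations
  are replaced by exchanges of two entries. The tractor metric enters through its inverse, a map s
  from covectors to vectors. With A* the Euclidean adjoint of A, being parallel reads ds(u) = -As -
  sA*, and self-adjointness of E becomes symmetry of Es for the Euclidean inner product. The
  analytic obstacle is the differentiability of E. It contains the mean curvature, hence second
  derivatives of the immersion and Christoffel symbols of the induced metric. An explicit formula
  for E replaces its definition by unique existence, and Cramer's rule takes care of the inverse
  matrices.\<close>

lemma alternating_form_linear:
  assumes "alternating_form k \<omega>" "length Vs = k" "j < k"
  shows "linear (\<lambda>X. \<omega> (Vs[j := X]))"
  using assms unfolding alternating_form_def by blast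

lemma alternating_form_repeat:
  assumes "alternating_form k \<omega>" "length Vs = k" "i < k" "j < k" "i \<noteq> j" "Vs ! i = Vs ! j"
  shows "\<omega> Vs = 0"
  using assms unfolding alternating_form_def by blast

lemma alternating_form_not_distinct:
  assumes "alternating_form k \<omega>" "length Vs = k" "\<not> distinct Vs"
  shows "\<omega> Vs = 0"
proof -
  obtain i j where "i < k" "j < k" "i \<noteq> j" "Vs ! i = Vs ! j"
    using assms(2,3) by (auto simp: distinct_conv_nth)
  then show ?thesis using alternating_form_repeat[OF assms(1,2)] by blast
qed

lemma alternating_form_swap:
  assumes alt: "alternating_form k \<omega>" and len: "length Vs = k"
    and ij: "i < k" "j < k" "i \<noteq> j"
  shows "\<omega> (Vs[i := Vs ! j, j := Vs ! i]) = - \<omega> Vs"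
proof -
  define F where "F a b = \<omega> (Vs[i := a, j := b])" for a b
  have lin2: "linear (\<lambda>b. F a b)" for a
    unfolding F_def using alternating_form_linear[OF alt, of "Vs[i := a]" j] len ij by simp
  have lin1: "linear (\<lambda>a. F a b)" for b
    using alternating_form_linear[OF alt, of "Vs[j := b]" i] len ij
    by (simp add: F_def list_update_swap[of i j])
  have diag: "F a a = 0" for a
    unfolding F_def using len ij
    by (intro alternating_form_repeat[OF alt, of _ i j]) auto
  have "F (Vs ! i + Vs ! j) (Vs ! i + Vs ! j)
      = F (Vs ! i) (Vs ! i) + F (Vs ! j) (Vs ! i) + (F (Vs ! i) (Vs ! j) + F (Vs ! j) (Vs ! j))"
    by (simp only: linear_add[OF lin1] linear_add[OF lin2])
  then have "F (Vs ! j) (Vs ! i) = - F (Vs ! i) (Vs ! j)" by (simp add: diag)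
  then show ?thesis by (simp add: F_def)
qed

text \<open>Permutations are products of transpositions. This carries a property from a list to its
  rearrangements without introducing signs of permutations.\<close>

lemma swap_invariant_mset:
  assumes swap: "\<And>xs i j. length xs = k \<Longrightarrow> P xs \<Longrightarrow> i < k \<Longrightarrow> j < k \<Longrightarrow> i \<noteq> j
                   \<Longrightarrow> P (xs[i := xs ! j, j := xs ! i])"
    and eq: "mset xs = mset ys" and len: "length ys = k" and P: "P ys"
  shows "P xs"
proof -
  obtain p where p: "p permutes {..<k}" and xs: "xs = permute_list p ys"
    using mset_eq_permutation[OF eq] len by metis
  \<comment> \<open>The list is generalised because composing with a transposition applies it to the
    list first and leaves \<open>p\<close> to act on the result.\<close>
  have "\<forall>ys. length ys = k \<longrightarrow> P ys \<longrightarrow> P (permute_list p ys)"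
    using p finite_lessThan
  proof (induction rule: permutes_induct)
    case id
    then show ?case by simp
  next
    case (swap a b p)
    show ?case
    proof (intro allI impI)
      fix ys :: "'a list" assume ys: "length ys = k" "P ys"
      have "permute_list (Transposition.transpose a b) ys = ys[a := ys ! b, b := ys ! a]"
        using ys swap.hyps
        by (intro nth_equalityI) (auto simp: permute_list_def nth_list_update Transposition.transpose_def)
      moreover have "P (permute_list (Transposition.transpose a b) ys)"
      proof (cases "a = b")
        case True then show ?thesis using ys by simp
      next
        case False
        then show ?thesis unfolding calculation using assms(1)[OF ys] swap.hyps by simp
      qed
      moreover have "permute_list (Transposition.transpose a b \<circ> p) ys = permute_list p (permute_list (Transposition.transpose a b) ys)"
        using swap ys by (intro permute_list_compose) simp
      ultimately show "P (permute_list (Transposition.transpose a b \<circ> p) ys)" using swap ys by simp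
    qed
  qed
  then show ?thesis using xs len P by blast
qed

lemma alternating_form_zero_on_span:
  assumes alt: "alternating_form k \<omega>"
    and zero: "\<And>Vs. length Vs = k \<Longrightarrow> set Vs \<subseteq> S \<Longrightarrow> \<omega> Vs = 0"
    and len: "length Vs = k" and Vs: "set Vs \<subseteq> span S"
  shows "\<omega> Vs = 0"
proof -
  \<comment> \<open>Linear extension slot by slot: the first \<open>p\<close> entries already range
    over the span, the others still over \<open>S\<close>.\<close>
  have "\<omega> Vs = 0" if "p \<le> k" "length Vs = k" "set (take p Vs) \<subseteq> span S" "set (drop p Vs) \<subseteq> S"
    for p Vs
    using that
  proof (induction p arbitrary: Vs)
    case 0
    then show ?case using zero by simp
  next
    case (Suc p)
    have "(\<lambda>X. \<omega> (Vs[p := X])) (Vs ! p) = 0"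
    proof (rule linear_eq_0_on_span[of _ S])
      show "linear (\<lambda>X. \<omega> (Vs[p := X]))"
        using alternating_form_linear[OF alt] Suc.prems by simp
      show "\<omega> (Vs[p := X]) = 0" if "X \<in> S" for X
      proof (rule Suc.IH)
        show "p \<le> k" "length (Vs[p := X]) = k" using Suc.prems by auto
        have "set (take p Vs) \<subseteq> set (take (Suc p) Vs)" by (intro set_take_subset_set_take) simp
        then show "set (take p (Vs[p := X])) \<subseteq> span S" using Suc.prems by auto
        have "drop p (Vs[p := X]) = X # drop (Suc p) Vs"
          using Suc.prems by (metis Cons_nth_drop_Suc Suc_le_eq drop_update_cancel length_list_update lessI nth_list_update_eq)
        then show "set (drop p (Vs[p := X])) \<subseteq> S" using Suc.prems that by simp
      qed
      have "Vs ! p \<in> set (take (Suc p) Vs)"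
        using Suc.prems by (metis Suc_le_eq in_set_conv_nth length_take lessI min.absorb2 nth_take)
      then show "Vs ! p \<in> span S" using Suc.prems by blast
    qed
    then show ?case by simp
  qed
  from this[of k Vs] show ?thesis using len Vs by simp
qed

text \<open>A list of k entries drawn from \<open>Ns\<close> either repeats a vector or is a
  rearrangement of \<open>Ns\<close>; by counting, the second case makes \<open>Ns\<close> itself
  distinct. Linear extension then reaches the span.\<close>

lemma alternating_form_zero_if_zero_on_spanning_list:
  assumes alt: "alternating_form k \<omega>" and zero: "\<omega> Ns = 0" and Ns: "length Ns = k"
    and len: "length Vs = k" and Vs: "set Vs \<subseteq> span (set Ns)"
  shows "\<omega> Vs = 0"
proof (rule alternating_form_zero_on_span[OF alt _ len Vs])
  fix Ws assume Ws: "length Ws = k" "set Ws \<subseteq> set Ns"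
  show "\<omega> Ws = 0"
  proof (cases "distinct Ws")
    case False
    then show ?thesis using alternating_form_not_distinct[OF alt] Ws by blast
  next
    case True
    then have "card (set Ws) = k" using Ws distinct_card by blast
    moreover have "card (set Ns) \<le> k" using Ns card_length by blast
    ultimately have eq: "set Ws = set Ns" 
      using Ws(2) by (intro card_seteq) auto
    then have "distinct Ns" using \<open>card (set Ws) = k\<close> Ns card_distinct by metis
    then have "mset Ws = mset Ns" using True eq set_eq_iff_mset_eq_distinct by blast
    then show ?thesis
      by (rule swap_invariant_mset[of k "\<lambda>Vs. \<omega> Vs = 0", rotated])
        (use Ns zero alternating_form_swap[OF alt] in auto)
  qed
qed

section \<open>Contractions as sums over lists of basis vectors\<close>

lemma finite_basis_lists: "finite (basis_lists k :: 'v::euclidean_space list set)"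
  unfolding basis_lists_def by (rule finite_lists_length_eq) simp

lemma length_basis_lists: "es \<in> basis_lists k \<Longrightarrow> length es = k"
  by (simp add: basis_lists_def)

lemma linear_euclidean_expansion:
  fixes f :: "'v::euclidean_space \<Rightarrow> 'w::real_vector"
  assumes "linear f"
  shows "f X = (\<Sum>b\<in>Basis. (X \<bullet> b) *\<^sub>R f b)"
proof -
  have "f X = f (\<Sum>b\<in>Basis. (X \<bullet> b) *\<^sub>R b)" by (simp add: euclidean_representation)
  then show ?thesis using assms by (simp add: linear_sum linear_scale)
qed

lemma alternating_form_expansion:
  fixes \<omega> :: "'v::euclidean_space list \<Rightarrow> real"
  assumes "alternating_form k \<omega>" "length Vs = k" "j < k"
  shows "\<omega> (Vs[j := X]) = (\<Sum>b\<in>Basis. (X \<bullet> b) * \<omega> (Vs[j := b]))"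
  using linear_euclidean_expansion[OF alternating_form_linear[OF assms], of X] by simp

text \<open>Both sides expand to a double sum over a basis list and a basis vector; exchanging the vector
  with the \<open>j\<close>-th entry of the list is an involution of the index set.\<close>

lemma sum_basis_lists_adjoint:
  fixes \<phi> \<psi> :: "'v::euclidean_space list \<Rightarrow> real"
  assumes \<phi>: "\<And>Vs. length Vs = k \<Longrightarrow> linear (\<lambda>X. \<phi> (Vs[j := X]))"
    and \<psi>: "\<And>Vs. length Vs = k \<Longrightarrow> linear (\<lambda>X. \<psi> (Vs[j := X]))"
    and A: "linear A" and j: "j < k"
  shows "(\<Sum>es\<in>basis_lists k. \<phi> (es[j := adjoint A (es ! j)]) * \<psi> es)
       = (\<Sum>es\<in>basis_lists k. \<phi> es * \<psi> (es[j := A (es ! j)]))"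
proof -
  let ?I = "(basis_lists k :: 'v list set) \<times> (Basis :: 'v set)"
  define \<tau> where "\<tau> p = ((fst p)[j := snd p], fst p ! j)" for p :: "'v list \<times> 'v"
  have exp\<phi>: "\<phi> (es[j := X]) = (\<Sum>b\<in>Basis. (X \<bullet> b) * \<phi> (es[j := b]))" if "es \<in> basis_lists k" for es X
    using linear_euclidean_expansion[OF \<phi>[OF length_basis_lists[OF that]], of X] by simp
  have exp\<psi>: "\<psi> (es[j := X]) = (\<Sum>b\<in>Basis. (X \<bullet> b) * \<psi> (es[j := b]))" if "es \<in> basis_lists k" for es X
    using linear_euclidean_expansion[OF \<psi>[OF length_basis_lists[OF that]], of X] by simp
  have "(\<Sum>es\<in>basis_lists k. \<phi> (es[j := adjoint A (es ! j)]) * \<psi> es)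
      = (\<Sum>(es, b)\<in>?I. (es ! j \<bullet> A b) * \<phi> (es[j := b]) * \<psi> es)"
    unfolding sum.cartesian_product[symmetric]
    by (rule sum.cong[OF refl], subst exp\<phi>)
      (simp_all add: sum_distrib_right adjoint_works[OF A] inner_commute)
  also have "\<dots> = (\<Sum>(es, b)\<in>?I. (b \<bullet> A (es ! j)) * \<phi> es * \<psi> (es[j := b]))"
  proof (rule sum.reindex_bij_witness[where i = \<tau> and j = \<tau>])
    fix p assume p: "p \<in> ?I"
    obtain es b where eq: "p = (es, b)" and es: "set es \<subseteq> Basis" "length es = k" and b: "b \<in> Basis"
      using p by (auto simp: basis_lists_def)
    show "\<tau> (\<tau> p) = p" using eq es j by (simp add: \<tau>_def)
    show "\<tau> p \<in> ?I" using eq es j b set_update_subset_insert[of es j b]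
      by (auto simp: \<tau>_def basis_lists_def)
    show "\<tau> (\<tau> p) = p" using eq es j by (simp add: \<tau>_def)
    show "\<tau> p \<in> ?I" using eq es j b set_update_subset_insert[of es j b]
      by (auto simp: \<tau>_def basis_lists_def)
    show "(case \<tau> p of (es, b) \<Rightarrow> (b \<bullet> A (es ! j)) * \<phi> es * \<psi> (es[j := b]))
        = (case p of (es, b) \<Rightarrow> (es ! j \<bullet> A b) * \<phi> (es[j := b]) * \<psi> es)"
      using eq es j by (simp add: \<tau>_def)
  qed
  also have "\<dots> = (\<Sum>es\<in>basis_lists k. \<phi> es * \<psi> (es[j := A (es ! j)]))"
    unfolding sum.cartesian_product[symmetric]
    by (rule sum.cong[OF refl], subst exp\<psi>)
      (simp_all add: sum_distrib_left inner_commute mult_ac)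
  finally show ?thesis .
qed

text \<open>A suitable \<open>Bs\<close> isolates one coefficient of \<psi>: for distinct
  \<open>es0\<close> it consists of the images of the remaining basis vectors. A list that is not a
  rearrangement of \<open>es0\<close> then repeats a vector in \<psi> or in \<epsilon>, and all
  rearrangements contribute the same product, as both factors change sign together.\<close>

lemma contraction_injective:
  fixes \<epsilon> \<psi> :: "'v::euclidean_space list \<Rightarrow> real"
  assumes \<epsilon>: "alternating_form (k + l) \<epsilon>" "length Us = k + l" "\<epsilon> Us \<noteq> 0"
    and \<psi>: "alternating_form k \<psi>"
    and dim: "DIM('v) = k + l" and s: "linear s" "surj s"
    and zero: "\<And>Bs. length Bs = l \<Longrightarrow> (\<Sum>es\<in>basis_lists k. \<epsilon> (map s es @ Bs) * \<psi> es) = 0"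
    and Vs: "length Vs = k"
  shows "\<psi> Vs = 0"
proof (rule alternating_form_zero_on_span[OF \<psi> _ Vs])
  show "set Vs \<subseteq> span Basis" by simp
  fix es0 :: "'v list" assume es0: "length es0 = k" "set es0 \<subseteq> Basis"
  show "\<psi> es0 = 0"
  proof (cases "distinct es0")
    case False
    then show ?thesis using alternating_form_not_distinct[OF \<psi>] es0 by blast
  next
    case True
    obtain bs where bs: "set bs = Basis - set es0" "distinct bs"
      using finite_distinct_list[of "Basis - set es0"] by auto
    have lbs: "length bs = l"
      using distinct_card[OF bs(2)] distinct_card[OF True] es0 dim
      by (simp add: bs(1) card_Diff_subset)
    define Bs where "Bs = map s bs"
    have Bs: "length Bs = l" by (simp add: Bs_def lbs)
    define F where "F es = \<epsilon> (map s es @ Bs) * \<psi> es" for es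
    \<comment> \<open>By surjectivity of \<open>s\<close> these k + l vectors span, so a zero here
      would make \<epsilon> vanish on \<open>Us\<close> too.\<close>
    have ne: "\<epsilon> (map s es0 @ Bs) \<noteq> 0"
    proof
      assume *: "\<epsilon> (map s es0 @ Bs) = 0"
      have "set (map s es0 @ Bs) = s ` Basis" using bs es0 by (auto simp: Bs_def)
      then have "span (set (map s es0 @ Bs)) = UNIV"
        using s by (simp add: linear_span_image)
      then have "\<epsilon> Us = 0"
        using alternating_form_zero_if_zero_on_spanning_list[OF \<epsilon>(1) *, of Us] \<epsilon>(2) es0 Bs by simp
      then show False using \<epsilon>(3) by simp
    qed
    have F0: "F es = 0" if es: "es \<in> basis_lists k" "mset es \<noteq> mset es0" for es
    proof (cases "distinct es")
      case False
      then show ?thesis using alternating_form_not_distinct[OF \<psi>] es by (simp add: F_def basis_lists_def)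
    next
      case d: True
      have "\<not> set es \<subseteq> set es0"
      proof
        assume "set es \<subseteq> set es0"
        then have "set es = set es0"
          using es0 es distinct_card[OF d] distinct_card[OF True]
          by (intro card_seteq) (auto simp: basis_lists_def)
        then show False using es(2) d True set_eq_iff_mset_eq_distinct by blast
      qed
      then obtain e where "e \<in> set es" "e \<in> set bs" using es bs by (auto simp: basis_lists_def)
      then have "\<not> distinct (map s es @ Bs)" by (auto simp: Bs_def)
      then have "\<epsilon> (map s es @ Bs) = 0"
        using alternating_form_not_distinct[OF \<epsilon>(1)] es Bs by (simp add: basis_lists_def)
      then show ?thesis by (simp add: F_def)
    qed
    have F1: "F es = F es0" if "mset es = mset es0" for es
    proof (rule swap_invariant_mset[of k "\<lambda>es. F es = F es0", OF _ that es0(1) refl])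
      fix xs :: "'v list" and i j
      assume xs: "length xs = k" "F xs = F es0" "i < k" "j < k" "i \<noteq> j"
      have "\<epsilon> ((map s xs @ Bs)[i := (map s xs @ Bs) ! j, j := (map s xs @ Bs) ! i]) = - \<epsilon> (map s xs @ Bs)"
        using xs Bs by (intro alternating_form_swap[OF \<epsilon>(1)]) auto
      moreover have "(map s xs @ Bs)[i := (map s xs @ Bs) ! j, j := (map s xs @ Bs) ! i]
          = map s (xs[i := xs ! j, j := xs ! i]) @ Bs"
        using xs by (simp add: list_update_append map_update nth_append)
      ultimately show "F (xs[i := xs ! j, j := xs ! i]) = F es0"
        using alternating_form_swap[OF \<psi> xs(1,3,4,5)] xs(2) by (simp add: F_def)
    qed
    \<comment> \<open>The rearrangements of \<open>es0\<close>. Since they contribute equally, a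
      nonzero cardinality is enough, and its value k! need not be computed.\<close>
    define M where "M = {es \<in> basis_lists k. mset es = mset es0}"
    have "es0 \<in> M" using es0 by (simp add: M_def basis_lists_def)
    moreover have "finite M" by (simp add: M_def finite_basis_lists)
    ultimately have "card M \<noteq> 0" by auto
    have "0 = (\<Sum>es\<in>basis_lists k. F es)" using zero[OF Bs] by (simp add: F_def)
    also have "\<dots> = (\<Sum>es\<in>M. F es)"
      by (rule sum.mono_neutral_right) (use F0 finite_basis_lists in \<open>auto simp: M_def\<close>)
    also have "\<dots> = (\<Sum>es\<in>M. F es0)" by (rule sum.cong[OF refl]) (unfold M_def mem_Collect_eq, blast intro: F1)
    also have "\<dots> = real (card M) * F es0" by simp
    finally have "F es0 = 0" using \<open>card M \<noteq> 0\<close> by simp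
    then show ?thesis using ne by (simp add: F_def)
  qed
qed

section \<open>Covariant derivatives of forms\<close>

lemma has_derivative_dir_deriv:
  assumes "f differentiable (at x)"
  shows "(f has_derivative dir_deriv f x) (at x)"
  using assms by (simp add: frechet_derivative_works)

lemma dir_deriv_eqI:
  assumes "(f has_derivative f') (at x)"
  shows "dir_deriv f x u = f' u"
  using frechet_derivative_at[OF assms] by simp

text \<open>Holds also where no derivative exists: \<open>frechet_derivative\<close> chooses from
  the set of derivatives, and the two functions have the same set.\<close>

lemma dir_deriv_cong_open:
  assumes "open S" "x \<in> S" "\<And>z. z \<in> S \<Longrightarrow> f z = g z"
  shows "dir_deriv f x = dir_deriv g x"
proof -
  have "(f has_derivative D) (at x) \<longleftrightarrow> (g has_derivative D) (at x)" for D
    using has_derivative_transform_within_open[OF _ assms(1,2), of f D UNIV g]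
      has_derivative_transform_within_open[OF _ assms(1,2), of g D UNIV f] assms(3) by auto
  then show ?thesis by (simp add: frechet_derivative_def)
qed

lemma differentiable_cong_open:
  assumes "f differentiable (at x)" "open S" "x \<in> S" "\<And>z. z \<in> S \<Longrightarrow> f z = g z"
  shows "g differentiable (at x)"
proof -
  obtain D where "(f has_derivative D) (at x)" using assms(1) by (auto simp: differentiable_def)
  then have "(g has_derivative D) (at x)"
    by (rule has_derivative_transform_within_open[OF _ assms(2,3)]) (rule assms(4))
  then show ?thesis by (auto simp: differentiable_def)
qed

text \<open>\<open>form_nabla\<close> with the geometry abstracted away: \<open>A\<close> stands for
  the connection in the direction \<open>u\<close> on sections with constant components.\<close>

definition form_cov ::
    "('v \<Rightarrow> 'v) \<Rightarrow> ('x::real_normed_vector \<Rightarrow> 'v list \<Rightarrow> real) \<Rightarrow> 'x \<Rightarrow> 'x \<Rightarrow> 'v list \<Rightarrow> real"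
  where "form_cov A \<Phi> x u Vs =
    dir_deriv (\<lambda>z. \<Phi> z Vs) x u - (\<Sum>j<length Vs. \<Phi> x (Vs[j := A (Vs ! j)]))"

text \<open>Alternation is asked on all of \<open>S\<close>, since it has to survive
  differentiation; regularity is asked at \<open>x\<close> alone.\<close>

definition differentiable_form :: "nat \<Rightarrow> 'x::real_normed_vector set \<Rightarrow> 'x \<Rightarrow> ('x \<Rightarrow> 'v::euclidean_space list \<Rightarrow> real) \<Rightarrow> bool"
  where "differentiable_form k S x \<Phi> \<longleftrightarrow> (\<forall>z\<in>S. alternating_form k (\<Phi> z)) \<and>
    (\<forall>Vs. length Vs = k \<longrightarrow> (\<lambda>z. \<Phi> z Vs) differentiable (at x))"

lemma differentiable_form_alternating: "differentiable_form k S x \<Phi> \<Longrightarrow> z \<in> S \<Longrightarrow> alternating_form k (\<Phi> z)"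
  by (simp add: differentiable_form_def)

lemma differentiable_form_differentiable:
  "differentiable_form k S x \<Phi> \<Longrightarrow> length Vs = k \<Longrightarrow> (\<lambda>z. \<Phi> z Vs) differentiable (at x)"
  by (simp add: differentiable_form_def)

lemma alternating_form_dir_deriv:
  assumes S: "open S" "x \<in> S" and \<Phi>: "differentiable_form k S x \<Phi>"
  shows "alternating_form k (\<lambda>Vs. dir_deriv (\<lambda>z. \<Phi> z Vs) x u)"
  unfolding alternating_form_def
proof (intro allI impI conjI)
  fix Vs :: "'b list" assume len: "length Vs = k"
  have D: "(\<lambda>z. \<Phi> z (Vs[j := X])) differentiable (at x)" for j X
    using differentiable_form_differentiable[OF \<Phi>] len by simp
  show "linear (\<lambda>X. dir_deriv (\<lambda>z. \<Phi> z (Vs[j := X])) x u)" if j: "j < k" for j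
  proof (rule linearI)
    fix X Y
    have "dir_deriv (\<lambda>z. \<Phi> z (Vs[j := X + Y])) x = dir_deriv (\<lambda>z. \<Phi> z (Vs[j := X]) + \<Phi> z (Vs[j := Y])) x" (is "_ = ?D")
      using linear_add[OF alternating_form_linear[OF differentiable_form_alternating[OF \<Phi>] len j]]
      by (intro dir_deriv_cong_open[OF S]) auto
    moreover have "?D u = dir_deriv (\<lambda>z. \<Phi> z (Vs[j := X])) x u + dir_deriv (\<lambda>z. \<Phi> z (Vs[j := Y])) x u"
      by (rule dir_deriv_eqI) (intro derivative_intros has_derivative_dir_deriv D)
    ultimately show "dir_deriv (\<lambda>z. \<Phi> z (Vs[j := X + Y])) x u
        = dir_deriv (\<lambda>z. \<Phi> z (Vs[j := X])) x u + dir_deriv (\<lambda>z. \<Phi> z (Vs[j := Y])) x u" by simp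
  next
    fix r X
    have "dir_deriv (\<lambda>z. \<Phi> z (Vs[j := r *\<^sub>R X])) x = dir_deriv (\<lambda>z. r *\<^sub>R \<Phi> z (Vs[j := X])) x" (is "_ = ?D")
      using linear_scale[OF alternating_form_linear[OF differentiable_form_alternating[OF \<Phi>] len j]]
      by (intro dir_deriv_cong_open[OF S]) auto
    moreover have "?D u = r *\<^sub>R dir_deriv (\<lambda>z. \<Phi> z (Vs[j := X])) x u"
      by (rule dir_deriv_eqI) (intro derivative_intros has_derivative_dir_deriv D)
    ultimately show "dir_deriv (\<lambda>z. \<Phi> z (Vs[j := r *\<^sub>R X])) x u
        = r *\<^sub>R dir_deriv (\<lambda>z. \<Phi> z (Vs[j := X])) x u" by simp
  qed
  fix i j assume ij: "i < k" "j < k" "i \<noteq> j" "Vs ! i = Vs ! j"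
  have "dir_deriv (\<lambda>z. \<Phi> z Vs) x = dir_deriv (\<lambda>z. 0) x"
    using alternating_form_repeat[OF differentiable_form_alternating[OF \<Phi>] len ij]
    by (intro dir_deriv_cong_open[OF S]) auto
  then show "dir_deriv (\<lambda>z. \<Phi> z Vs) x u = 0" by simp
qed

lemma alternating_form_derivation:
  assumes \<omega>: "alternating_form k \<omega>" and A: "linear A"
  shows "alternating_form k (\<lambda>Vs. \<Sum>j<length Vs. \<omega> (Vs[j := A (Vs ! j)]))"
  unfolding alternating_form_def
proof (intro allI impI conjI)
  fix Vs :: "'a list" assume len: "length Vs = k"
  show "linear (\<lambda>X. \<Sum>j<length (Vs[i := X]). \<omega> (Vs[i := X, j := A (Vs[i := X] ! j)]))" if i: "i < k" for i
    unfolding length_list_update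
  proof (rule linear_compose_sum, rule ballI)
    fix j assume j: "j \<in> {..<length Vs}"
    show "linear (\<lambda>X. \<omega> (Vs[i := X, j := A (Vs[i := X] ! j)]))"
    proof (cases "i = j")
      case True
      then show ?thesis
        using linear_compose[OF A alternating_form_linear[OF \<omega> len i]] j by (simp add: o_def)
    next
      case False
      then show ?thesis
        using alternating_form_linear[OF \<omega>, of "Vs[j := A (Vs ! j)]" i] len i
        by (simp add: list_update_swap[of i j])
    qed
  qed
  fix a b assume ab: "a < k" "b < k" "a \<noteq> b" "Vs ! a = Vs ! b"
  let ?T = "\<lambda>j. \<omega> (Vs[j := A (Vs ! j)])"
  have "?T j = 0" if "j \<in> {..<length Vs} - {a, b}" for j
    by (rule alternating_form_repeat[OF \<omega>, of _ a b]) (use that ab len in auto)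
  then have "(\<Sum>j<length Vs. ?T j) = (\<Sum>j\<in>{a, b}. ?T j)"
    using ab len by (intro sum.mono_neutral_right) auto
  also have "\<dots> = ?T a + ?T b" using ab by simp
  \<comment> \<open>As the entries \<open>a\<close> and \<open>b\<close> of \<open>Vs\<close> agree,
    exchanging them in the list updated at \<open>a\<close> gives the list updated at
    \<open>b\<close>.\<close>
  also have "?T b = - ?T a"
  proof -
    let ?W = "Vs[a := A (Vs ! a)]"
    have "?W[a := ?W ! b, b := ?W ! a] = Vs[b := A (Vs ! b)]"
      using ab len by (metis length_list_update list_update_id list_update_overwrite nth_list_update_eq nth_list_update_neq)
    then show ?thesis using alternating_form_swap[OF \<omega>, of ?W a b] ab len by simp
  qed
  finally show "(\<Sum>j<length Vs. ?T j) = 0" by simp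
qed

lemma alternating_form_diff:
  assumes "alternating_form k \<phi>" "alternating_form k \<psi>"
  shows "alternating_form k (\<lambda>Vs. \<phi> Vs - \<psi> Vs)"
  using assms unfolding alternating_form_def by (auto intro!: linear_compose_sub)

lemma alternating_form_scale:
  assumes "alternating_form k \<phi>"
  shows "alternating_form k (\<lambda>Vs. r * \<phi> Vs)"
  unfolding alternating_form_def
proof (intro allI impI conjI)
  fix Vs :: "'a list" assume len: "length Vs = k"
  show "linear (\<lambda>X. r * \<phi> (Vs[j := X]))" if "j < k" for j
    using linear_compose_scale_right[OF alternating_form_linear[OF assms len that], of r] by simp
  show "r * \<phi> Vs = 0" if "i < k" "j < k" "i \<noteq> j" "Vs ! i = Vs ! j" for i j
    using alternating_form_repeat[OF assms len that] by simp
qed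

lemma alternating_form_cov:
  assumes S: "open S" "x \<in> S" and \<Phi>: "differentiable_form k S x \<Phi>" and A: "linear A"
  shows "alternating_form k (form_cov A \<Phi> x u)"
  using alternating_form_diff[OF alternating_form_dir_deriv[OF S \<Phi>]
      alternating_form_derivation[OF differentiable_form_alternating[OF \<Phi> S(2)] A]]
  by (simp add: form_cov_def[abs_def])

text \<open>Product rule for arguments that move with the point; \<open>Ws\<close> are the moving
  entries, \<open>Cs\<close> the constant ones. Expanding the last moving entry in the Euclidean
  basis turns it into a constant entry with a moving scalar coefficient, and the induction
  hypothesis applies with a longer \<open>Cs\<close>.\<close>

lemma differentiable_form_has_derivative:
  fixes \<Phi> :: "'x::real_normed_vector \<Rightarrow> 'v::euclidean_space list \<Rightarrow> real"
  assumes S: "open S" "x \<in> S" and \<Phi>: "differentiable_form k S x \<Phi>"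
    and Ws: "\<And>w. w \<in> set Ws \<Longrightarrow> w differentiable (at x)"
    and len: "length Ws + length Cs = k"
  shows "((\<lambda>z. \<Phi> z (map (\<lambda>w. w z) Ws @ Cs)) has_derivative
    (\<lambda>u. dir_deriv (\<lambda>z. \<Phi> z (map (\<lambda>w. w x) Ws @ Cs)) x u
      + (\<Sum>j<length Ws. \<Phi> x ((map (\<lambda>w. w x) Ws @ Cs)[j := dir_deriv (Ws ! j) x u])))) (at x)"
  using Ws len
proof (induction Ws arbitrary: Cs rule: rev_induct)
  case Nil
  then show ?case using has_derivative_dir_deriv[OF differentiable_form_differentiable[OF \<Phi>]] by simp
next
  case (snoc w Ws)
  let ?m = "length Ws"
  have w: "w differentiable (at x)" using snoc.prems by simp
  have wb: "((\<lambda>z. w z \<bullet> b) has_derivative (\<lambda>u. dir_deriv w x u \<bullet> b)) (at x)" for b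
    by (intro derivative_intros has_derivative_dir_deriv w)
  define L where "L z X = map (\<lambda>w. w z) Ws @ X # Cs" for z X
  have lenL: "length (L z X) = k" for z X using snoc.prems by (simp add: L_def)
  have mk: "?m < k" using snoc.prems by simp
  have LL: "(L z X)[?m := Y] = L z Y" for z X Y
    by (simp add: L_def list_update_append)
  have ex: "\<omega> (L z X) = (\<Sum>b\<in>Basis. (X \<bullet> b) * \<omega> (L z b))" if "alternating_form k \<omega>" for \<omega> z X
    using alternating_form_expansion[OF that lenL mk, of z 0 X] by (simp add: LL)
  have ex': "\<omega> ((L z X)[j := Y]) = (\<Sum>b\<in>Basis. (X \<bullet> b) * \<omega> ((L z b)[j := Y]))"
    if "alternating_form k \<omega>" "j < ?m" for \<omega> z X j Y
  proof -
    have "(L z 0)[j := Y, ?m := X'] = (L z X')[j := Y]" for X'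
      using that by (simp add: list_update_swap[of j ?m] LL)
    then show ?thesis
      using alternating_form_expansion[OF that(1) _ mk, of "(L z 0)[j := Y]" X] by (simp add: lenL)
  qed
  have IH: "((\<lambda>z. \<Phi> z (L z b)) has_derivative
      (\<lambda>u. dir_deriv (\<lambda>z. \<Phi> z (L x b)) x u + (\<Sum>j<?m. \<Phi> x ((L x b)[j := dir_deriv (Ws ! j) x u])))) (at x)" for b
    unfolding L_def using snoc.prems by (intro snoc.IH) auto
  have "((\<lambda>z. \<Sum>b\<in>Basis. (w z \<bullet> b) * \<Phi> z (L z b)) has_derivative
      (\<lambda>u. \<Sum>b\<in>Basis. (w x \<bullet> b) * (dir_deriv (\<lambda>z. \<Phi> z (L x b)) x u
          + (\<Sum>j<?m. \<Phi> x ((L x b)[j := dir_deriv (Ws ! j) x u])))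
        + (dir_deriv w x u \<bullet> b) * \<Phi> x (L x b))) (at x)"
    by (intro has_derivative_sum has_derivative_mult wb IH)
  also have "(\<lambda>u. \<Sum>b\<in>Basis. (w x \<bullet> b) * (dir_deriv (\<lambda>z. \<Phi> z (L x b)) x u
          + (\<Sum>j<?m. \<Phi> x ((L x b)[j := dir_deriv (Ws ! j) x u])))
        + (dir_deriv w x u \<bullet> b) * \<Phi> x (L x b))
     = (\<lambda>u. dir_deriv (\<lambda>z. \<Phi> z (L x (w x))) x u
      + (\<Sum>j<Suc ?m. \<Phi> x ((L x (w x))[j := dir_deriv ((Ws @ [w]) ! j) x u])))"
  proof
    fix u
    have alt: "alternating_form k (\<Phi> x)" using differentiable_form_alternating[OF \<Phi> S(2)] .
    have "dir_deriv (\<lambda>z. \<Phi> z (L x (w x))) x u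
        = (\<Sum>b\<in>Basis. (w x \<bullet> b) * dir_deriv (\<lambda>z. \<Phi> z (L x b)) x u)"
      by (rule ex[OF alternating_form_dir_deriv[OF S \<Phi>]])
    moreover have "\<Phi> x (L x (dir_deriv w x u)) = (\<Sum>b\<in>Basis. (dir_deriv w x u \<bullet> b) * \<Phi> x (L x b))"
      by (rule ex[OF alt])
    moreover have "(\<Sum>j<?m. \<Phi> x ((L x (w x))[j := dir_deriv (Ws ! j) x u]))
        = (\<Sum>b\<in>Basis. (w x \<bullet> b) * (\<Sum>j<?m. \<Phi> x ((L x b)[j := dir_deriv (Ws ! j) x u])))"
      unfolding sum_distrib_left by (subst sum.swap, rule sum.cong[OF refl], rule ex'[OF alt]) simp
    ultimately show "(\<Sum>b\<in>Basis. (w x \<bullet> b) * (dir_deriv (\<lambda>z. \<Phi> z (L x b)) x u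
          + (\<Sum>j<?m. \<Phi> x ((L x b)[j := dir_deriv (Ws ! j) x u])))
        + (dir_deriv w x u \<bullet> b) * \<Phi> x (L x b))
      = dir_deriv (\<lambda>z. \<Phi> z (L x (w x))) x u
      + (\<Sum>j<Suc ?m. \<Phi> x ((L x (w x))[j := dir_deriv ((Ws @ [w]) ! j) x u]))"
      by (simp add: LL nth_append sum.distrib distrib_left)
  qed
  finally have "((\<lambda>z. \<Phi> z (L z (w z))) has_derivative
      (\<lambda>u. dir_deriv (\<lambda>z. \<Phi> z (L x (w x))) x u
      + (\<Sum>j<Suc ?m. \<Phi> x ((L x (w x))[j := dir_deriv ((Ws @ [w]) ! j) x u])))) (at x)"
    by (rule has_derivative_transform_within_open[OF _ S])
      (simp add: ex[OF differentiable_form_alternating[OF \<Phi>], symmetric])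
  then show ?case by (simp add: L_def)
qed

text \<open>The hypothesis on \<open>s\<close> says that the identification \<open>s\<close> of covectors with vectors is
  parallel for the connection with coefficient \<open>A\<close>. With \<open>l = 0\<close> this is the product rule for a
  full contraction, otherwise it commutes the Hodge operator with the connection.\<close>

lemma form_contraction_leibniz:
  fixes \<Phi> \<Psi> :: "'x::real_normed_vector \<Rightarrow> 'v::euclidean_space list \<Rightarrow> real"
  assumes S: "open S" "x \<in> S" and \<Phi>: "differentiable_form (k + l) S x \<Phi>" and \<Psi>: "differentiable_form k S x \<Psi>"
    and A: "linear A" and s: "linear (s x)" and ds: "\<And>e. (\<lambda>z. s z e) differentiable (at x)"
    and par: "\<And>e. dir_deriv (\<lambda>z. s z e) x u = - A (s x e) - s x (adjoint A e)"
    and Bs: "length Bs = l"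
  shows "form_cov A (\<lambda>z Bs. \<Sum>es\<in>basis_lists k. \<Phi> z (map (s z) es @ Bs) * \<Psi> z es) x u Bs
    = (\<Sum>es\<in>basis_lists k. form_cov A \<Phi> x u (map (s x) es @ Bs) * \<Psi> x es
        + \<Phi> x (map (s x) es @ Bs) * form_cov A \<Psi> x u es)"
proof -
  have alt: "alternating_form (k + l) (\<Phi> x)" using differentiable_form_alternating[OF \<Phi> S(2)] .
  have alt': "alternating_form k (\<Psi> x)" using differentiable_form_alternating[OF \<Psi> S(2)] .
  define W where "W es = map (s x) es @ Bs" for es
  define R where "R es = (\<Sum>j<l. \<Phi> x (map (s x) es @ Bs[j := A (Bs ! j)]))" for es
  define Q where "Q es = (\<Sum>j<k. \<Phi> x (W (es[j := adjoint A (es ! j)])))" for es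
  define P where "P es = (\<Sum>j<k. \<Psi> x (es[j := A (es ! j)]))" for es
  have T: "((\<lambda>z. \<Phi> z (map (s z) es @ Bs)) has_derivative
        (\<lambda>u. dir_deriv (\<lambda>z. \<Phi> z (W es)) x u
           + (\<Sum>j<k. \<Phi> x ((W es)[j := dir_deriv (\<lambda>z. s z (es ! j)) x u])))) (at x)"
    if es: "length es = k" for es
  proof -
    have m: "map (\<lambda>w. w z) (map (\<lambda>e z. s z e) es) = map (s z) es" for z by simp
    have "((\<lambda>z. \<Phi> z (map (\<lambda>w. w z) (map (\<lambda>e z. s z e) es) @ Bs)) has_derivative
        (\<lambda>u. dir_deriv (\<lambda>z. \<Phi> z (map (\<lambda>w. w x) (map (\<lambda>e z. s z e) es) @ Bs)) x u
           + (\<Sum>j<length (map (\<lambda>e z. s z e) es). \<Phi> x ((map (\<lambda>w. w x) (map (\<lambda>e z. s z e) es) @ Bs)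
                [j := dir_deriv (map (\<lambda>e z. s z e) es ! j) x u])))) (at x)"
      by (rule differentiable_form_has_derivative[OF S \<Phi>]) (use es Bs ds in auto)
    then show ?thesis unfolding m using es by (simp add: W_def)
  qed
  \<comment> \<open>By \<open>par\<close>, a derivative of \<open>s\<close> splits into two parts.
    The part with \<open>A\<close> builds the covariant derivative of \<Phi>, except for the last l
    slots, which are collected in \<open>R\<close>; the part with the adjoint is
    \<open>Q\<close>.\<close>
  have T': "dir_deriv (\<lambda>z. \<Phi> z (W es)) x u
           + (\<Sum>j<k. \<Phi> x ((W es)[j := dir_deriv (\<lambda>z. s z (es ! j)) x u]))
         = form_cov A \<Phi> x u (W es) + R es - Q es" if es: "length es = k" for es
  proof -
    have "\<Phi> x ((W es)[j := dir_deriv (\<lambda>z. s z (es ! j)) x u])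
        = - \<Phi> x ((W es)[j := A (W es ! j)]) - \<Phi> x (W (es[j := adjoint A (es ! j)]))" if j: "j < k" for j
    proof -
      have lin: "linear (\<lambda>X. \<Phi> x ((W es)[j := X]))"
        using alternating_form_linear[OF alt] es Bs j by (simp add: W_def)
      have "W es ! j = s x (es ! j)" using es j by (simp add: W_def nth_append)
      moreover have "W (es[j := adjoint A (es ! j)]) = (W es)[j := s x (adjoint A (es ! j))]"
        using es j by (simp add: W_def list_update_append map_update)
      ultimately show ?thesis
        unfolding par by (simp only: linear_diff[OF lin] linear_neg[OF lin])
    qed
    then have "(\<Sum>j<k. \<Phi> x ((W es)[j := dir_deriv (\<lambda>z. s z (es ! j)) x u]))
        = - (\<Sum>j<k. \<Phi> x ((W es)[j := A (W es ! j)])) - Q es"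
      by (simp add: Q_def sum_subtractf sum_negf)
    moreover have "(\<Sum>j<k + l. \<Phi> x ((W es)[j := A (W es ! j)]))
        = (\<Sum>j<k. \<Phi> x ((W es)[j := A (W es ! j)])) + R es"
    proof -
      have "(\<Sum>j<k + l. f j) = (\<Sum>j<k. f j) + (\<Sum>j<l. f (k + j))" for f :: "nat \<Rightarrow> real"
        by (induction l) (simp_all add: add_ac)
      moreover have "(\<Sum>j<l. \<Phi> x ((W es)[k + j := A (W es ! (k + j))])) = R es"
        using es by (simp add: R_def W_def list_update_append nth_append)
      ultimately show ?thesis by simp
    qed
    moreover have "length (W es) = k + l" using es Bs by (simp add: W_def)
    ultimately show ?thesis by (simp add: form_cov_def)
  qed
  have d\<Psi>: "dir_deriv (\<lambda>z. \<Psi> z es) x u = form_cov A \<Psi> x u es + P es" if "length es = k" for es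
    using that by (simp add: form_cov_def P_def)
  have "((\<lambda>z. \<Sum>es\<in>basis_lists k. \<Phi> z (map (s z) es @ Bs) * \<Psi> z es) has_derivative
      (\<lambda>u. \<Sum>es\<in>basis_lists k. \<Phi> x (map (s x) es @ Bs) * dir_deriv (\<lambda>z. \<Psi> z es) x u
        + (dir_deriv (\<lambda>z. \<Phi> z (W es)) x u
           + (\<Sum>j<k. \<Phi> x ((W es)[j := dir_deriv (\<lambda>z. s z (es ! j)) x u]))) * \<Psi> x es)) (at x)"
    by (intro has_derivative_sum has_derivative_mult T has_derivative_dir_deriv
        differentiable_form_differentiable[OF \<Psi>] length_basis_lists)
  then have "dir_deriv (\<lambda>z. \<Sum>es\<in>basis_lists k. \<Phi> z (map (s z) es @ Bs) * \<Psi> z es) x u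
      = (\<Sum>es\<in>basis_lists k. \<Phi> x (W es) * dir_deriv (\<lambda>z. \<Psi> z es) x u
        + (dir_deriv (\<lambda>z. \<Phi> z (W es)) x u
           + (\<Sum>j<k. \<Phi> x ((W es)[j := dir_deriv (\<lambda>z. s z (es ! j)) x u]))) * \<Psi> x es)"
    by (simp add: dir_deriv_eqI W_def)
  also have "\<dots> = (\<Sum>es\<in>basis_lists k. \<Phi> x (W es) * (form_cov A \<Psi> x u es + P es)
        + (form_cov A \<Phi> x u (W es) + R es - Q es) * \<Psi> x es)"
    by (intro sum.cong refl) (simp add: T' d\<Psi> length_basis_lists)
  also have "\<dots> = (\<Sum>es\<in>basis_lists k. form_cov A \<Phi> x u (W es) * \<Psi> x es + \<Phi> x (W es) * form_cov A \<Psi> x u es)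
      + (\<Sum>es\<in>basis_lists k. R es * \<Psi> x es)
      + ((\<Sum>es\<in>basis_lists k. \<Phi> x (W es) * P es) - (\<Sum>es\<in>basis_lists k. Q es * \<Psi> x es))"
    by (simp add: algebra_simps sum.distrib sum_subtractf)
  \<comment> \<open>In a contraction, the adjoint of \<open>A\<close> on the arguments of \<Phi>
    equals \<open>A\<close> on those of \<Psi>, so the correction terms of the two forms
    cancel.\<close>
  also have "(\<Sum>es\<in>basis_lists k. Q es * \<Psi> x es) = (\<Sum>es\<in>basis_lists k. \<Phi> x (W es) * P es)"
  proof -
    have lin: "linear (\<lambda>X. \<Phi> x (W (Vs[j := X])))" if "length Vs = k" "j < k" for Vs j
    proof -
      have "linear ((\<lambda>X. \<Phi> x ((W Vs)[j := X])) \<circ> s x)"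
        using that Bs by (intro linear_compose[OF s] alternating_form_linear[OF alt]) (simp_all add: W_def)
      then show ?thesis using that by (simp add: o_def W_def list_update_append map_update)
    qed
    have "(\<Sum>es\<in>basis_lists k. Q es * \<Psi> x es)
        = (\<Sum>j<k. \<Sum>es\<in>basis_lists k. \<Phi> x (W (es[j := adjoint A (es ! j)])) * \<Psi> x es)"
      unfolding Q_def sum_distrib_right by (rule sum.swap)
    also have "\<dots> = (\<Sum>j<k. \<Sum>es\<in>basis_lists k. \<Phi> x (W es) * \<Psi> x (es[j := A (es ! j)]))"
      by (rule sum.cong[OF refl], rule sum_basis_lists_adjoint[OF _ _ A])
        (use lin alternating_form_linear[OF alt'] in auto)
    also have "\<dots> = (\<Sum>es\<in>basis_lists k. \<Phi> x (W es) * P es)"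
      unfolding P_def sum_distrib_left by (rule sum.swap)
    finally show ?thesis .
  qed
  finally have "dir_deriv (\<lambda>z. \<Sum>es\<in>basis_lists k. \<Phi> z (map (s z) es @ Bs) * \<Psi> z es) x u
     = (\<Sum>es\<in>basis_lists k. form_cov A \<Phi> x u (W es) * \<Psi> x es + \<Phi> x (W es) * form_cov A \<Psi> x u es)
      + (\<Sum>es\<in>basis_lists k. R es * \<Psi> x es)" by simp
  \<comment> \<open>\<open>R\<close> is what the covariant derivative of the contraction subtracts
    for its free arguments.\<close>
  moreover have "(\<Sum>j<length Bs. \<Sum>es\<in>basis_lists k. \<Phi> x (map (s x) es @ Bs[j := A (Bs ! j)]) * \<Psi> x es)
     = (\<Sum>es\<in>basis_lists k. R es * \<Psi> x es)"
    unfolding R_def sum_distrib_right Bs by (rule sum.swap)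
  ultimately show ?thesis by (subst form_cov_def) (simp add: W_def)
qed

section \<open>Parallel projections\<close>

text \<open>Expanding \<open>V z\<close> in the basis leaves only derivatives of
  \<open>E z b\<close> for constant \<open>b\<close>, so no normed space of linear maps is
  involved.\<close>

lemma linear_field_has_derivative:
  fixes E :: "'x::real_normed_vector \<Rightarrow> 'v::euclidean_space \<Rightarrow> 'w::real_normed_vector"
  assumes S: "open S" "x \<in> S" and lin: "\<And>z. z \<in> S \<Longrightarrow> linear (E z)"
    and diff: "\<And>X. (\<lambda>z. E z X) differentiable (at x)" and V: "V differentiable (at x)"
  shows "((\<lambda>z. E z (V z)) has_derivative
    (\<lambda>u. dir_deriv (\<lambda>z. E z (V x)) x u + E x (dir_deriv V x u))) (at x)"
proof -
  have Vb: "((\<lambda>z. V z \<bullet> b) has_derivative (\<lambda>u. dir_deriv V x u \<bullet> b)) (at x)" for b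
    by (intro derivative_intros has_derivative_dir_deriv V)
  have d: "((\<lambda>z. \<Sum>b\<in>Basis. (V z \<bullet> b) *\<^sub>R E z b) has_derivative
      (\<lambda>u. \<Sum>b\<in>Basis. (V x \<bullet> b) *\<^sub>R dir_deriv (\<lambda>z. E z b) x u + (dir_deriv V x u \<bullet> b) *\<^sub>R E x b)) (at x)"
    by (intro has_derivative_sum has_derivative_scaleR Vb has_derivative_dir_deriv diff)
  have e: "((\<lambda>z. \<Sum>b\<in>Basis. (V x \<bullet> b) *\<^sub>R E z b) has_derivative
      (\<lambda>u. \<Sum>b\<in>Basis. (V x \<bullet> b) *\<^sub>R dir_deriv (\<lambda>z. E z b) x u)) (at x)"
    by (intro has_derivative_sum has_derivative_scaleR_right has_derivative_dir_deriv diff)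
  have ex: "E z X = (\<Sum>b\<in>Basis. (X \<bullet> b) *\<^sub>R E z b)" if "z \<in> S" for z X
    by (rule linear_euclidean_expansion[OF lin[OF that]])
  have "dir_deriv (\<lambda>z. E z (V x)) x = dir_deriv (\<lambda>z. \<Sum>b\<in>Basis. (V x \<bullet> b) *\<^sub>R E z b) x"
    by (rule dir_deriv_cong_open[OF S]) (rule ex)
  then have "dir_deriv (\<lambda>z. E z (V x)) x u + E x (dir_deriv V x u)
      = (\<Sum>b\<in>Basis. (V x \<bullet> b) *\<^sub>R dir_deriv (\<lambda>z. E z b) x u + (dir_deriv V x u \<bullet> b) *\<^sub>R E x b)" for u
    using dir_deriv_eqI[OF e, of u] ex[OF S(2), of "dir_deriv V x u"] by (simp add: sum.distrib)
  then show ?thesis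
    using has_derivative_transform_within_open[OF d S, of "\<lambda>z. E z (V z)"] ex[symmetric] by simp
qed

lemma linear_field_dir_deriv:
  fixes E :: "'x::real_normed_vector \<Rightarrow> 'v::euclidean_space \<Rightarrow> 'w::real_normed_vector"
  assumes S: "open S" "x \<in> S" and lin: "\<And>z. z \<in> S \<Longrightarrow> linear (E z)"
    and diff: "\<And>X. (\<lambda>z. E z X) differentiable (at x)"
  shows "linear (\<lambda>X. dir_deriv (\<lambda>z. E z X) x u)"
proof (rule linearI)
  fix X Y r
  have "dir_deriv (\<lambda>z. E z (X + Y)) x = dir_deriv (\<lambda>z. E z X + E z Y) x"
    by (rule dir_deriv_cong_open[OF S]) (simp add: lin linear_add)
  moreover have "dir_deriv (\<lambda>z. E z X + E z Y) x u = dir_deriv (\<lambda>z. E z X) x u + dir_deriv (\<lambda>z. E z Y) x u"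
    by (rule dir_deriv_eqI) (intro has_derivative_add has_derivative_dir_deriv diff)
  ultimately show "dir_deriv (\<lambda>z. E z (X + Y)) x u
      = dir_deriv (\<lambda>z. E z X) x u + dir_deriv (\<lambda>z. E z Y) x u" by simp
  have "dir_deriv (\<lambda>z. E z (r *\<^sub>R X)) x = dir_deriv (\<lambda>z. r *\<^sub>R E z X) x"
    by (rule dir_deriv_cong_open[OF S]) (simp add: lin linear_scale)
  moreover have "dir_deriv (\<lambda>z. r *\<^sub>R E z X) x u = r *\<^sub>R dir_deriv (\<lambda>z. E z X) x u"
    by (rule dir_deriv_eqI) (intro has_derivative_scaleR_right has_derivative_dir_deriv diff)
  ultimately show "dir_deriv (\<lambda>z. E z (r *\<^sub>R X)) x u = r *\<^sub>R dir_deriv (\<lambda>z. E z X) x u" by simp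
qed

section \<open>Forms of top degree on the image of a projection\<close>

lemma alternating_form_zero_if_zero_on_image:
  fixes E :: "'v::real_vector \<Rightarrow> 'v"
  assumes \<omega>: "alternating_form k \<omega>" and E: "linear E" "\<And>X. E (E X) = E X"
    and ker: "\<And>Vs j. length Vs = k \<Longrightarrow> j < k \<Longrightarrow> E (Vs ! j) = 0 \<Longrightarrow> \<omega> Vs = 0"
    and Ns: "length Ns = k" "span (set Ns) = range E" "\<omega> Ns = 0"
    and Vs: "length Vs = k"
  shows "\<omega> Vs = 0"
proof (rule alternating_form_zero_on_span[OF \<omega> _ Vs])
  \<comment> \<open>The space is the sum of the image and the kernel of \<open>E\<close>, so entries
    from these two suffice. A kernel entry is covered by \<open>ker\<close>; otherwise all entries
    lie in the span of \<open>Ns\<close>.\<close>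
  fix Ws assume Ws: "length Ws = k" "set Ws \<subseteq> range E \<union> {X. E X = 0}"
  show "\<omega> Ws = 0"
  proof (cases "\<exists>j<k. E (Ws ! j) = 0")
    case True
    then show ?thesis using ker Ws by blast
  next
    case False
    then have "set Ws \<subseteq> span (set Ns)" using Ws Ns(2) by (fastforce simp: in_set_conv_nth)
    then show ?thesis
      using alternating_form_zero_if_zero_on_spanning_list[OF \<omega> Ns(3,1) Ws(1)] by simp
  qed
next
  have "X \<in> span (range E \<union> {X. E X = 0})" for X
  proof -
    have "E (X - E X) = 0" using E by (simp add: linear_diff)
    then have "E X + (X - E X) \<in> span (range E \<union> {X. E X = 0})"
      by (intro span_add span_base) auto
    then show ?thesis by simp
  qed
  then show "set Vs \<subseteq> span (range E \<union> {X. E X = 0})" by blast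
qed

lemma spanning_list_exists:
  fixes T :: "'v::euclidean_space set"
  assumes T: "subspace T" "dim T = k" and W: "W \<in> T" "W \<noteq> 0"
  obtains Ns where "length Ns = k" "span (set Ns) = T" "Ns \<noteq> []" "Ns ! 0 = W"
proof -
  have "independent {W}" using W(2) by simp
  then obtain B where B: "{W} \<subseteq> B" "B \<subseteq> T" "independent B" "T \<subseteq> span B"
    using maximal_independent_subset_extend[of "{W}" T] W(1) by blast
  have fin: "finite B" using B(3) by (rule independent_imp_finite)
  obtain bs where bs: "set bs = B - {W}" "distinct bs" using finite_distinct_list[of "B - {W}"] fin by auto
  have "span B = T" using B(2,4) T(1) span_minimal by blast
  moreover have "card B = k" using B T(2) by (simp add: basis_card_eq_dim)
  moreover have "length bs = card B - 1" using distinct_card[OF bs(2)] bs(1) B(1) fin by simp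
  moreover have "card B \<noteq> 0" using B(1) fin by auto
  moreover have "set (W # bs) = B" using bs B(1) by auto
  ultimately show thesis using that[of "W # bs"] by simp
qed

text \<open>A nonzero \<open>W\<close> could be completed to a basis of the image with
  \<open>W\<close> in slot 0. The form would vanish on that basis and hence, having top degree
  there, everywhere.\<close>

lemma top_form_nondegenerate:
  fixes E :: "'v::euclidean_space \<Rightarrow> 'v"
  assumes \<omega>: "alternating_form k \<omega>" and E: "linear E" "\<And>X. E (E X) = E X"
    and ker: "\<And>Vs j. length Vs = k \<Longrightarrow> j < k \<Longrightarrow> E (Vs ! j) = 0 \<Longrightarrow> \<omega> Vs = 0"
    and dim: "dim (range E) = k" and ne: "length Us = k" "\<omega> Us \<noteq> 0"
    and W: "E W = W" "\<And>Vs. length Vs = k \<Longrightarrow> \<omega> (Vs[0 := W]) = 0"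
  shows "W = 0"
proof (rule ccontr)
  assume "W \<noteq> 0"
  moreover have "subspace (range E)" using linear_subspace_image[OF E(1)] by simp
  moreover have "W \<in> range E" using W(1) by (metis rangeI)
  ultimately obtain Ns where Ns: "length Ns = k" "span (set Ns) = range E" "Ns \<noteq> []" "Ns ! 0 = W"
    using spanning_list_exists dim by metis
  have "Ns[0 := W] = Ns" using Ns(4) by auto
  then have "\<omega> Ns = 0" using W(2)[OF Ns(1)] by simp
  have "\<omega> Us = 0"
    by (rule alternating_form_zero_if_zero_on_image[OF \<omega> E _ Ns(1,2) \<open>\<omega> Ns = 0\<close> ne(1)]) (erule (2) ker)
  then show False using ne(2) by blast
qed

text \<open>A form of top degree on the image is determined by its value on one basis
  \<open>Ns\<close>, and the combination of the two forms with the coefficients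
  \<open>\<omega> Ns\<close> and \<open>- \<phi> Ns\<close> vanishes on it.\<close>

lemma top_form_proportional:
  fixes E :: "'v::euclidean_space \<Rightarrow> 'v"
  assumes \<omega>: "alternating_form k \<omega>" and \<phi>: "alternating_form k \<phi>"
    and E: "linear E" "\<And>X. E (E X) = E X"
    and ker\<omega>: "\<And>Vs j. length Vs = k \<Longrightarrow> j < k \<Longrightarrow> E (Vs ! j) = 0 \<Longrightarrow> \<omega> Vs = 0"
    and ker\<phi>: "\<And>Vs j. length Vs = k \<Longrightarrow> j < k \<Longrightarrow> E (Vs ! j) = 0 \<Longrightarrow> \<phi> Vs = 0"
    and dim: "dim (range E) = k" and ne: "length Us = k" "\<omega> Us \<noteq> 0"
  obtains r where "\<And>Vs. length Vs = k \<Longrightarrow> \<phi> Vs = r * \<omega> Vs"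
proof -
  obtain B where B: "B \<subseteq> range E" "independent B" "range E \<subseteq> span B" "card B = k"
    using basis_exists[of "range E"] dim by metis
  obtain Ns where Ns': "set Ns = B" "distinct Ns"
    using finite_distinct_list[OF independent_imp_finite[OF B(2)]] by auto
  have "subspace (range E)" using linear_subspace_image[OF E(1)] by simp
  then have Ns: "length Ns = k" "span (set Ns) = range E"
    using Ns' B distinct_card[of Ns] span_minimal[of B "range E"] by auto
  have "\<omega> Us = 0" if "\<omega> Ns = 0"
    by (rule alternating_form_zero_if_zero_on_image[OF \<omega> E _ Ns that ne(1)]) (erule (2) ker\<omega>)
  then have "\<omega> Ns \<noteq> 0" using ne(2) by blast
  moreover have "\<omega> Ns * \<phi> Vs - \<phi> Ns * \<omega> Vs = 0" if "length Vs = k" for Vs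
    by (rule alternating_form_zero_if_zero_on_image[OF
          alternating_form_diff[OF alternating_form_scale[OF \<phi>] alternating_form_scale[OF \<omega>]] E _ Ns _ that])
      (use ker\<omega> ker\<phi> in \<open>fastforce, simp\<close>)
  ultimately have "\<phi> Vs = (\<phi> Ns / \<omega> Ns) * \<omega> Vs" if "length Vs = k" for Vs
    using that by (simp add: field_simps)
  then show thesis using that by blast
qed

section \<open>Projections self-adjoint for a parallel metric\<close>

definition endo_cov :: "('v \<Rightarrow> 'v) \<Rightarrow> ('x::real_normed_vector \<Rightarrow> 'v \<Rightarrow> 'v::real_normed_vector) \<Rightarrow> 'x \<Rightarrow> 'x \<Rightarrow> 'v \<Rightarrow> 'v"
  where "endo_cov A E x u X = dir_deriv (\<lambda>z. E z X) x u + A (E x X) - E x (A X)"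

text \<open>In the application \<open>E\<close> is the projection onto the normal tractors,
  \<open>s\<close> the inverse tractor metric and \<open>A\<close> the tractor connection on
  constant sections, all in one trivialisation. The inner product is the Euclidean one of the
  trivialisation and merely writes covectors as vectors. Thus \<open>E_sym\<close> is
  self-adjointness of \<open>E\<close> for the metric inverse to \<open>s\<close>, and
  \<open>s_parallel\<close> says that this metric is parallel.\<close>

locale projection_field =
  fixes S :: "'x::real_normed_vector set" and x u :: 'x
    and A :: "'v::euclidean_space \<Rightarrow> 'v" and s E :: "'x \<Rightarrow> 'v \<Rightarrow> 'v"
  assumes S: "open S" "x \<in> S"
    and A: "linear A"
    and s_lin: "\<And>z. z \<in> S \<Longrightarrow> linear (s z)"
    and s_sym: "\<And>e e'. s x e \<bullet> e' = e \<bullet> s x e'"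
    and s_surj: "surj (s x)"
    and s_diff: "\<And>e. (\<lambda>z. s z e) differentiable (at x)"
    and s_parallel: "\<And>e. dir_deriv (\<lambda>z. s z e) x u = - A (s x e) - s x (adjoint A e)"
    and E_lin: "\<And>z. z \<in> S \<Longrightarrow> linear (E z)"
    and E_idem: "\<And>z X. z \<in> S \<Longrightarrow> E z (E z X) = E z X"
    and E_sym: "\<And>z e e'. z \<in> S \<Longrightarrow> E z (s z e) \<bullet> e' = e \<bullet> E z (s z e')"
    and E_diff: "\<And>X. (\<lambda>z. E z X) differentiable (at x)"
begin

abbreviation "dE X \<equiv> dir_deriv (\<lambda>z. E z X) x u"
abbreviation "DE \<equiv> endo_cov A E x u"

lemma linear_DE: "linear DE"
proof -
  have "linear (\<lambda>X. dE X + (A \<circ> E x) X - (E x \<circ> A) X)"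
    by (intro linear_compose_sub linear_compose_add linear_field_dir_deriv[OF S E_lin E_diff]
        linear_compose A E_lin S(2))
  then show ?thesis by (simp add: endo_cov_def[abs_def])
qed

lemma dir_deriv_E_field:
  assumes "V differentiable (at x)"
  shows "dir_deriv (\<lambda>z. E z (V z)) x u = dE (V x) + E x (dir_deriv V x u)"
  by (rule dir_deriv_eqI[OF linear_field_has_derivative[OF S E_lin E_diff assms]])

lemma DE_derivation: "E x (DE X) + DE (E x X) = DE X"
proof -
  have "dE X = dir_deriv (\<lambda>z. E z (E z X)) x u"
    by (subst dir_deriv_cong_open[OF S, of _ "\<lambda>z. E z X"]) (simp_all add: E_idem)
  also have "\<dots> = dE (E x X) + E x (dE X)"
    by (rule dir_deriv_E_field[OF E_diff])
  finally show ?thesis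
    using E_lin[OF S(2)] S(2) by (simp add: endo_cov_def E_idem linear_add linear_diff algebra_simps)
qed

text \<open>Es is a contravariant 2-tensor, symmetric on all of \<open>S\<close>. Its covariant
  derivative is again symmetric, and it equals \<open>DE\<close> composed with \<open>s\<close>
  because \<open>s\<close> is parallel.\<close>

lemma DE_sym: "DE (s x e) \<bullet> e' = e \<bullet> DE (s x e')"
proof -
  define M where "M z e = E z (s z e)" for z e
  have M_diff: "(\<lambda>z. M z e) differentiable (at x)" for e
    unfolding M_def differentiable_def
    using linear_field_has_derivative[OF S E_lin E_diff s_diff] by blast
  have dM: "dir_deriv (\<lambda>z. M z e) x u = dE (s x e) - E x (A (s x e)) - M x (adjoint A e)" for e
    unfolding M_def dir_deriv_E_field[OF s_diff] s_parallel
    using E_lin[OF S(2)] by (simp add: linear_diff linear_neg)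
  \<comment> \<open>The right side is the covariant derivative of \<open>M\<close>, with one
    connection term for each of its two indices.\<close>
  have D: "DE (s x e) = dir_deriv (\<lambda>z. M z e) x u + M x (adjoint A e) + A (M x e)" for e
    unfolding dM endo_cov_def by (simp add: M_def)
  have dir: "dir_deriv (\<lambda>z. M z a \<bullet> b) x u = dir_deriv (\<lambda>z. M z a) x u \<bullet> b" for a b
    by (rule dir_deriv_eqI) (intro derivative_intros has_derivative_dir_deriv M_diff)
  have "dir_deriv (\<lambda>z. M z e \<bullet> e') x = dir_deriv (\<lambda>z. M z e' \<bullet> e) x"
    using E_sym by (intro dir_deriv_cong_open[OF S]) (simp add: M_def inner_commute)
  then have 1: "dir_deriv (\<lambda>z. M z e) x u \<bullet> e' = dir_deriv (\<lambda>z. M z e') x u \<bullet> e"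
    using dir by metis
  have 2: "M x (adjoint A a) \<bullet> b = a \<bullet> A (M x b)" for a b
    using E_sym[OF S(2)] adjoint_works[OF A] by (metis M_def inner_commute)
  show ?thesis unfolding D
    using 1 2[of e e'] 2[of e' e] by (simp add: inner_add_left inner_add_right inner_commute)
qed

text \<open>Vanishing on the kernel makes \<open>DE\<close> factor through \<open>E\<close>, and
  \<open>DE_derivation\<close> then makes \<open>E\<close> annihilate all values of
  \<open>DE\<close>. Moving first \<open>DE\<close> and then \<open>E\<close> across the pairing
  leaves exactly such a value.\<close>

lemma DE_zero_if_zero_on_kernel:
  assumes ker: "\<And>X. E x X = 0 \<Longrightarrow> DE X = 0"
  shows "DE X = 0"
proof -
  have DEE: "DE (E x X) = DE X" for X
  proof -
    have "E x (X - E x X) = 0" using E_lin E_idem S(2) by (simp add: linear_diff)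
    then have "DE (X - E x X) = 0" by (rule ker)
    then show ?thesis using linear_DE by (simp add: linear_diff)
  qed
  then have EDE: "E x (DE X) = 0" for X using DE_derivation[of X] by simp
  obtain t where t: "\<And>X. s x (t X) = X" using s_surj by (metis surj_def)
  have "DE (s x e) \<bullet> e' = 0" for e e'
  proof -
    let ?Y = "DE (s x e')"
    have "DE (s x e) \<bullet> e' = DE (s x (t (E x (s x e)))) \<bullet> e'" by (simp add: t DEE)
    also have "\<dots> = t (E x (s x e)) \<bullet> s x (t ?Y)" by (subst DE_sym) (simp add: t)
    also have "\<dots> = E x (s x e) \<bullet> t ?Y" 
      using s_sym[of "t (E x (s x e))" "t ?Y"] by (simp add: t)
    also have "\<dots> = e \<bullet> E x ?Y" by (simp only: E_sym[OF S(2)] t)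
    finally show ?thesis by (simp only: EDE inner_zero_right)
  qed
  then have "DE (s x e) = 0" for e using inner_eq_zero_iff by blast
  from this[of "t X"] show ?thesis by (simp only: t)
qed

text \<open>The left side is the projected covariant derivative of a section of the kernel. The
  right side depends on its value at \<open>x\<close> alone; this tensoriality makes the tractor
  second fundamental form well defined.\<close>

lemma DE_section_of_kernel:
  assumes V: "V differentiable (at x)" and ker: "\<And>z. z \<in> S \<Longrightarrow> E z (V z) = 0"
  shows "E x (dir_deriv V x u + A (V x)) = - DE (V x)"
proof -
  have "dir_deriv (\<lambda>z. E z (V z)) x u = 0"
    by (subst dir_deriv_cong_open[OF S, of _ "\<lambda>z. 0"]) (simp_all add: ker)
  then have "dE (V x) + E x (dir_deriv V x u) = 0" by (simp add: dir_deriv_E_field[OF V])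
  then show ?thesis
    using linear_add[OF E_lin[OF S(2)]] linear_0[OF A] ker[OF S(2)]
    by (simp add: endo_cov_def algebra_simps eq_neg_iff_add_eq_0)
qed

context
  fixes N :: "'x \<Rightarrow> 'v list \<Rightarrow> real" and k :: nat
  assumes N: "differentiable_form k S x N"
    and N_ker: "\<And>z Vs j. z \<in> S \<Longrightarrow> length Vs = k \<Longrightarrow> j < k \<Longrightarrow> E z (Vs ! j) = 0 \<Longrightarrow> N z Vs = 0"
begin

lemma form_cov_kernel:
  assumes len: "length Vs = k" and j: "j < k" and X: "E x X = 0"
  shows "form_cov A N x u (Vs[j := X]) = N x (Vs[j := DE X])"
proof -
  have alt: "alternating_form k (N x)" using differentiable_form_alternating[OF N S(2)] .
  have lin: "linear (\<lambda>Y. N x (Vs[j := Y]))" by (rule alternating_form_linear[OF alt len j])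
  have Ex: "linear (E x)" using E_lin[OF S(2)] .
  \<comment> \<open>In slot \<open>j\<close> the vector \<open>X\<close> is extended to a field with
    values in the kernel of \<open>E z\<close>, on which the form vanishes throughout
    \<open>S\<close>; it equals \<open>X\<close> at \<open>x\<close> because
    \<open>E x X = 0\<close>.\<close>
  define Ws where "Ws = (map (\<lambda>V z. V) Vs)[j := \<lambda>z. X - E z X]"
  have Wj: "((\<lambda>z. X - E z X) has_derivative (\<lambda>u. 0 - dir_deriv (\<lambda>z. E z X) x u)) (at x)"
    by (intro has_derivative_diff has_derivative_const has_derivative_dir_deriv E_diff)
  have Ws_diff: "w differentiable (at x)" if "w \<in> set Ws" for w
  proof -
    have "w \<in> insert (\<lambda>z. X - E z X) (set (map (\<lambda>V z. V) Vs))"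
      using that set_update_subset_insert[of "map (\<lambda>V z. V) Vs" j] unfolding Ws_def by blast
    moreover have "(\<lambda>z. X - E z X) differentiable (at x)" using Wj by (auto simp: differentiable_def)
    ultimately show ?thesis by auto
  qed
  have Ws_at: "map (\<lambda>w. w z) Ws = Vs[j := X - E z X]" for z
    by (simp add: Ws_def map_update o_def)
  have "((\<lambda>z. N z (Vs[j := X - E z X])) has_derivative
      (\<lambda>u. dir_deriv (\<lambda>z. N z (Vs[j := X])) x u
        + (\<Sum>i<k. N x (Vs[j := X, i := dir_deriv (Ws ! i) x u])))) (at x)"
    using differentiable_form_has_derivative[OF S N, of Ws "[]", OF Ws_diff] len linear_0[OF Ex]
    by (simp add: Ws_at X) (simp add: Ws_def)
  then have d: "dir_deriv (\<lambda>z. N z (Vs[j := X - E z X])) x u = dir_deriv (\<lambda>z. N z (Vs[j := X])) x u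
        + (\<Sum>i<k. N x (Vs[j := X, i := dir_deriv (Ws ! i) x u]))"
    by (rule dir_deriv_eqI)
  \<comment> \<open>Differentiating any other slot leaves the kernel vector \<open>X\<close> in slot
    \<open>j\<close>.\<close>
  have only_j: "(\<Sum>i<k. N x (Vs[j := X, i := f i])) = N x (Vs[j := f j])" for f
  proof -
    have "N x (Vs[j := X, i := f i]) = 0" if "i < k" "i \<noteq> j" for i
      by (rule N_ker[OF S(2), of _ j]) (use that len j X in auto)
    then have "(\<Sum>i<k. N x (Vs[j := X, i := f i])) = (\<Sum>i\<in>{j}. N x (Vs[j := X, i := f i]))"
      using j by (intro sum.mono_neutral_right) auto
    then show ?thesis by simp
  qed
  have "dir_deriv (\<lambda>z. N z (Vs[j := X - E z X])) x u = 0"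
  proof -
    have "N z (Vs[j := X - E z X]) = 0" if "z \<in> S" for z
      by (rule N_ker[OF that, of _ j])
        (use that len j linear_diff[OF E_lin[OF that]] E_idem in auto)
    then show ?thesis by (subst dir_deriv_cong_open[OF S, of _ "\<lambda>z. 0"]) simp_all
  qed
  moreover have "dir_deriv (Ws ! j) x u = - dE X"
    using dir_deriv_eqI[OF Wj] len j by (simp add: Ws_def)
  ultimately have 1: "dir_deriv (\<lambda>z. N z (Vs[j := X])) x u = N x (Vs[j := dE X])"
    using d only_j[of "\<lambda>i. dir_deriv (Ws ! i) x u"] linear_neg[OF lin] by simp
  have "(\<Sum>i<k. N x (Vs[j := X, i := A (Vs[j := X] ! i)])) = N x (Vs[j := A X])"
    using only_j[of "\<lambda>i. A (Vs[j := X] ! i)"] len j by simp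
  then have 2: "form_cov A N x u (Vs[j := X]) = N x (Vs[j := dE X - A X])"
    using 1 linear_diff[OF lin] len by (simp add: form_cov_def)
  \<comment> \<open>The form sees only the image part of a slot, so \<open>A X\<close> may be
    replaced by \<open>E x (A X)\<close>. As \<open>E x X = 0\<close>, what then stands in slot
    \<open>j\<close> is \<open>DE X\<close>.\<close>
  have "N x (Vs[j := A X - E x (A X)]) = 0"
    by (rule N_ker[OF S(2), of _ j]) (use len j linear_diff[OF Ex] E_idem S(2) in auto)
  then have "N x (Vs[j := A X]) = N x (Vs[j := E x (A X)])" using linear_diff[OF lin] by simp
  then show ?thesis
    unfolding 2 using linear_diff[OF lin] linear_0[OF A] by (simp add: endo_cov_def X)
qed

lemma projection_parallel_iff_form_parallel:
  assumes k: "1 \<le> k" and dim: "dim (range (E x)) = k"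
    and norm: "\<And>z. z \<in> S \<Longrightarrow> (\<Sum>es\<in>basis_lists k. N z (map (s z) es) * N z es) = c" and c: "c \<noteq> 0"
  shows "(\<forall>X. DE X = 0) \<longleftrightarrow> (\<forall>Vs. length Vs = k \<longrightarrow> form_cov A N x u Vs = 0)"
proof
  have alt: "alternating_form k (N x)" using differentiable_form_alternating[OF N S(2)] .
  obtain Us where Us: "length Us = k" "N x Us \<noteq> 0"
  proof -
    have "\<exists>es\<in>basis_lists k. N x (map (s x) es) * N x es \<noteq> 0"
    proof (rule ccontr)
      assume "\<not> ?thesis"
      then have "(\<Sum>es\<in>basis_lists k. N x (map (s x) es) * N x es) = 0"
        by (intro sum.neutral) blast
      then show False using norm[OF S(2)] c by simp
    qed
    then obtain es where "length es = k" "N x es \<noteq> 0" by (auto dest: length_basis_lists)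
    then show thesis using that by blast
  qed
  note Ex = E_lin[OF S(2)] E_idem[OF S(2)]
  {
    assume DE0: "\<forall>X. DE X = 0"
    have altcov: "alternating_form k (form_cov A N x u)" by (rule alternating_form_cov[OF S N A])
    have ker: "form_cov A N x u Vs = 0" if "length Vs = k" "j < k" "E x (Vs ! j) = 0" for Vs j
      using form_cov_kernel[OF that] linear_0[OF alternating_form_linear[OF alt that(1,2)]] DE0 by simp
    obtain r where r: "\<And>Vs. length Vs = k \<Longrightarrow> form_cov A N x u Vs = r * N x Vs"
      by (rule top_form_proportional[OF alt altcov Ex _ _ dim Us])
        (erule (2) N_ker[OF S(2)], erule (2) ker, blast)
    \<comment> \<open>The full contraction is the Leibniz rule with no free arguments. Its
      derivative is zero since the length is constant; on the other hand it is 2rc, with one r from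
      each factor.\<close>
    let ?C = "\<lambda>z Bs. \<Sum>es\<in>basis_lists k. N z (map (s z) es @ Bs) * N z es"
    have "dir_deriv (\<lambda>z. ?C z []) x = dir_deriv (\<lambda>z. c) x"
      by (rule dir_deriv_cong_open[OF S]) (simp add: norm)
    then have "0 = form_cov A ?C x u []" by (simp add: form_cov_def)
    also have "\<dots> = (\<Sum>es\<in>basis_lists k. form_cov A N x u (map (s x) es @ []) * N x es
        + N x (map (s x) es @ []) * form_cov A N x u es)"
      by (rule form_contraction_leibniz[OF S _ N A s_lin[OF S(2)] s_diff s_parallel]) (simp_all add: N)
    also have "\<dots> = (\<Sum>es\<in>basis_lists k. 2 * r * (N x (map (s x) es) * N x es))"
      by (intro sum.cong refl) (simp add: r length_basis_lists)
    also have "\<dots> = 2 * r * c" by (simp add: sum_distrib_left[symmetric] norm[OF S(2)])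
    finally have "r = 0" using c by simp
    then show "\<forall>Vs. length Vs = k \<longrightarrow> form_cov A N x u Vs = 0" using r by simp
  }
  {
    assume cov0: "\<forall>Vs. length Vs = k \<longrightarrow> form_cov A N x u Vs = 0"
    have "DE X = 0" if X: "E x X = 0" for X
    proof (rule top_form_nondegenerate[OF alt Ex _ dim Us])
      show "N x Vs = 0" if "length Vs = k" "j < k" "E x (Vs ! j) = 0" for Vs j
        by (rule N_ker[OF S(2) that])
      \<comment> \<open>On a kernel vector the derivation identity puts \<open>DE X\<close> into the
        image, where the form is nondegenerate.\<close>
      show "E x (DE X) = DE X" using DE_derivation[of X] X linear_0[OF linear_DE] by simp
      show "N x (Vs[0 := DE X]) = 0" if "length Vs = k" for Vs
        using form_cov_kernel[OF that _ X, of 0] cov0 that k by simp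
    qed
    then show "\<forall>X. DE X = 0" using DE_zero_if_zero_on_kernel by blast
  }
qed

end

lemma contraction_parallel_iff:
  assumes \<epsilon>: "differentiable_form (k + l) S x \<epsilon>" and \<epsilon>_cov: "\<And>Vs. length Vs = k + l \<Longrightarrow> form_cov A \<epsilon> x u Vs = 0"
    and Us: "length Us = k + l" "\<epsilon> x Us \<noteq> 0" and dim: "DIM('v) = k + l"
    and N: "differentiable_form k S x N"
  shows "(\<forall>Vs. length Vs = k \<longrightarrow> form_cov A N x u Vs = 0) \<longleftrightarrow>
    (\<forall>Bs. length Bs = l \<longrightarrow>
      form_cov A (\<lambda>z Bs. \<Sum>es\<in>basis_lists k. \<epsilon> z (map (s z) es @ Bs) * N z es) x u Bs = 0)"
proof -
  have eq: "form_cov A (\<lambda>z Bs. \<Sum>es\<in>basis_lists k. \<epsilon> z (map (s z) es @ Bs) * N z es) x u Bs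
      = (\<Sum>es\<in>basis_lists k. \<epsilon> x (map (s x) es @ Bs) * form_cov A N x u es)" if "length Bs = l" for Bs
    unfolding form_contraction_leibniz[OF S \<epsilon> N A s_lin[OF S(2)] s_diff s_parallel that]
    by (intro sum.cong refl) (simp add: \<epsilon>_cov length_basis_lists that)
  show ?thesis
  proof (intro iffI allI impI)
    fix Bs :: "'v list"
    assume "\<forall>Vs. length Vs = k \<longrightarrow> form_cov A N x u Vs = 0" "length Bs = l"
    then show "form_cov A (\<lambda>z Bs. \<Sum>es\<in>basis_lists k. \<epsilon> z (map (s z) es @ Bs) * N z es) x u Bs = 0"
      by (simp add: eq length_basis_lists)
  next
    fix Vs :: "'v list"
    assume *: "\<forall>Bs. length Bs = l \<longrightarrow>
      form_cov A (\<lambda>z Bs. \<Sum>es\<in>basis_lists k. \<epsilon> z (map (s z) es @ Bs) * N z es) x u Bs = 0"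
      and len: "length Vs = k"
    show "form_cov A N x u Vs = 0"
      by (rule contraction_injective[OF differentiable_form_alternating[OF \<epsilon> S(2)] Us
            alternating_form_cov[OF S N A] dim s_lin[OF S(2)] s_surj _ len])
        (use * eq in simp)
  qed
qed

end

section \<open>Smooth functions\<close>

lemma Ck_on_cong:
  assumes "open S" "\<And>x. x \<in> S \<Longrightarrow> f x = g x"
  shows "Ck_on k S f \<longleftrightarrow> Ck_on k S g"
  using assms(2)
proof (induction k arbitrary: f g)
  case 0
  then show ?case by (simp cong: continuous_on_cong)
next
  case (Suc k)
  have "Ck_on k S (\<lambda>x. dir_deriv f x u) \<longleftrightarrow> Ck_on k S (\<lambda>x. dir_deriv g x u)" for u
    by (rule Suc.IH) (simp add: dir_deriv_cong_open[OF assms(1) _ Suc.prems])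
  moreover have "(\<forall>x\<in>S. f differentiable (at x)) \<longleftrightarrow> (\<forall>x\<in>S. g differentiable (at x))"
    using differentiable_cong_open[OF _ assms(1)] Suc.prems by metis
  ultimately show ?case by simp
qed

lemma smooth_on_differentiable:
  assumes "smooth_on S f" "x \<in> S"
  shows "f differentiable (at x)"
  using assms(1)[unfolded smooth_on_def, rule_format, of "Suc 0"] assms(2) by simp

lemma smooth_on_dir_deriv:
  assumes "smooth_on S f"
  shows "smooth_on S (\<lambda>x. dir_deriv f x u)"
  unfolding smooth_on_def
proof
  fix k show "Ck_on k S (\<lambda>x. dir_deriv f x u)"
    using assms[unfolded smooth_on_def, rule_format, of "Suc k"] by simp
qed

text \<open>Product and chain rule multiply a derivative by a factor that has not been
  differentiated, and the latter has to be brought down to the same order.\<close>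

lemma Ck_on_lower: "Ck_on (Suc k) S f \<Longrightarrow> Ck_on k S f"
proof (induction k arbitrary: f)
  case 0
  then have "\<forall>x\<in>S. isCont f x" by (auto dest: differentiable_imp_continuous_within)
  then show ?case by (simp add: continuous_at_imp_continuous_on)
next
  case (Suc k)
  then show ?case by (metis Ck_on.simps(2))
qed

lemma Ck_on_const: "Ck_on k S (\<lambda>x. a)"
  by (induction k arbitrary: a) simp_all

lemma smooth_on_const: "smooth_on S (\<lambda>x. a)"
  by (simp add: smooth_on_def Ck_on_const)

lemma Ck_on_bounded_linear:
  assumes S: "open S" and L: "bounded_linear L"
  shows "Ck_on k S f \<Longrightarrow> Ck_on k S (\<lambda>x. L (f x))"
proof (induction k arbitrary: f)
  case 0
  then show ?case using bounded_linear.continuous_on[OF L] by simp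
next
  case (Suc k)
  have der: "((\<lambda>x. L (f x)) has_derivative (\<lambda>u. L (dir_deriv f x u))) (at x)" if "x \<in> S" for x
    using Suc.prems that by (intro bounded_linear.has_derivative[OF L] has_derivative_dir_deriv) simp
  have "Ck_on k S (\<lambda>x. dir_deriv (\<lambda>x. L (f x)) x u)" for u
    using Suc Ck_on_cong[OF S, of "\<lambda>x. dir_deriv (\<lambda>x. L (f x)) x u" "\<lambda>x. L (dir_deriv f x u)" k]
    by (simp add: dir_deriv_eqI[OF der])
  then show ?case using der by (auto simp: differentiable_def)
qed

lemma Ck_on_add:
  assumes S: "open S"
  shows "Ck_on k S f \<Longrightarrow> Ck_on k S g \<Longrightarrow> Ck_on k S (\<lambda>x. f x + g x)"
proof (induction k arbitrary: f g)
  case 0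
  then show ?case by (simp add: continuous_on_add)
next
  case (Suc k)
  have der: "((\<lambda>x. f x + g x) has_derivative (\<lambda>u. dir_deriv f x u + dir_deriv g x u)) (at x)" if "x \<in> S" for x
    using Suc.prems that by (intro has_derivative_add has_derivative_dir_deriv) simp_all
  have "Ck_on k S (\<lambda>x. dir_deriv (\<lambda>x. f x + g x) x u)" for u
    using Suc Ck_on_cong[OF S, of "\<lambda>x. dir_deriv (\<lambda>x. f x + g x) x u" "\<lambda>x. dir_deriv f x u + dir_deriv g x u" k]
    by (simp add: dir_deriv_eqI[OF der])
  then show ?case using der by (auto simp: differentiable_def)
qed

lemma Ck_on_sum:
  assumes S: "open S" and "\<And>i. i \<in> I \<Longrightarrow> Ck_on k S (f i)"
  shows "Ck_on k S (\<lambda>x. \<Sum>i\<in>I. f i x)"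
  using assms(2) by (induction I rule: infinite_finite_induct) (simp_all add: Ck_on_const Ck_on_add[OF S])

lemma Ck_on_mult:
  fixes f g :: "'v::euclidean_space \<Rightarrow> real"
  assumes S: "open S"
  shows "Ck_on k S f \<Longrightarrow> Ck_on k S g \<Longrightarrow> Ck_on k S (\<lambda>x. f x * g x)"
proof (induction k arbitrary: f g)
  case 0
  then show ?case by (simp add: continuous_on_mult)
next
  case (Suc k)
  have der: "((\<lambda>x. f x * g x) has_derivative (\<lambda>u. f x * dir_deriv g x u + dir_deriv f x u * g x)) (at x)"
    if "x \<in> S" for x
    using Suc.prems that by (intro has_derivative_mult has_derivative_dir_deriv) simp_all
  have "Ck_on k S f" "Ck_on k S g" using Suc.prems by (simp_all only: Ck_on_lower)
  then have "Ck_on k S (\<lambda>x. f x * dir_deriv g x u + dir_deriv f x u * g x)" for u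
    using Suc.prems by (intro Ck_on_add[OF S] Suc.IH) simp_all
  then have "Ck_on k S (\<lambda>x. dir_deriv (\<lambda>x. f x * g x) x u)" for u
    using Ck_on_cong[OF S, of "\<lambda>x. dir_deriv (\<lambda>x. f x * g x) x u" "\<lambda>x. f x * dir_deriv g x u + dir_deriv f x u * g x" k]
    by (simp add: dir_deriv_eqI[OF der])
  then show ?case using der by (auto simp: differentiable_def)
qed

lemma dir_deriv_vec_expansion:
  fixes f :: "real ^ 'n::finite \<Rightarrow> 'w::real_normed_vector"
  assumes "f differentiable (at x)"
  shows "dir_deriv f x u = (\<Sum>a\<in>UNIV. u $ a *\<^sub>R pderiv_at f x a)"
proof -
  have lin: "linear (dir_deriv f x)"
    using has_derivative_dir_deriv[OF assms] has_derivative_linear by blast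
  have "dir_deriv f x u = dir_deriv f x (\<Sum>a\<in>UNIV. u $ a *\<^sub>R axis a 1)"
    by (simp add: basis_expansion scalar_mult_eq_scaleR[symmetric])
  then show ?thesis by (simp add: linear_sum[OF lin] linear_scale[OF lin])
qed

lemma has_derivative_chain:
  assumes "f differentiable (at (y x))" "y differentiable (at x)"
  shows "((\<lambda>z. f (y z)) has_derivative (\<lambda>u. dir_deriv f (y x) (dir_deriv y x u))) (at x)"
  using has_derivative_compose[OF has_derivative_dir_deriv[OF assms(2)] has_derivative_dir_deriv[OF assms(1)]] .

text \<open>Written with partial derivatives, the derivative of the composite is a sum of products
  of composites with the same \<open>y\<close> and components of its derivative. The induction
  therefore varies \<open>f\<close> and fixes \<open>y\<close>.\<close>

lemma Ck_on_compose:
  fixes f :: "real ^ 'n::finite \<Rightarrow> real" and y :: "'v::euclidean_space \<Rightarrow> real ^ 'n"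
  assumes S: "open S" "open T" and yST: "\<And>x. x \<in> S \<Longrightarrow> y x \<in> T"
  shows "Ck_on k T f \<Longrightarrow> Ck_on k S y \<Longrightarrow> Ck_on k S (\<lambda>x. f (y x))"
proof (induction k arbitrary: f)
  case 0
  then show ?case using yST by (auto intro: continuous_on_compose2)
next
  case (Suc k)
  have f: "f differentiable (at (y x))" and y: "y differentiable (at x)" if "x \<in> S" for x
    using Suc.prems that yST by simp_all
  have der: "((\<lambda>x. f (y x)) has_derivative
      (\<lambda>u. \<Sum>a\<in>UNIV. dir_deriv y x u $ a * pderiv_at f (y x) a)) (at x)" if "x \<in> S" for x
  proof -
    have "dir_deriv f (y x) v = (\<Sum>a\<in>UNIV. v $ a * pderiv_at f (y x) a)" for v
      by (subst dir_deriv_vec_expansion[OF f[OF that]]) simp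
    then have eq: "(\<lambda>u. dir_deriv f (y x) (dir_deriv y x u))
        = (\<lambda>u. \<Sum>a\<in>UNIV. dir_deriv y x u $ a * pderiv_at f (y x) a)" by (rule ext)
    show ?thesis using has_derivative_chain[OF f y, OF that that] by (simp only: eq)
  qed
  have "Ck_on k S (\<lambda>x. dir_deriv y x u $ a * pderiv_at f (y x) a)" for u a
  proof (rule Ck_on_mult[OF S(1)])
    show "Ck_on k S (\<lambda>x. dir_deriv y x u $ a)"
      by (rule Ck_on_bounded_linear[OF S(1) bounded_linear_vec_nth]) (use Suc.prems(2) in simp)
    show "Ck_on k S (\<lambda>x. pderiv_at f (y x) a)"
      by (rule Suc.IH[of "\<lambda>p. pderiv_at f p a"])
        (use Suc.prems Ck_on_lower[of k S y] in auto)
  qed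
  then have "Ck_on k S (\<lambda>x. \<Sum>a\<in>UNIV. dir_deriv y x u $ a * pderiv_at f (y x) a)" for u
    by (intro Ck_on_sum[OF S(1)])
  then have "Ck_on k S (\<lambda>x. dir_deriv (\<lambda>x. f (y x)) x u)" for u
    using Ck_on_cong[OF S(1), of "\<lambda>x. dir_deriv (\<lambda>x. f (y x)) x u"
        "\<lambda>x. \<Sum>a\<in>UNIV. dir_deriv y x u $ a * pderiv_at f (y x) a" k]
    by (simp add: dir_deriv_eqI[OF der])
  then show ?case using der by (auto simp: differentiable_def)
qed

lemma smooth_on_vec_nth: "open S \<Longrightarrow> smooth_on S f \<Longrightarrow> smooth_on S (\<lambda>x. f x $ i)"
  unfolding smooth_on_def using Ck_on_bounded_linear[OF _ bounded_linear_vec_nth] by blast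

lemma smooth_on_mult:
  "open S \<Longrightarrow> smooth_on S f \<Longrightarrow> smooth_on S g \<Longrightarrow> smooth_on S (\<lambda>x. f x * g x :: real)"
  by (simp add: smooth_on_def Ck_on_mult)

lemma smooth_on_sum:
  "open S \<Longrightarrow> (\<And>i. i \<in> I \<Longrightarrow> smooth_on S (f i)) \<Longrightarrow> smooth_on S (\<lambda>x. \<Sum>i\<in>I. f i x)"
  by (simp add: smooth_on_def Ck_on_sum)

lemma smooth_on_compose:
  fixes f :: "real ^ 'n::finite \<Rightarrow> real"
  assumes "open S" "open T" "\<And>x. x \<in> S \<Longrightarrow> y x \<in> T" "smooth_on T f" "smooth_on S y"
  shows "smooth_on S (\<lambda>x. f (y x))"
  using assms by (simp add: smooth_on_def Ck_on_compose)

section \<open>Differentiability of vectors, matrices and Christoffel symbols\<close>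

lemma differentiable_vec_nth: "f differentiable F \<Longrightarrow> (\<lambda>z. f z $ i) differentiable F"
  unfolding differentiable_def using bounded_linear.has_derivative[OF bounded_linear_vec_nth] by blast

lemma differentiable_vecI:
  fixes f :: "'x::real_normed_vector \<Rightarrow> ('w::euclidean_space) ^ 'n::finite"
  assumes "\<And>i. (\<lambda>z. f z $ i) differentiable (at x)"
  shows "f differentiable (at x)"
  unfolding differentiable_def
proof
  show "(f has_derivative (\<lambda>u. \<chi> i. dir_deriv (\<lambda>z. f z $ i) x u)) (at x)"
    by (subst has_derivative_componentwise_within)
      (auto simp: Basis_vec_def inner_axis intro!: derivative_intros has_derivative_dir_deriv assms)
qed

lemma differentiable_matrix_vector_mult:
  fixes M :: "'x::real_normed_vector \<Rightarrow> real ^ 'n ^ 'm::finite"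
  assumes "M differentiable (at x)" "f differentiable (at x)"
  shows "(\<lambda>z. M z *v f z) differentiable (at x)"
  by (rule differentiable_vecI)
    (auto simp: matrix_vector_mult_def intro!: differentiable_sum differentiable_mult differentiable_vec_nth assms)

lemma differentiable_prod_real:
  fixes f :: "'i \<Rightarrow> 'x::real_normed_vector \<Rightarrow> real"
  assumes "\<And>i. i \<in> I \<Longrightarrow> f i differentiable (at x)"
  shows "(\<lambda>z. \<Prod>i\<in>I. f i z) differentiable (at x)"
  using assms by (induction I rule: infinite_finite_induct) simp_all

lemma differentiable_det:
  fixes M :: "'x::real_normed_vector \<Rightarrow> real ^ 'n ^ 'n::finite"
  assumes "\<And>i j. (\<lambda>z. M z $ i $ j) differentiable (at x)"
  shows "(\<lambda>z. det (M z)) differentiable (at x)"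
  unfolding det_def
  by (auto intro!: differentiable_sum differentiable_mult differentiable_prod_real assms finite_permutations)

text \<open>The inverse becomes a quotient of polynomials in the entries, which reduces its
  differentiability to that of determinants.\<close>

lemma matrix_inv_cramer:
  fixes A :: "real ^ 'n ^ 'n::finite"
  assumes "invertible A"
  shows "matrix_inv A $ k $ l = det (\<chi> i j. if j = k then axis l 1 $ i else A $ i $ j) / det A"
proof -
  have "A *v (matrix_inv A *v axis l 1) = axis l 1"
    by (simp add: matrix_vector_mul_assoc matrix_inv_inverse(1)[OF assms])
  then have "matrix_inv A *v axis l 1 = (\<chi> k. det (\<chi> i j. if j = k then axis l 1 $ i else A $ i $ j) / det A)"
    using cramer[of A] assms by (simp add: invertible_det_nz)
  then have "(matrix_inv A *v axis l 1) $ k = det (\<chi> i j. if j = k then axis l 1 $ i else A $ i $ j) / det A"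
    by simp
  then show ?thesis by (simp add: matrix_vector_mult_basis column_def)
qed

lemma differentiable_matrix_inv:
  fixes M :: "'x::real_normed_vector \<Rightarrow> real ^ 'n ^ 'n::finite"
  assumes S: "open S" "x \<in> S" and inv: "\<And>z. z \<in> S \<Longrightarrow> invertible (M z)"
    and diff: "M differentiable (at x)"
  shows "(\<lambda>z. matrix_inv (M z)) differentiable (at x)"
proof (intro differentiable_vecI)
  fix k l
  have M: "(\<lambda>z. M z $ i $ j) differentiable (at x)" for i j
    by (intro differentiable_vec_nth diff)
  have "(\<lambda>z. if j = k then axis l 1 $ i else M z $ i $ j) differentiable (at x)" for i j :: 'n
    using M by (cases "j = k") simp_all
  then have "(\<lambda>z. det (\<chi> i j. if j = k then axis l 1 $ i else M z $ i $ j) / det (M z)) differentiable (at x)"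
    using inv[OF S(2)] M
    by (intro differentiable_divide differentiable_det) (auto simp: invertible_det_nz)
  then show "(\<lambda>z. matrix_inv (M z) $ k $ l) differentiable (at x)"
    by (rule differentiable_cong_open[OF _ S]) (simp add: matrix_inv_cramer[OF inv])
qed

lemma christoffel_differentiable:
  fixes G :: "real ^ 'n::finite \<Rightarrow> real ^ 'n ^ 'n"
  assumes T: "open T" "p \<in> T" and inv: "\<And>z. z \<in> T \<Longrightarrow> invertible (G z)"
    and G: "\<And>i j. smooth_on T (\<lambda>z. G z $ i $ j)"
  shows "(\<lambda>z. christoffel G z c a b) differentiable (at p)"
proof -
  have "G differentiable (at p)"
    by (intro differentiable_vecI smooth_on_differentiable[OF G T(2)])
  then have "(\<lambda>z. matrix_inv (G z) $ i $ j) differentiable (at p)" for i j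
    using differentiable_matrix_inv[OF T inv] by (intro differentiable_vec_nth)
  moreover have "(\<lambda>z. pderiv_at (\<lambda>z. G z $ i $ j) z k) differentiable (at p)" for i j k
    by (rule smooth_on_differentiable[OF smooth_on_dir_deriv[OF G] T(2)])
  ultimately show ?thesis
    unfolding christoffel_def
    by (intro differentiable_mult differentiable_const differentiable_sum differentiable_add differentiable_diff) auto
qed

section \<open>Local geometry of an immersion\<close>

lemma differentiable_fst: "f differentiable F \<Longrightarrow> (\<lambda>z. fst (f z)) differentiable F"
  unfolding differentiable_def by (blast intro: has_derivative_fst)

lemma differentiable_snd: "f differentiable F \<Longrightarrow> (\<lambda>z. snd (f z)) differentiable F"
  unfolding differentiable_def by (blast intro: has_derivative_snd)

lemma symmetric_matrix_inner:
  fixes M :: "real ^ 'n ^ 'n::finite"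
  assumes "transpose M = M"
  shows "(M *v v) \<bullet> w = v \<bullet> (M *v w)"
  by (metis assms dot_lmul_matrix transpose_matrix_vector)

lemma positive_definite_invertible:
  fixes M :: "real ^ 'n ^ 'n::finite"
  assumes "\<And>v. v \<noteq> 0 \<Longrightarrow> v \<bullet> (M *v v) > 0"
  shows "invertible M"
  using assms unfolding invertible_left_inverse matrix_left_invertible_ker
  by (metis inner_zero_right less_irrefl)

lemma matrix_inv_cancel:
  fixes M :: "real ^ 'n ^ 'n::finite"
  assumes "invertible M"
  shows "M *v (matrix_inv M *v v) = v" "matrix_inv M *v (M *v v) = v"
  by (simp_all add: matrix_vector_mul_assoc matrix_inv_inverse[OF assms])

lemma matrix_inv_symmetric_inner:
  fixes M :: "real ^ 'n ^ 'n::finite"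
  assumes "invertible M" "transpose M = M"
  shows "(matrix_inv M *v v) \<bullet> w = v \<bullet> (matrix_inv M *v w)"
  by (metis assms matrix_inv_cancel(1) symmetric_matrix_inner)

text \<open>The projection onto the normal space orthogonal for \<open>G\<close>: the tangential
  part is recovered from the pairings with the coordinate tangent vectors through the inverse
  induced metric.\<close>

definition normal_part ::
    "(real ^ 'n \<Rightarrow> real ^ 'n ^ 'n) \<Rightarrow> (real ^ 'm \<Rightarrow> real ^ 'n::finite) \<Rightarrow> real ^ 'm::finite \<Rightarrow> real ^ 'n \<Rightarrow> real ^ 'n"
  where "normal_part G y x w =
    w - dir_deriv y x (matrix_inv (induced_metric G y x) *v (\<chi> i. pderiv_at y x i \<bullet> (G (y x) *v w)))"

text \<open>The vector \<sigma>H + \<mu>, with \<mu> raised. Pairing V with the normal tractor of v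
  amounts to pairing this vector with v, so that questions about normal tractors become questions
  about normal vectors.\<close>

definition shifted_covector ::
    "(real ^ 'n \<Rightarrow> real ^ 'n ^ 'n) \<Rightarrow> (real ^ 'm \<Rightarrow> real ^ 'n::finite) \<Rightarrow> real ^ 'm::finite \<Rightarrow> 'n tractor \<Rightarrow> real ^ 'n"
  where "shifted_covector G y x V =
    fst V *\<^sub>R mean_curvature G y x + matrix_inv (G (y x)) *v fst (snd V)"

locale local_immersion =
  fixes G :: "real ^ 'n::finite \<Rightarrow> real ^ 'n ^ 'n" and y :: "real ^ 'm::finite \<Rightarrow> real ^ 'n"
    and S :: "(real ^ 'm) set" and T :: "(real ^ 'n) set"
  assumes open_S: "open S" and open_T: "open T"
    and y_smooth: "smooth_on S y" and y_mem: "\<And>x. x \<in> S \<Longrightarrow> y x \<in> T"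
    and G_smooth: "smooth_on T G"
    and G_sym: "\<And>p. p \<in> T \<Longrightarrow> transpose (G p) = G p"
    and G_pos: "\<And>p v. p \<in> T \<Longrightarrow> v \<noteq> 0 \<Longrightarrow> v \<bullet> (G p *v v) > 0"
    and inj_dy: "\<And>x. x \<in> S \<Longrightarrow> inj (dir_deriv y x)"
begin

lemma G_comp_smooth: "smooth_on T (\<lambda>p. G p $ i $ j)"
  using smooth_on_vec_nth[OF open_T smooth_on_vec_nth[OF open_T G_smooth]] .

lemma G_invertible: "p \<in> T \<Longrightarrow> invertible (G p)"
  using positive_definite_invertible G_pos by blast

lemma G_inner: "x \<in> S \<Longrightarrow> (G (y x) *v v) \<bullet> w = v \<bullet> (G (y x) *v w)"
  by (rule symmetric_matrix_inner[OF G_sym[OF y_mem]])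

lemma Ginv_cancel:
  assumes "x \<in> S"
  shows "G (y x) *v (matrix_inv (G (y x)) *v v) = v" "matrix_inv (G (y x)) *v (G (y x) *v v) = v"
  using matrix_inv_cancel[OF G_invertible[OF y_mem[OF assms]]] by simp_all

lemma G_pos_y: "x \<in> S \<Longrightarrow> v \<noteq> 0 \<Longrightarrow> v \<bullet> (G (y x) *v v) > 0"
  using G_pos y_mem by blast

lemma y_differentiable: "x \<in> S \<Longrightarrow> y differentiable (at x)"
  by (rule smooth_on_differentiable[OF y_smooth])

lemma linear_dy: "x \<in> S \<Longrightarrow> linear (dir_deriv y x)"
  using has_derivative_dir_deriv[OF y_differentiable] has_derivative_linear by blast

lemma dy_expansion: "x \<in> S \<Longrightarrow> dir_deriv y x u = (\<Sum>i\<in>UNIV. u $ i *\<^sub>R pderiv_at y x i)"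
  by (rule dir_deriv_vec_expansion[OF y_differentiable])

lemma dy_inner:
  assumes "x \<in> S"
  shows "dir_deriv y x a \<bullet> w = a \<bullet> (\<chi> i. pderiv_at y x i \<bullet> w)"
  by (subst dy_expansion[OF assms]) (simp add: inner_sum_left inner_vec_def[of a])

lemma induced_metric_mult:
  assumes "x \<in> S"
  shows "induced_metric G y x *v b = (\<chi> i. pderiv_at y x i \<bullet> (G (y x) *v dir_deriv y x b))"
proof -
  have "pderiv_at y x i \<bullet> (G (y x) *v dir_deriv y x b)
      = (\<Sum>j\<in>UNIV. (pderiv_at y x i \<bullet> (G (y x) *v pderiv_at y x j)) * b $ j)" for i
  proof -
    have lin: "linear (\<lambda>v. pderiv_at y x i \<bullet> (G (y x) *v v))"
      by (rule linearI) (simp_all add: matrix_vector_right_distrib matrix_vector_mult_scaleR inner_add_right)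
    show ?thesis
      by (subst dy_expansion[OF assms]) (simp add: linear_sum[OF lin] linear_scale[OF lin] mult.commute)
  qed
  then show ?thesis
    by (simp add: vec_eq_iff induced_metric_def matrix_vector_mult_def[of "\<chi> i j. _ i j"])
qed

lemma induced_metric_inner:
  assumes "x \<in> S"
  shows "a \<bullet> (induced_metric G y x *v b) = dir_deriv y x a \<bullet> (G (y x) *v dir_deriv y x b)"
  unfolding induced_metric_mult[OF assms] by (rule dy_inner[OF assms, symmetric])

lemma induced_metric_sym:
  assumes "x \<in> S"
  shows "transpose (induced_metric G y x) = induced_metric G y x"
  using G_inner[OF assms]
  by (simp add: vec_eq_iff transpose_def induced_metric_def) (metis inner_commute)

lemma induced_metric_invertible:
  assumes "x \<in> S"
  shows "invertible (induced_metric G y x)"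
proof (rule positive_definite_invertible)
  fix v :: "real ^ 'm" assume "v \<noteq> 0"
  then have "dir_deriv y x v \<noteq> 0"
    using inj_dy[OF assms] linear_dy[OF assms] by (metis injD linear_0)
  then show "v \<bullet> (induced_metric G y x *v v) > 0"
    unfolding induced_metric_inner[OF assms] by (rule G_pos_y[OF assms])
qed

section \<open>Regularity of the induced geometry\<close>

lemma y_comp_smooth: "smooth_on S (\<lambda>z. pderiv_at y z j $ a)"
  by (rule smooth_on_vec_nth[OF open_S smooth_on_dir_deriv[OF y_smooth]])

lemma induced_metric_smooth: "smooth_on S (\<lambda>z. induced_metric G y z $ i $ j)"
proof -
  have "induced_metric G y z $ i $ j
      = (\<Sum>a\<in>UNIV. pderiv_at y z i $ a * (\<Sum>b\<in>UNIV. G (y z) $ a $ b * pderiv_at y z j $ b))" for z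
    by (simp add: induced_metric_def inner_vec_def matrix_vector_mult_def)
  moreover have "smooth_on S (\<lambda>z. \<Sum>a\<in>UNIV. pderiv_at y z i $ a * (\<Sum>b\<in>UNIV. G (y z) $ a $ b * pderiv_at y z j $ b))"
    by (intro smooth_on_sum[OF open_S] smooth_on_mult[OF open_S] y_comp_smooth
        smooth_on_compose[OF open_S open_T y_mem G_comp_smooth y_smooth])
  ultimately show ?thesis by simp
qed

lemma G_differentiable: "x \<in> S \<Longrightarrow> (\<lambda>z. G (y z)) differentiable (at x)"
  using has_derivative_chain[OF smooth_on_differentiable[OF G_smooth y_mem] y_differentiable]
  by (auto simp: differentiable_def)

lemma Ginv_differentiable: "x \<in> S \<Longrightarrow> (\<lambda>z. matrix_inv (G (y z))) differentiable (at x)"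
  by (rule differentiable_matrix_inv[OF open_S _ _ G_differentiable]) (simp_all add: G_invertible y_mem)

lemma induced_metric_differentiable: "x \<in> S \<Longrightarrow> induced_metric G y differentiable (at x)"
  by (intro differentiable_vecI smooth_on_differentiable[OF induced_metric_smooth])

lemma induced_metric_inv_differentiable:
  "x \<in> S \<Longrightarrow> (\<lambda>z. matrix_inv (induced_metric G y z)) differentiable (at x)"
  by (rule differentiable_matrix_inv[OF open_S _ induced_metric_invertible induced_metric_differentiable])

lemma dy_differentiable: "x \<in> S \<Longrightarrow> (\<lambda>z. dir_deriv y z u) differentiable (at x)"
  by (rule smooth_on_differentiable[OF smooth_on_dir_deriv[OF y_smooth]])

lemma christoffel_y_differentiable: 
  assumes "x \<in> S"
  shows "(\<lambda>z. christoffel G (y z) c a b) differentiable (at x)"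
  using has_derivative_chain[OF christoffel_differentiable[OF open_T y_mem[OF assms] G_invertible G_comp_smooth]
      y_differentiable[OF assms]]
  by (auto simp: differentiable_def)

lemma second_ff_differentiable:
  assumes x: "x \<in> S"
  shows "(\<lambda>z. second_ff G y z i j) differentiable (at x)"
proof -
  have *: "(\<lambda>z. pderiv_at (\<lambda>z. pderiv_at y z j $ c) z i) differentiable (at x)" for c
    by (rule smooth_on_differentiable[OF smooth_on_dir_deriv[OF y_comp_smooth] x])
  have "(\<lambda>z. \<chi> c. pderiv_at (\<lambda>z. pderiv_at y z j $ c) z i
        + (\<Sum>a\<in>UNIV. \<Sum>b\<in>UNIV. christoffel G (y z) c a b * pderiv_at y z i $ a * pderiv_at y z j $ b))
      differentiable (at x)"
    by (rule differentiable_vecI)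
      (auto intro!: differentiable_add * differentiable_sum differentiable_mult
        christoffel_y_differentiable[OF x] differentiable_vec_nth dy_differentiable[OF x])
  moreover have "(\<lambda>z. \<Sum>k\<in>UNIV. christoffel (induced_metric G y) z k i j *\<^sub>R pderiv_at y z k) differentiable (at x)"
    by (auto intro!: differentiable_sum differentiable_scaleR dy_differentiable[OF x]
        christoffel_differentiable[OF open_S x induced_metric_invertible induced_metric_smooth])
  ultimately show ?thesis unfolding second_ff_def by (rule differentiable_diff)
qed

lemma mean_curvature_differentiable:
  assumes x: "x \<in> S"
  shows "mean_curvature G y differentiable (at x)"
  unfolding mean_curvature_def[abs_def]
  by (auto intro!: differentiable_scaleR differentiable_const differentiable_sum differentiable_vec_nth
      induced_metric_inv_differentiable[OF x] second_ff_differentiable[OF x])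

lemma dy_field_differentiable:
  assumes x: "x \<in> S" and v: "v differentiable (at x)"
  shows "(\<lambda>z. dir_deriv y z (v z)) differentiable (at x)"
proof -
  have "(\<lambda>z. \<Sum>i\<in>UNIV. v z $ i *\<^sub>R pderiv_at y z i) differentiable (at x)"
    by (auto intro!: differentiable_sum differentiable_scaleR differentiable_vec_nth v dy_differentiable[OF x])
  then show ?thesis
    by (rule differentiable_cong_open[OF _ open_S x]) (rule dy_expansion[symmetric])
qed

lemma normal_part_differentiable:
  assumes x: "x \<in> S" and w: "w differentiable (at x)"
  shows "(\<lambda>z. normal_part G y z (w z)) differentiable (at x)"
proof -
  have "(\<lambda>z. \<chi> i. pderiv_at y z i \<bullet> (G (y z) *v w z)) differentiable (at x)"
    by (rule differentiable_vecI)
      (auto intro!: differentiable_inner dy_differentiable[OF x] differentiable_matrix_vector_mult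
        G_differentiable[OF x] w)
  then show ?thesis
    unfolding normal_part_def
    by (intro differentiable_diff w dy_field_differentiable[OF x] differentiable_matrix_vector_mult
        induced_metric_inv_differentiable[OF x])
qed

section \<open>Orthogonal projection onto the normal space\<close>

lemma linear_normal_part:
  assumes x: "x \<in> S"
  shows "linear (normal_part G y x)"
proof -
  have "linear (\<lambda>w. w - (dir_deriv y x \<circ> ((\<lambda>a. matrix_inv (induced_metric G y x) *v a)
          \<circ> (\<lambda>w. \<chi> i. pderiv_at y x i \<bullet> (G (y x) *v w)))) w)"
  proof (intro linear_compose_sub linear_compose linear_dy[OF x] matrix_vector_mul_linear linear_ident)
    show "linear (\<lambda>w. \<chi> i. pderiv_at y x i \<bullet> (G (y x) *v w))"
      by (rule linearI) (simp_all add: vec_eq_iff matrix_vector_right_distrib inner_add_right matrix_vector_mult_scaleR)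
  qed
  then show ?thesis by (simp add: normal_part_def[abs_def] o_def)
qed

lemma normal_part_normal:
  assumes x: "x \<in> S"
  shows "normal_part G y x w \<in> normal_vectors G y x"
proof -
  have "normal_part G y x w \<bullet> (G (y x) *v dir_deriv y x a) = 0" for a
  proof -
    let ?g = "induced_metric G y x"
    let ?\<nu> = "\<chi> i. pderiv_at y x i \<bullet> (G (y x) *v w)"
    have "dir_deriv y x (matrix_inv ?g *v ?\<nu>) \<bullet> (G (y x) *v dir_deriv y x a)
        = (matrix_inv ?g *v ?\<nu>) \<bullet> (?g *v a)"
      by (simp only: induced_metric_inner[OF x])
    also have "\<dots> = ?\<nu> \<bullet> a"
      by (simp only: symmetric_matrix_inner[OF induced_metric_sym[OF x], symmetric]
          matrix_inv_cancel[OF induced_metric_invertible[OF x]])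
    also have "\<dots> = dir_deriv y x a \<bullet> (G (y x) *v w)"
      by (rule trans[OF inner_commute dy_inner[OF x, symmetric]])
    also have "\<dots> = w \<bullet> (G (y x) *v dir_deriv y x a)"
      by (metis G_inner[OF x] inner_commute)
    finally show ?thesis by (simp add: normal_part_def inner_diff_left)
  qed
  then show ?thesis by (simp add: normal_vectors_def)
qed

lemma normal_part_of_normal:
  assumes x: "x \<in> S" and v: "v \<in> normal_vectors G y x"
  shows "normal_part G y x v = v"
proof -
  have "pderiv_at y x i \<bullet> (G (y x) *v v) = 0" for i
    using v G_inner[OF x] by (metis (mono_tags) inner_commute mem_Collect_eq normal_vectors_def)
  then have "(\<chi> i. pderiv_at y x i \<bullet> (G (y x) *v v)) = 0" by (simp add: vec_eq_iff)
  then show ?thesis using linear_0[OF linear_dy[OF x]] by (simp add: normal_part_def)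
qed

lemma normal_part_tangent:
  assumes x: "x \<in> S"
  shows "normal_part G y x (dir_deriv y x a) = 0"
  unfolding normal_part_def induced_metric_mult[OF x, symmetric]
  by (simp add: matrix_inv_cancel[OF induced_metric_invertible[OF x]])

lemma normal_inner_normal_part:
  assumes x: "x \<in> S" and v: "v \<in> normal_vectors G y x"
  shows "v \<bullet> (G (y x) *v normal_part G y x w) = v \<bullet> (G (y x) *v w)"
proof -
  have "v \<bullet> (G (y x) *v dir_deriv y x a) = 0" for a using v by (simp add: normal_vectors_def)
  then show ?thesis
    by (simp add: normal_part_def matrix_vector_mult_diff_distrib inner_diff_right)
qed

lemma normal_part_sym:
  assumes x: "x \<in> S"
  shows "normal_part G y x v \<bullet> (G (y x) *v w) = v \<bullet> (G (y x) *v normal_part G y x w)"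
  by (metis G_inner[OF x] inner_commute normal_inner_normal_part[OF x normal_part_normal[OF x]])

section \<open>Normal tractors and the projection onto them\<close>

lemma linear_normal_tractor: "linear (normal_tractor G y x)"
  by (rule linearI)
    (simp_all add: normal_tractor_def matrix_vector_right_distrib matrix_vector_mult_scaleR inner_add_left)

lemma tractor_metric_normal_tractor:
  assumes x: "x \<in> S"
  shows "tractor_metric (G (y x)) V (normal_tractor G y x v) = v \<bullet> (G (y x) *v shifted_covector G y x V)"
  using Ginv_cancel[OF x]
  by (cases V rule: prod_cases3)
    (simp add: tractor_metric_def normal_tractor_def shifted_covector_def matrix_vector_right_distrib
      matrix_vector_mult_scaleR inner_add_right inner_commute)

lemma linear_shifted_covector: "linear (shifted_covector G y x)"
  by (rule linearI)
    (simp_all add: shifted_covector_def matrix_vector_right_distrib matrix_vector_mult_scaleR algebra_simps)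

lemma shifted_covector_normal_tractor:
  "x \<in> S \<Longrightarrow> shifted_covector G y x (normal_tractor G y x v) = v"
  by (simp add: shifted_covector_def normal_tractor_def Ginv_cancel)

lemma normal_tractors_perp_iff:
  assumes x: "x \<in> S"
  shows "V \<in> normal_tractors_perp G y x \<longleftrightarrow> normal_part G y x (shifted_covector G y x V) = 0"
proof -
  let ?w = "shifted_covector G y x V"
  have "V \<in> normal_tractors_perp G y x \<longleftrightarrow> (\<forall>v\<in>normal_vectors G y x. v \<bullet> (G (y x) *v ?w) = 0)"
    by (simp add: normal_tractors_perp_def normal_tractors_def tractor_metric_normal_tractor[OF x])
  also have "\<dots> \<longleftrightarrow> (\<forall>v\<in>normal_vectors G y x. v \<bullet> (G (y x) *v normal_part G y x ?w) = 0)"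
    by (simp add: normal_inner_normal_part[OF x])
  also have "\<dots> \<longleftrightarrow> normal_part G y x ?w = 0"
  proof
    assume "\<forall>v\<in>normal_vectors G y x. v \<bullet> (G (y x) *v normal_part G y x ?w) = 0"
    \<comment> \<open>The normal part is itself a normal vector and may be tested against itself;
      the metric is positive definite.\<close>
    then have "normal_part G y x ?w \<bullet> (G (y x) *v normal_part G y x ?w) = 0"
      using normal_part_normal[OF x] by blast
    then show "normal_part G y x ?w = 0" using G_pos_y[OF x] by (metis less_irrefl)
  qed simp
  finally show ?thesis .
qed

text \<open>Subtracting the normal tractor of a normal vector v from V subtracts v from the normal
  part of the shifted covector. Hence exactly one v leaves a remainder orthogonal to all normal
  tractors.\<close>

lemma normal_proj_eq:
  assumes x: "x \<in> S"
  shows "normal_proj G y x V = normal_tractor G y x (normal_part G y x (shifted_covector G y x V))"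
  unfolding normal_proj_def
proof (rule the_equality)
  let ?v = "normal_part G y x (shifted_covector G y x V)"
  note linear = linear_diff[OF linear_normal_part[OF x]] linear_diff[OF linear_shifted_covector]
  have *: "normal_part G y x (shifted_covector G y x (V - normal_tractor G y x v)) = ?v - v"
    if "v \<in> normal_vectors G y x" for v
    by (simp add: linear shifted_covector_normal_tractor[OF x] normal_part_of_normal[OF x that])
  show "normal_tractor G y x ?v \<in> normal_tractors G y x
      \<and> V - normal_tractor G y x ?v \<in> normal_tractors_perp G y x"
    unfolding normal_tractors_perp_iff[OF x] *[OF normal_part_normal[OF x]]
    using normal_part_normal[OF x] by (simp add: normal_tractors_def)
  fix W assume W: "W \<in> normal_tractors G y x \<and> V - W \<in> normal_tractors_perp G y x"
  then obtain v where v: "v \<in> normal_vectors G y x" "W = normal_tractor G y x v"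
    by (auto simp: normal_tractors_def)
  then have "?v - v = 0" using W *[OF v(1)] by (simp add: normal_tractors_perp_iff[OF x])
  then show "W = normal_tractor G y x ?v" using v(2) by simp
qed

lemma normal_proj_eq_0_iff:
  assumes x: "x \<in> S"
  shows "normal_proj G y x V = 0 \<longleftrightarrow> V \<in> normal_tractors_perp G y x"
  unfolding normal_proj_eq[OF x] normal_tractors_perp_iff[OF x]
  by (metis linear_0[OF linear_normal_tractor] shifted_covector_normal_tractor[OF x] linear_0[OF linear_shifted_covector])

lemma linear_normal_proj:
  assumes x: "x \<in> S"
  shows "linear (normal_proj G y x)"
proof -
  have "normal_proj G y x = normal_tractor G y x \<circ> (normal_part G y x \<circ> shifted_covector G y x)"
    by (rule ext) (simp add: normal_proj_eq[OF x])
  then show ?thesis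
    by (simp only:) (intro linear_compose linear_shifted_covector linear_normal_part[OF x] linear_normal_tractor)
qed

lemma normal_proj_idem: "x \<in> S \<Longrightarrow> normal_proj G y x (normal_proj G y x V) = normal_proj G y x V"
  by (simp add: normal_proj_eq shifted_covector_normal_tractor normal_part_of_normal normal_part_normal)

text \<open>The same vector, built from the last two slots of a covector, is the shifted covector of
  its sharp (\<open>sh\<close>) and represents its pairing with normal tractors (\<open>nt\<close>).
  What remains is the symmetry of \<open>normal_part\<close> for \<open>G\<close>.\<close>

lemma normal_proj_sym:
  assumes x: "x \<in> S"
  shows "normal_proj G y x (tractor_sharp (G (y x)) e) \<bullet> e' = e \<bullet> normal_proj G y x (tractor_sharp (G (y x)) e')"
proof -
  have sh: "shifted_covector G y x (tractor_sharp (G (y x)) e)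
      = snd (snd e) *\<^sub>R mean_curvature G y x + fst (snd e)" for e
    by (cases e rule: prod_cases3) (simp add: shifted_covector_def tractor_sharp_def Ginv_cancel[OF x])
  have nt: "normal_tractor G y x v \<bullet> e
      = v \<bullet> (G (y x) *v (snd (snd e) *\<^sub>R mean_curvature G y x + fst (snd e)))" for v e
    by (cases e rule: prod_cases3)
      (simp add: normal_tractor_def matrix_vector_right_distrib matrix_vector_mult_scaleR inner_add_right G_inner[OF x])
  show ?thesis
    unfolding normal_proj_eq[OF x] nt sh inner_commute[of e]
    by (metis normal_part_sym[OF x] G_inner[OF x] inner_commute)
qed

lemma normal_proj_differentiable:
  assumes x: "x \<in> S"
  shows "(\<lambda>z. normal_proj G y z V) differentiable (at x)"
proof -
  define v where "v z = normal_part G y z (shifted_covector G y z V)" for z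
  have v: "v differentiable (at x)"
    unfolding v_def[abs_def] shifted_covector_def
    by (intro normal_part_differentiable[OF x] differentiable_add differentiable_scaleR differentiable_const
        differentiable_matrix_vector_mult mean_curvature_differentiable[OF x] Ginv_differentiable[OF x])
  have "(\<lambda>z. normal_tractor G y z (v z)) differentiable (at x)"
    unfolding normal_tractor_def
    by (intro differentiable_Pair differentiable_const differentiable_inner differentiable_matrix_vector_mult v
        G_differentiable[OF x] mean_curvature_differentiable[OF x])
  then show ?thesis
    by (rule differentiable_cong_open[OF _ open_S x]) (simp add: normal_proj_eq v_def)
qed

lemma range_normal_proj:
  assumes x: "x \<in> S"
  shows "range (normal_proj G y x) = normal_tractors G y x"
proof
  show "range (normal_proj G y x) \<subseteq> normal_tractors G y x"
    using normal_part_normal[OF x] by (auto simp: normal_tractors_def normal_proj_eq[OF x])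
  show "normal_tractors G y x \<subseteq> range (normal_proj G y x)"
  proof
    fix W assume "W \<in> normal_tractors G y x"
    then have "W = normal_proj G y x W"
      by (auto simp: normal_tractors_def normal_proj_eq[OF x] shifted_covector_normal_tractor[OF x] normal_part_of_normal[OF x])
    then show "W \<in> range (normal_proj G y x)" by blast
  qed
qed

text \<open>Being normal for \<open>G\<close> is Euclidean orthogonality to the image of
  \<open>?f\<close>, which has dimension m by injectivity. No dimension is lost from normal vectors
  to normal tractors, as \<open>shifted_covector\<close> is a left inverse.\<close>

lemma dim_normal_tractors:
  assumes x: "x \<in> S"
  shows "dim (normal_tractors G y x) + CARD('m) = CARD('n)"
proof -
  let ?f = "\<lambda>u. G (y x) *v dir_deriv y x u"
  have lin: "linear ?f"
    using linear_compose[OF linear_dy[OF x] matrix_vector_mul_linear[of "G (y x)"]] by (simp add: o_def)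
  have "inj ?f"
    using inj_dy[OF x] Ginv_cancel(2)[OF x] by (metis (no_types, lifting) inj_def)
  then have "dim (range ?f) = CARD('m)"
    using dim_image_eq[OF lin, of UNIV] by simp
  moreover have "normal_vectors G y x = {v \<in> UNIV. \<forall>w\<in>range ?f. orthogonal w v}"
    by (auto simp: normal_vectors_def orthogonal_def inner_commute)
  moreover have "dim {v \<in> UNIV. \<forall>w\<in>range ?f. orthogonal w v} + dim (range ?f) = dim (UNIV :: (real ^ 'n) set)"
    by (rule dim_subspace_orthogonal_to_vectors) (simp_all add: linear_subspace_image[OF lin])
  ultimately have "dim (normal_vectors G y x) + CARD('m) = CARD('n)" by simp
  moreover have "dim (normal_tractors G y x) = dim (normal_vectors G y x)"
    unfolding normal_tractors_def
    by (rule dim_image_eq[OF linear_normal_tractor])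
      (metis inj_on_inverseI shifted_covector_normal_tractor[OF x])
  ultimately show ?thesis by simp
qed

section \<open>The tractors of the submanifold as kernel of the projection\<close>

lemma normal_proj_tractor_incl:
  assumes x: "x \<in> S"
  shows "normal_proj G y x (tractor_incl G y x X) = 0"
proof -
  obtain \<sigma> \<nu> \<rho> where X: "X = (\<sigma>, \<nu>, \<rho>)" by (cases X rule: prod_cases3)
  \<comment> \<open>The shift by -\<sigma>H in \<open>tractor_incl\<close> cancels the term
    \<sigma>H of the shifted covector and leaves a tangent vector.\<close>
  have "shifted_covector G y x (tractor_incl G y x X)
      = dir_deriv y x (matrix_inv (induced_metric G y x) *v \<nu>)"
    by (simp add: shifted_covector_def tractor_incl_def X Let_def matrix_vector_mult_diff_distrib
        matrix_vector_mult_scaleR Ginv_cancel[OF x])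
  then show ?thesis
    by (simp add: normal_proj_eq[OF x] normal_part_tangent[OF x] linear_0[OF linear_normal_tractor])
qed

lemma tractor_incl_surj:
  assumes x: "x \<in> S" and V: "normal_proj G y x V = 0"
  obtains X where "tractor_incl G y x X = V"
proof -
  obtain \<sigma> \<mu> \<rho> where V': "V = (\<sigma>, \<mu>, \<rho>)" by (cases V rule: prod_cases3)
  let ?H = "mean_curvature G y x"
  define w where "w = shifted_covector G y x V"
  \<comment> \<open>The pairings of \<open>w\<close> with the coordinate tangent vectors; since
    \<open>w\<close> has no normal part, they recover it.\<close>
  define \<nu> where "\<nu> = (\<chi> i. pderiv_at y x i \<bullet> (G (y x) *v w))"
  have "normal_part G y x w = 0"
    using V by (simp add: normal_proj_eq_0_iff[OF x] normal_tractors_perp_iff[OF x] w_def)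
  then have w: "dir_deriv y x (matrix_inv (induced_metric G y x) *v \<nu>) = w"
    by (simp add: normal_part_def \<nu>_def)
  have "G (y x) *v w = \<sigma> *\<^sub>R (G (y x) *v ?H) + \<mu>"
    by (simp add: w_def shifted_covector_def V' matrix_vector_right_distrib matrix_vector_mult_scaleR Ginv_cancel[OF x])
  \<comment> \<open>The addition to the last slot undoes the quadratic shift by H in
    \<open>tractor_incl\<close>.\<close>
  then have "tractor_incl G y x (\<sigma>, \<nu>, \<rho> + 1 / 2 * (?H \<bullet> (G (y x) *v ?H)) * \<sigma>) = V"
    by (simp add: tractor_incl_def Let_def w V')
  then show thesis using that by blast
qed

lemma tractor_incl_differentiable:
  assumes x: "x \<in> S" and V: "V differentiable (at x)"
  shows "(\<lambda>z. tractor_incl G y z (V z)) differentiable (at x)"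
proof -
  note comps = differentiable_fst[OF V] differentiable_fst[OF differentiable_snd[OF V]]
    differentiable_snd[OF differentiable_snd[OF V]]
  show ?thesis
    unfolding tractor_incl_def case_prod_beta Let_def
    by (intro differentiable_Pair differentiable_diff differentiable_mult differentiable_scaleR differentiable_const
        differentiable_inner differentiable_matrix_vector_mult dy_field_differentiable[OF x]
        G_differentiable[OF x] mean_curvature_differentiable[OF x] induced_metric_inv_differentiable[OF x] comps)
qed

end

section \<open>The tractor connection along an immersion\<close>

lemma dir_deriv_bounded_linear:
  assumes "bounded_linear L" "f differentiable (at x)"
  shows "dir_deriv (\<lambda>z. L (f z)) x u = L (dir_deriv f x u)"
  by (rule dir_deriv_eqI) (intro bounded_linear.has_derivative[OF assms(1)] has_derivative_dir_deriv assms(2))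

lemma christoffel_lower:
  fixes G :: "real ^ 'n::finite \<Rightarrow> real ^ 'n ^ 'n"
  assumes "invertible (G p)"
  shows "(\<Sum>c\<in>UNIV. G p $ d $ c * christoffel G p c a b) =
    1 / 2 * (pderiv_at (\<lambda>z. G z $ b $ d) p a + pderiv_at (\<lambda>z. G z $ a $ d) p b
      - pderiv_at (\<lambda>z. G z $ a $ b) p d)"
proof -
  define K where "K = (\<chi> d. 1 / 2 * (pderiv_at (\<lambda>z. G z $ b $ d) p a + pderiv_at (\<lambda>z. G z $ a $ d) p b
      - pderiv_at (\<lambda>z. G z $ a $ b) p d))"
  have "(matrix_inv (G p) *v K) $ c = christoffel G p c a b" for c
    unfolding christoffel_def K_def matrix_vector_mult_def
    by (simp add: sum_distrib_left mult.left_commute)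
  then have "(\<Sum>c\<in>UNIV. G p $ d $ c * christoffel G p c a b) = (G p *v (matrix_inv (G p) *v K)) $ d"
    unfolding matrix_vector_mult_def[of "G p"] by simp
  then show ?thesis by (simp add: matrix_inv_cancel[OF assms] K_def)
qed

text \<open>In the sum of the two lowered Christoffel symbols the wanted derivative of the metric
  occurs twice with factor 1/2, by symmetry of the metric near p, and the other four derivatives
  cancel.\<close>

lemma christoffel_metric_compatible:
  fixes G :: "real ^ 'n::finite \<Rightarrow> real ^ 'n ^ 'n"
  assumes T: "open T" "p \<in> T" and sym: "\<And>z. z \<in> T \<Longrightarrow> transpose (G z) = G z" and inv: "invertible (G p)"
  shows "pderiv_at (\<lambda>z. G z $ b $ d) p a =
    (\<Sum>c\<in>UNIV. christoffel G p c a b * G p $ c $ d) + (\<Sum>c\<in>UNIV. G p $ b $ c * christoffel G p c a d)"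
proof -
  have s: "G z $ i $ j = G z $ j $ i" if "z \<in> T" for z i j
    using sym[OF that] by (simp add: transpose_def vec_eq_iff)
  have ps: "pderiv_at (\<lambda>z. G z $ i $ j) p k = pderiv_at (\<lambda>z. G z $ j $ i) p k" for i j k
    by (subst dir_deriv_cong_open[OF T, of _ "\<lambda>z. G z $ j $ i"]) (simp_all add: s)
  have "(\<Sum>c\<in>UNIV. christoffel G p c a b * G p $ c $ d) = (\<Sum>c\<in>UNIV. G p $ d $ c * christoffel G p c a b)"
    by (intro sum.cong refl) (simp add: s[OF T(2), of d] mult.commute)
  moreover have "p1 = s1 + 1 / 2 * (p2 + r - q)"
    if "s1 = s2" "s2 = 1 / 2 * (p1 + q - r)" "p2 = p1" for s1 s2 p1 p2 q r :: real
    using that by (simp add: field_simps)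
  ultimately show ?thesis
    unfolding christoffel_lower[where G = G, OF inv, of b a d]
    using christoffel_lower[where G = G, OF inv, of d a b] ps[of d b a] by blast
qed

text \<open>The Christoffel symbols contracted with w, with the lower index as row. Multiplication
  by \<open>*v\<close> is the action on covectors and by \<open>v*\<close> the action on vectors, so
  both occur below.\<close>

definition connection_matrix ::
    "(real ^ 'n::finite \<Rightarrow> real ^ 'n ^ 'n) \<Rightarrow> real ^ 'n \<Rightarrow> real ^ 'n \<Rightarrow> real ^ 'n ^ 'n"
  where "connection_matrix G p w = (\<chi> b c. \<Sum>a\<in>UNIV. christoffel G p c a b * w $ a)"

lemma tractor_nabla_const:
  fixes G :: "real ^ 'n::finite \<Rightarrow> real ^ 'n ^ 'n" and y :: "real ^ 'm::finite \<Rightarrow> real ^ 'n" and x u :: "real ^ 'm"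
  defines "P \<equiv> schouten G (y x)" and "w \<equiv> dir_deriv y x u"
  shows "tractor_nabla G y (\<lambda>_. (\<sigma>, \<mu>, \<rho>)) x u =
    (- (w \<bullet> \<mu>),
     \<sigma> *\<^sub>R (w v* P) + \<rho> *\<^sub>R (w v* G (y x)) - connection_matrix G (y x) w *v \<mu>,
     - ((w v* P) \<bullet> (matrix_inv (G (y x)) *v \<mu>)))"
proof -
  have "(\<Sum>a\<in>UNIV. \<Sum>c\<in>UNIV. christoffel G (y x) c a b * w $ a * \<mu> $ c)
      = (connection_matrix G (y x) w *v \<mu>) $ b" for b
    by (subst sum.swap) (simp add: connection_matrix_def matrix_vector_mult_def sum_distrib_right)
  moreover have "(\<Sum>a\<in>UNIV. \<Sum>b\<in>UNIV. P $ a $ b * w $ a * m $ b) = (w v* P) \<bullet> m" for m :: "real ^ 'n"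
    by (subst sum.swap) (simp add: inner_vec_def vector_matrix_mult_def sum_distrib_left sum_distrib_right mult_ac)
  ultimately show ?thesis
    by (simp add: tractor_nabla_def Let_def P_def[symmetric] w_def[symmetric])
      (simp add: vec_eq_iff vector_matrix_mult_def mult.commute)
qed

text \<open>All derivatives of V are gathered in the first term, and the second is linear in the
  value of V. This brings the connection into the shape used by
  \<open>projection_field\<close>.\<close>

lemma tractor_nabla_eq:
  fixes G :: "real ^ 'n::finite \<Rightarrow> real ^ 'n ^ 'n" and y :: "real ^ 'm::finite \<Rightarrow> real ^ 'n"
  assumes V: "V differentiable (at x)"
  shows "tractor_nabla G y V x u = dir_deriv V x u + tractor_nabla G y (\<lambda>_. V x) x u"
proof -
  have bl: "bounded_linear (\<lambda>X :: 'n tractor. fst X)" "bounded_linear (\<lambda>X :: 'n tractor. fst (snd X) $ b)"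
      "bounded_linear (\<lambda>X :: 'n tractor. snd (snd X))" for b
    by (intro bounded_linear_compose[OF bounded_linear_fst] bounded_linear_compose[OF bounded_linear_snd]
        bounded_linear_compose[OF bounded_linear_vec_nth] bounded_linear_fst bounded_linear_snd)+
  have "dir_deriv V x u = (dir_deriv (\<lambda>z. fst (V z)) x u, \<chi> b. dir_deriv (\<lambda>z. fst (snd (V z)) $ b) x u,
      dir_deriv (\<lambda>z. snd (snd (V z))) x u)"
    by (simp add: prod_eq_iff vec_eq_iff dir_deriv_bounded_linear[OF bl(1) V]
        dir_deriv_bounded_linear[OF bl(2) V] dir_deriv_bounded_linear[OF bl(3) V])
  then show ?thesis
    by (simp add: tractor_nabla_def Let_def vec_eq_iff)
qed

lemma linear_tractor_nabla_const: "linear (\<lambda>X. tractor_nabla G y (\<lambda>_. X) x u)"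
proof (rule linearI)
  fix X Y :: "'a tractor" and r
  obtain \<sigma> \<mu> \<rho> \<sigma>' \<mu>' \<rho>' where "X = (\<sigma>, \<mu>, \<rho>)" "Y = (\<sigma>', \<mu>', \<rho>')" by (metis prod_cases3)
  then show "tractor_nabla G y (\<lambda>_. X + Y) x u = tractor_nabla G y (\<lambda>_. X) x u + tractor_nabla G y (\<lambda>_. Y) x u"
    "tractor_nabla G y (\<lambda>_. r *\<^sub>R X) x u = r *\<^sub>R tractor_nabla G y (\<lambda>_. X) x u"
    by (simp_all add: tractor_nabla_const matrix_vector_right_distrib matrix_vector_mult_scaleR algebra_simps)
qed

context local_immersion
begin

lemma vector_matrix_G: "x \<in> S \<Longrightarrow> v v* G (y x) = G (y x) *v v"
  by (metis G_sym transpose_matrix_vector y_mem)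

text \<open>Up to sign this is the tractor connection on covectors with constant components. It is
  found by moving each coefficient across the Euclidean pairing, and its explicit form allows
  \<open>tractor_sharp_parallel\<close> to be checked slot by slot.\<close>

lemma adjoint_tractor_nabla:
  fixes u :: "real ^ 'm"
  assumes x: "x \<in> S"
  defines "p \<equiv> dir_deriv y x u v* schouten G (y x)"
  shows "adjoint (\<lambda>X. tractor_nabla G y (\<lambda>_. X) x u) (a, \<beta>, c) =
    (p \<bullet> \<beta>,
     - (a *\<^sub>R dir_deriv y x u) - \<beta> v* connection_matrix G (y x) (dir_deriv y x u)
       - c *\<^sub>R (matrix_inv (G (y x)) *v p),
     (G (y x) *v dir_deriv y x u) \<bullet> \<beta>)"
proof -
  let ?w = "dir_deriv y x u" and ?C = "connection_matrix G (y x) (dir_deriv y x u)"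
  define L :: "'n tractor \<Rightarrow> 'n tractor" where "L = (\<lambda>(a, \<beta>, c). (p \<bullet> \<beta>,
     - (a *\<^sub>R ?w) - \<beta> v* ?C - c *\<^sub>R (matrix_inv (G (y x)) *v p), (G (y x) *v ?w) \<bullet> \<beta>))"
  have C: "(?C *v \<mu>) \<bullet> \<beta> = \<mu> \<bullet> (\<beta> v* ?C)" for \<mu> \<beta>
    by (metis dot_lmul_matrix inner_commute)
  have Gi: "p \<bullet> (matrix_inv (G (y x)) *v \<mu>) = \<mu> \<bullet> (matrix_inv (G (y x)) *v p)" for \<mu>
    using matrix_inv_symmetric_inner[OF G_invertible[OF y_mem[OF x]] G_sym[OF y_mem[OF x]]]
    by (metis inner_commute)
  have "adjoint (\<lambda>X. tractor_nabla G y (\<lambda>_. X) x u) = L"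
  proof (rule adjoint_unique, intro allI)
    fix X Y :: "'n tractor"
    obtain \<sigma> \<mu> \<rho> a \<beta> c where "X = (\<sigma>, \<mu>, \<rho>)" "Y = (a, \<beta>, c)" by (metis prod_cases3)
    then show "tractor_nabla G y (\<lambda>_. X) x u \<bullet> Y = X \<bullet> L Y"
      by (simp add: tractor_nabla_const L_def p_def[symmetric] C Gi vector_matrix_G[OF x]
          inner_diff_left inner_diff_right inner_add_left inner_commute[of ?w] algebra_simps)
  qed
  then show ?thesis by (simp add: L_def)
qed

text \<open>The metric is parallel along the immersion: the first term belongs to the free covector
  index, the second to the contracted vector, whose components are constant.\<close>

lemma metric_dir_deriv:
  assumes x: "x \<in> S"
  shows "dir_deriv (\<lambda>z. G (y z) *v \<beta>) x u =
    connection_matrix G (y x) (dir_deriv y x u) *v (G (y x) *v \<beta>)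
    + G (y x) *v (\<beta> v* connection_matrix G (y x) (dir_deriv y x u))"
proof -
  let ?w = "dir_deriv y x u" and ?C = "connection_matrix G (y x) (dir_deriv y x u)"
  have yx: "y x \<in> T" by (rule y_mem[OF x])
  have d: "dir_deriv (\<lambda>z. G (y z) $ b $ d) x u = (\<Sum>c\<in>UNIV. ?C $ b $ c * G (y x) $ c $ d + G (y x) $ b $ c * ?C $ d $ c)"
    for b d
  proof -
    have compat: "pderiv_at (\<lambda>p. G p $ b $ d) (y x) a =
        (\<Sum>c\<in>UNIV. christoffel G (y x) c a b * G (y x) $ c $ d)
        + (\<Sum>c\<in>UNIV. G (y x) $ b $ c * christoffel G (y x) c a d)" for a
      by (rule christoffel_metric_compatible[where G = G, OF open_T yx _ G_invertible[OF yx]]) (rule G_sym)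
    have GT: "(\<lambda>p. G p $ b $ d) differentiable (at (y x))" by (rule smooth_on_differentiable[OF G_comp_smooth yx])
    have "dir_deriv (\<lambda>z. G (y z) $ b $ d) x u = dir_deriv (\<lambda>p. G p $ b $ d) (y x) ?w"
      by (rule dir_deriv_eqI[OF has_derivative_chain[OF GT y_differentiable[OF x]]])
    also have "\<dots> = (\<Sum>a\<in>UNIV. ?w $ a *\<^sub>R pderiv_at (\<lambda>p. G p $ b $ d) (y x) a)"
      by (rule dir_deriv_vec_expansion[OF GT])
    also have "\<dots> = (\<Sum>a\<in>UNIV. \<Sum>c\<in>UNIV. christoffel G (y x) c a b * ?w $ a * G (y x) $ c $ d
        + G (y x) $ b $ c * (christoffel G (y x) c a d * ?w $ a))"
      unfolding compat by (simp add: sum_distrib_left distrib_left sum.distrib mult_ac)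
    also have "\<dots> = (\<Sum>c\<in>UNIV. ?C $ b $ c * G (y x) $ c $ d + G (y x) $ b $ c * ?C $ d $ c)"
      by (subst sum.swap) (simp add: connection_matrix_def sum_distrib_right sum_distrib_left sum.distrib)
    finally show ?thesis .
  qed
  have "dir_deriv (\<lambda>z. G (y z) *v \<beta>) x u $ b
      = (\<Sum>d\<in>UNIV. dir_deriv (\<lambda>z. G (y z) $ b $ d) x u * \<beta> $ d)" for b
  proof -
    have "dir_deriv (\<lambda>z. G (y z) *v \<beta>) x u $ b = dir_deriv (\<lambda>z. (G (y z) *v \<beta>) $ b) x u"
      by (rule dir_deriv_bounded_linear[OF bounded_linear_vec_nth, symmetric])
        (intro differentiable_matrix_vector_mult G_differentiable[OF x] differentiable_const)
    also have "\<dots> = dir_deriv (\<lambda>z. \<Sum>d\<in>UNIV. G (y z) $ b $ d * \<beta> $ d) x u"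
      by (simp add: matrix_vector_mult_def)
    also have "\<dots> = (\<Sum>d\<in>UNIV. dir_deriv (\<lambda>z. G (y z) $ b $ d) x u * \<beta> $ d)"
      by (rule dir_deriv_eqI)
        (intro has_derivative_sum has_derivative_mult_left has_derivative_dir_deriv
          differentiable_vec_nth G_differentiable[OF x])
    finally show ?thesis .
  qed
  moreover have "(\<Sum>d\<in>UNIV. (\<Sum>c\<in>UNIV. ?C $ b $ c * G (y x) $ c $ d + G (y x) $ b $ c * ?C $ d $ c) * \<beta> $ d)
      = (?C *v (G (y x) *v \<beta>) + G (y x) *v (\<beta> v* ?C)) $ b" for b
    unfolding sum_distrib_right
    by (subst sum.swap)
      (simp add: matrix_vector_mult_def vector_matrix_mult_def sum_distrib_left sum.distrib distrib_right distrib_left mult_ac)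
  ultimately show ?thesis by (simp add: vec_eq_iff d)
qed

lemma tractor_sharp_differentiable:
  assumes x: "x \<in> S"
  shows "(\<lambda>z. tractor_sharp (G (y z)) e) differentiable (at x)"
  unfolding tractor_sharp_def case_prod_beta
  by (intro differentiable_Pair differentiable_const differentiable_matrix_vector_mult G_differentiable[OF x])

text \<open>Compatibility with the tractor metric, stated for the inverse metric: this way no derivative of an
  inverse matrix is needed.\<close>

lemma tractor_sharp_parallel:
  assumes x: "x \<in> S"
  shows "dir_deriv (\<lambda>z. tractor_sharp (G (y z)) e) x u =
    - tractor_nabla G y (\<lambda>_. tractor_sharp (G (y x)) e) x u
    - tractor_sharp (G (y x)) (adjoint (\<lambda>X. tractor_nabla G y (\<lambda>_. X) x u) e)"
proof -
  obtain a \<beta> c where e: "e = (a, \<beta>, c)" by (cases e rule: prod_cases3)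
  have "dir_deriv (\<lambda>z. tractor_sharp (G (y z)) e) x u = (0, dir_deriv (\<lambda>z. G (y z) *v \<beta>) x u, 0)"
    unfolding e tractor_sharp_def prod.case
    by (rule dir_deriv_eqI)
      (intro has_derivative_Pair has_derivative_const has_derivative_dir_deriv
        differentiable_matrix_vector_mult G_differentiable[OF x] differentiable_const)
  then show ?thesis
    unfolding e
    by (simp add: adjoint_tractor_nabla[OF x] tractor_sharp_def tractor_nabla_const metric_dir_deriv[OF x]
        vector_matrix_G[OF x] Ginv_cancel[OF x] matrix_vector_mult_diff_distrib matrix_vector_mult_scaleR
        G_inner[OF x] linear_neg[OF matrix_vector_mul_linear])
qed

lemma projection_field_normal_proj:
  assumes x: "x \<in> S"
  shows "projection_field S x u (\<lambda>X. tractor_nabla G y (\<lambda>_. X) x u) (\<lambda>z. tractor_sharp (G (y z))) (normal_proj G y)"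
proof -
  have s_lin: "linear (tractor_sharp (G (y z)))" for z
    by (rule linearI) (auto simp: tractor_sharp_def matrix_vector_right_distrib matrix_vector_mult_scaleR)
  have s_sym: "tractor_sharp (G (y x)) e \<bullet> e' = e \<bullet> tractor_sharp (G (y x)) e'" for e e'
    by (cases e rule: prod_cases3, cases e' rule: prod_cases3)
      (simp add: tractor_sharp_def G_inner[OF x])
  have "tractor_sharp (G (y x)) (snd (snd V), matrix_inv (G (y x)) *v fst (snd V), fst V) = V" for V
    by (simp add: tractor_sharp_def Ginv_cancel[OF x])
  then have s_surj: "surj (tractor_sharp (G (y x)))" by (metis surj_def)
  show ?thesis
    by (rule projection_field.intro)
      (assumption | rule open_S x linear_tractor_nabla_const s_lin s_sym s_surj
        tractor_sharp_differentiable[OF x] tractor_sharp_parallel[OF x] linear_normal_proj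
        normal_proj_idem normal_proj_sym normal_proj_differentiable[OF x])+
qed

lemma endo_nabla_eq_endo_cov:
  assumes x: "x \<in> S"
  shows "endo_nabla G y (normal_proj G y) x u = endo_cov (\<lambda>X. tractor_nabla G y (\<lambda>_. X) x u) (normal_proj G y) x u"
  by (rule ext) (simp add: endo_nabla_def endo_cov_def tractor_nabla_eq[OF normal_proj_differentiable[OF x]])

text \<open>By tensoriality all admissible sections V give the same value, which settles existence
  for \<open>THE\<close>. Uniqueness requires at least one admissible section, and a constant one
  serves.\<close>

lemma tractor_second_ff_eq:
  assumes x: "x \<in> S"
  shows "tractor_second_ff G y S x u X = - endo_nabla G y (normal_proj G y) x u (tractor_incl G y x X)"
proof -
  interpret projection_field S x u "\<lambda>X. tractor_nabla G y (\<lambda>_. X) x u" "\<lambda>z. tractor_sharp (G (y z))" "normal_proj G y"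
    by (rule projection_field_normal_proj[OF x])
  have *: "normal_proj G y x (tractor_nabla G y (\<lambda>z. tractor_incl G y z (V z)) x u)
      = - endo_nabla G y (normal_proj G y) x u (tractor_incl G y x X)"
    if V: "smooth_on S V \<and> V x = X" for V
  proof -
    have d: "(\<lambda>z. tractor_incl G y z (V z)) differentiable (at x)"
      by (rule tractor_incl_differentiable[OF x smooth_on_differentiable[OF conjunct1[OF V] x]])
    show ?thesis
      using DE_section_of_kernel[OF d normal_proj_tractor_incl] V
      by (simp add: tractor_nabla_eq[OF d] endo_nabla_eq_endo_cov[OF x])
  qed
  show ?thesis
    unfolding tractor_second_ff_def
  proof (rule the_equality)
    show "\<forall>V. smooth_on S V \<and> V x = X \<longrightarrow> - endo_nabla G y (normal_proj G y) x u (tractor_incl G y x X)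
        = normal_proj G y x (tractor_nabla G y (\<lambda>z. tractor_incl G y z (V z)) x u)"
      using * by simp
    fix Y assume Y: "\<forall>V. smooth_on S V \<and> V x = X \<longrightarrow>
        Y = normal_proj G y x (tractor_nabla G y (\<lambda>z. tractor_incl G y z (V z)) x u)"
    have const: "smooth_on S (\<lambda>z. X) \<and> X = X" by (simp add: smooth_on_const)
    show "Y = - endo_nabla G y (normal_proj G y) x u (tractor_incl G y x X)"
      by (rule trans[OF mp[OF spec[OF Y, of "\<lambda>z. X"] const] *[OF const]])
  qed
qed

lemma tractor_second_ff_zero_iff:
  assumes x: "x \<in> S"
  shows "(\<forall>X. tractor_second_ff G y S x u X = 0) \<longleftrightarrow> (\<forall>X. endo_nabla G y (normal_proj G y) x u X = 0)"
proof
  interpret projection_field S x u "\<lambda>X. tractor_nabla G y (\<lambda>_. X) x u" "\<lambda>z. tractor_sharp (G (y z))" "normal_proj G y"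
    by (rule projection_field_normal_proj[OF x])
  assume L: "\<forall>X. tractor_second_ff G y S x u X = 0"
  \<comment> \<open>Each kernel vector is a value of \<open>tractor_incl\<close>, so the hypothesis
    controls the derivative of the projection on the whole kernel.\<close>
  have "endo_cov (\<lambda>X. tractor_nabla G y (\<lambda>_. X) x u) (normal_proj G y) x u V = 0"
    if V: "normal_proj G y x V = 0" for V
  proof -
    obtain X where X: "tractor_incl G y x X = V" using tractor_incl_surj[OF x V] by blast
    have "tractor_second_ff G y S x u X = 0" using L by blast
    then show ?thesis unfolding tractor_second_ff_eq[OF x] X by (simp add: endo_nabla_eq_endo_cov[OF x])
  qed
  then show "\<forall>X. endo_nabla G y (normal_proj G y) x u X = 0"
    using DE_zero_if_zero_on_kernel by (simp add: endo_nabla_eq_endo_cov[OF x])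
next
  assume R: "\<forall>X. endo_nabla G y (normal_proj G y) x u X = 0"
  show "\<forall>X. tractor_second_ff G y S x u X = 0"
    by (rule allI) (simp only: tractor_second_ff_eq[OF x] spec[OF R] minus_zero)
qed

end

section \<open>Conformal manifolds\<close>

lemma form_nabla_eq_form_cov:
  "form_nabla G y \<Psi> x u = form_cov (\<lambda>X. tractor_nabla G y (\<lambda>_. X) x u) \<Psi> x u"
  by (rule ext) (simp add: form_nabla_def form_cov_def)

lemma form_cov_cong_open:
  assumes "open S" "x \<in> S" "\<And>z. z \<in> S \<Longrightarrow> \<Phi> z = \<Psi> z"
  shows "form_cov A \<Phi> x u = form_cov A \<Psi> x u"
proof
  fix Vs
  have "dir_deriv (\<lambda>z. \<Phi> z Vs) x = dir_deriv (\<lambda>z. \<Psi> z Vs) x"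
    by (rule dir_deriv_cong_open[OF assms(1,2)]) (simp add: assms(3))
  then show "form_cov A \<Phi> x u Vs = form_cov A \<Psi> x u Vs"
    by (simp add: form_cov_def assms(2,3))
qed

lemma differentiable_form_scale:
  assumes "differentiable_form k S x \<Phi>"
  shows "differentiable_form k S x (\<lambda>z Vs. r * \<Phi> z Vs)"
  using assms alternating_form_scale unfolding differentiable_form_def by auto

lemma form_cov_scale:
  assumes "(\<lambda>z. \<Phi> z Vs) differentiable (at x)"
  shows "form_cov A (\<lambda>z Vs. r * \<Phi> z Vs) x u Vs = r * form_cov A \<Phi> x u Vs"
proof -
  have "dir_deriv (\<lambda>z. r * \<Phi> z Vs) x u = r * dir_deriv (\<lambda>z. \<Phi> z Vs) x u"
    by (rule dir_deriv_eqI) (intro has_derivative_mult_right has_derivative_dir_deriv assms)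
  then show ?thesis by (simp add: form_cov_def sum_distrib_left right_diff_distrib)
qed

context
  fixes \<kappa> :: "('a::topological_space, 'n::finite) chart"
  assumes \<kappa>: "is_chart \<kappa>"
begin

lemma chart_inv_chart: "p \<in> fst \<kappa> \<Longrightarrow> chart_inv \<kappa> (snd \<kappa> p) = p"
  using \<kappa> by (auto simp: is_chart_def homeomorphism_def)

lemma open_chart_image:
  assumes "open U" "U \<subseteq> fst \<kappa>"
  shows "open (snd \<kappa> ` U)"
proof -
  have h: "homeomorphism (fst \<kappa>) (snd \<kappa> ` fst \<kappa>) (snd \<kappa>) (chart_inv \<kappa>)"
    and o: "open (snd \<kappa> ` fst \<kappa>)" using \<kappa> by (auto simp: is_chart_def)
  have "openin (top_of_set (fst \<kappa>)) U" using assms by (auto simp: openin_open)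
  then have "openin (top_of_set (snd \<kappa> ` fst \<kappa>)) (snd \<kappa> ` U)"
    by (rule homeomorphism_imp_open_map[OF h])
  then show ?thesis using o by (metis openin_open_trans)
qed

end

lemma loc_domD:
  assumes "is_chart \<psi>" "x \<in> loc_dom f \<kappa> \<psi>"
  shows "chart_inv \<psi> x \<in> fst \<psi> \<inter> f -` fst \<kappa>" "snd \<psi> (chart_inv \<psi> x) = x"
  using assms chart_inv_chart[OF assms(1)] by (auto simp: loc_dom_def)

locale conformal_immersion_setting =
  fixes A :: "('a::topological_space, 'n::finite) chart set"
    and B :: "('b::topological_space, 'm::finite) chart set"
    and c :: "('a, 'n) metric set" and f :: "'b \<Rightarrow> 'a"
    and g :: "('a, 'n) metric" and \<kappa> :: "('a, 'n) chart" and \<psi> :: "('b, 'm) chart"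
  assumes A: "oriented_atlas A" and c: "conformal_class A c" and B: "oriented_atlas B"
    and f: "smooth_embedding A B f" and g: "g \<in> c" and \<kappa>: "\<kappa> \<in> A" and \<psi>: "\<psi> \<in> B"
begin

abbreviation "G \<equiv> loc_metric g \<kappa>"
abbreviation "y \<equiv> loc_map f \<kappa> \<psi>"
abbreviation "S \<equiv> loc_dom f \<kappa> \<psi>"
abbreviation "T \<equiv> snd \<kappa> ` fst \<kappa>"

lemma chart_\<kappa>: "is_chart \<kappa>" and chart_\<psi>: "is_chart \<psi>"
  using A B \<kappa> \<psi> by (auto simp: oriented_atlas_def)

lemma open_S: "open S"
proof -
  have "continuous_on UNIV f" using f by (auto simp: smooth_embedding_def homeomorphism_def)
  then have "open (f -` fst \<kappa>)" using chart_\<kappa> by (auto simp: is_chart_def intro: open_vimage)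
  then show ?thesis
    unfolding loc_dom_def using chart_\<psi> by (intro open_chart_image) (auto simp: is_chart_def)
qed

lemma open_T: "open T"
  using chart_\<kappa> by (simp add: is_chart_def)

lemma loc_map_at:
  assumes "x \<in> S"
  shows "f (chart_inv \<psi> x) \<in> fst \<kappa>" "y x = snd \<kappa> (f (chart_inv \<psi> x))"
    "chart_inv \<kappa> (y x) = f (chart_inv \<psi> x)" "G (y x) = g \<kappa> (f (chart_inv \<psi> x))" "y x \<in> T"
  using loc_domD[OF chart_\<psi> assms] chart_inv_chart[OF chart_\<kappa>]
  by (auto simp: loc_map_def loc_metric_def)

sublocale local_immersion G y S T
proof
  have riem: "riemannian_metric A g" using c g by (auto simp: conformal_class_def)
  show "open S" by (rule open_S)
  show "open T" by (rule open_T)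
  show "smooth_on S y" using f \<kappa> \<psi> by (auto simp: smooth_embedding_def)
  show "y x \<in> T" if "x \<in> S" for x by (rule loc_map_at(5)[OF that])
  show "smooth_on T G" using riem \<kappa> by (auto simp: riemannian_metric_def loc_metric_def)
  have gp: "\<forall>p\<in>fst \<kappa>. transpose (g \<kappa> p) = g \<kappa> p \<and> (\<forall>v. v \<noteq> 0 \<longrightarrow> v \<bullet> (g \<kappa> p *v v) > 0)"
    using riem \<kappa> unfolding riemannian_metric_def by blast
  have G: "\<exists>q\<in>fst \<kappa>. G p = g \<kappa> q" if "p \<in> T" for p
    using that chart_inv_chart[OF chart_\<kappa>] by (auto simp: loc_metric_def)
  show "transpose (G p) = G p" if "p \<in> T" for p
    using gp G[OF that] by auto
  show "v \<bullet> (G p *v v) > 0" if "p \<in> T" "v \<noteq> 0" for p v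
    using gp G[OF that(1)] that(2) by auto
  show "inj (dir_deriv y x)" if "x \<in> S" for x
    using f \<kappa> \<psi> that by (auto simp: smooth_embedding_def)
qed

lemma tform_section_differentiable_form:
  assumes \<Psi>: "tform_section A c B f k \<Psi>" and x: "x \<in> S"
  shows "differentiable_form k S x (\<lambda>z. \<Psi> \<kappa> g (chart_inv \<psi> z))"
  unfolding differentiable_form_def
proof (intro conjI ballI allI impI)
  fix z assume "z \<in> S"
  then have "chart_inv \<psi> z \<in> f -` fst \<kappa>" using loc_domD[OF chart_\<psi>] by blast
  then show "alternating_form k (\<Psi> \<kappa> g (chart_inv \<psi> z))"
    using \<Psi> g \<kappa> by (simp add: tform_section_def)
next
  fix Vs :: "'n tractor list" assume "length Vs = k"
  then have "smooth_on S (\<lambda>x. \<Psi> \<kappa> g (chart_inv \<psi> x) Vs)"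
    using \<Psi> g \<kappa> \<psi> by (simp add: tform_section_def)
  then show "(\<lambda>z. \<Psi> \<kappa> g (chart_inv \<psi> z) Vs) differentiable (at x)"
    by (rule smooth_on_differentiable[OF _ x])
qed

text \<open>By the chain rule, differentiating the restricted form along \<open>u\<close> is
  differentiating the ambient form along the image of \<open>u\<close>. On constant sections the
  tractor connection also depends on \<open>u\<close> only through this image, so the ambient
  equation restricts.\<close>

lemma ambient_form_pullback:
  assumes sec: "tform_section A c A id k eps" and par: "tform_parallel A c A id k eps" and x: "x \<in> S"
  defines "\<Phi> \<equiv> \<lambda>z. eps \<kappa> g (f (chart_inv \<psi> z))"
  shows "differentiable_form k S x \<Phi>"
    and "length Vs = k \<Longrightarrow> form_cov (\<lambda>X. tractor_nabla G y (\<lambda>_. X) x u) \<Phi> x u Vs = 0"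
proof -
  define E where "E p = eps \<kappa> g (chart_inv \<kappa> p)" for p
  have dom: "loc_dom id \<kappa> \<kappa> = T" by (simp add: loc_dom_def)
  have \<Phi>E: "\<Phi> z = E (y z)" if "z \<in> S" for z
    using loc_map_at(3)[OF that] by (simp add: \<Phi>_def E_def)
  have yx: "y x \<in> T" by (rule loc_map_at(5)[OF x])
  have E_diff: "(\<lambda>p. E p Vs) differentiable (at (y x))" if "length Vs = k" for Vs
  proof -
    have "smooth_on (loc_dom id \<kappa> \<kappa>) (\<lambda>p. E p Vs)"
      using sec g \<kappa> that by (simp add: tform_section_def E_def)
    then show ?thesis unfolding dom by (rule smooth_on_differentiable[OF _ yx])
  qed
  have der: "((\<lambda>z. \<Phi> z Vs) has_derivative (\<lambda>u. dir_deriv (\<lambda>p. E p Vs) (y x) (dir_deriv y x u))) (at x)"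
    if "length Vs = k" for Vs
    by (rule has_derivative_transform_within_open[OF
          has_derivative_chain[where f = "\<lambda>p. E p Vs", OF E_diff[OF that] y_differentiable[OF x]] open_S x])
      (simp add: \<Phi>E)
  show "differentiable_form k S x \<Phi>"
    unfolding differentiable_form_def
  proof (intro conjI ballI allI impI)
    fix z assume "z \<in> S"
    then have "f (chart_inv \<psi> z) \<in> id -` fst \<kappa>" using loc_map_at(1) by simp
    then show "alternating_form k (\<Phi> z)"
      unfolding \<Phi>_def using sec g \<kappa> by (simp add: tform_section_def)
  next
    fix Vs :: "'n tractor list" assume "length Vs = k"
    then show "(\<lambda>z. \<Phi> z Vs) differentiable (at x)" using der by (auto simp: differentiable_def)
  qed
  assume len: "length Vs = k"
  let ?w = "dir_deriv y x u" and ?i = "loc_map id \<kappa> \<kappa>"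
  have i: "?i p = p" if "p \<in> T" for p
    using that chart_inv_chart[OF chart_\<kappa>] by (auto simp: loc_map_def)
  \<comment> \<open>\<open>?i\<close> is known to be the identity only on \<open>T\<close>, which
    determines its derivative because \<open>T\<close> is open.\<close>
  have di: "dir_deriv ?i (y x) ?w = ?w"
    using dir_deriv_cong_open[OF open_T yx, of ?i "\<lambda>p. p"] i by (simp add: dir_deriv_eqI[OF has_derivative_ident])
  have "tractor_nabla G ?i (\<lambda>_. X) (y x) ?w = tractor_nabla G y (\<lambda>_. X) x u" for X
    by (simp add: tractor_nabla_def Let_def di i[OF yx])
  moreover have "form_nabla G ?i E (y x) ?w Vs = 0"
    using par g \<kappa> len yx dom unfolding tform_parallel_def E_def by blast
  ultimately show "form_cov (\<lambda>X. tractor_nabla G y (\<lambda>_. X) x u) \<Phi> x u Vs = 0"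
    by (simp add: form_nabla_def form_cov_def dir_deriv_eqI[OF der[OF len]] \<Phi>E[OF x])
qed

section \<open>The normal form and its Hodge dual\<close>

context
  fixes N :: "('a, 'n, 'b) tform_field" and d :: nat
  assumes N: "tractor_normal_form A c B f N" and dim: "CARD('m) = CARD('n) - d" and d: "1 \<le> d" "d < CARD('n)"
begin

lemma d_eq: "CARD('n) - CARD('m) = d"
  using dim d by linarith

lemma normal_form_section: "tform_section A c B f d N"
  using N by (simp add: tractor_normal_form_def d_eq Let_def)

lemma normal_form_at:
  assumes "x \<in> S"
  shows "length Vs = d \<Longrightarrow> set Vs \<inter> normal_tractors_perp G y x \<noteq> {} \<Longrightarrow> N \<kappa> g (chart_inv \<psi> x) Vs = 0"
    and "form_norm2 (G (y x)) d (N \<kappa> g (chart_inv \<psi> x)) = fact d"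
proof -
  have q: "chart_inv \<psi> x \<in> fst \<psi> \<inter> f -` fst \<kappa>" and x: "snd \<psi> (chart_inv \<psi> x) = x"
    using loc_domD[OF chart_\<psi> assms] by blast+
  note * = bspec[OF bspec[OF bspec[OF bspec[OF
    conjunct2[OF N[unfolded tractor_normal_form_def d_eq Let_def]] g] \<kappa>] \<psi>] q, unfolded x]
  show "length Vs = d \<Longrightarrow> set Vs \<inter> normal_tractors_perp G y x \<noteq> {} \<Longrightarrow> N \<kappa> g (chart_inv \<psi> x) Vs = 0"
    and "form_norm2 (G (y x)) d (N \<kappa> g (chart_inv \<psi> x)) = fact d"
    using * by blast+
qed

lemma normal_proj_parallel_iff_normal_form_parallel:
  assumes x: "x \<in> S"
  shows "(\<forall>X. endo_nabla G y (normal_proj G y) x u X = 0) \<longleftrightarrow>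
    (\<forall>Vs. length Vs = d \<longrightarrow> form_nabla G y (\<lambda>z. N \<kappa> g (chart_inv \<psi> z)) x u Vs = 0)"
proof -
  interpret projection_field S x u "\<lambda>X. tractor_nabla G y (\<lambda>_. X) x u" "\<lambda>z. tractor_sharp (G (y z))" "normal_proj G y"
    by (rule projection_field_normal_proj[OF x])
  show ?thesis
    unfolding endo_nabla_eq_endo_cov[OF x] form_nabla_eq_form_cov
  proof (rule projection_parallel_iff_form_parallel[OF tform_section_differentiable_form[OF normal_form_section x] _ d(1)])
    fix z and Vs :: "'n tractor list" and j
    assume z: "z \<in> S" and Vs: "length Vs = d" "j < d" "normal_proj G y z (Vs ! j) = 0"
    have "Vs ! j \<in> set Vs \<inter> normal_tractors_perp G y z"
      using Vs by (simp add: normal_proj_eq_0_iff[OF z])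
    then show "N \<kappa> g (chart_inv \<psi> z) Vs = 0" using normal_form_at(1)[OF z Vs(1)] by blast
  next
    show "dim (range (normal_proj G y x)) = d"
      unfolding range_normal_proj[OF x] using dim_normal_tractors[OF x] d_eq by linarith
    show "(\<Sum>es\<in>basis_lists d. N \<kappa> g (chart_inv \<psi> z) (map (tractor_sharp (G (y z))) es) * N \<kappa> g (chart_inv \<psi> z) es)
        = fact d" if "z \<in> S" for z
      using normal_form_at(2)[OF that] by (simp add: form_norm2_def)
  qed simp
qed

lemma normal_form_parallel_iff_star_parallel:
  assumes x: "x \<in> S" and eps: "tractor_volume_form A c eps"
  shows "(\<forall>Vs. length Vs = d \<longrightarrow> form_nabla G y (\<lambda>z. N \<kappa> g (chart_inv \<psi> z)) x u Vs = 0) \<longleftrightarrow>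
    (\<forall>Bs. length Bs = CARD('m) + 2 \<longrightarrow>
      form_nabla G y (\<lambda>z. normal_form_star f eps d N \<kappa> g (chart_inv \<psi> z)) x u Bs = 0)"
proof -
  interpret projection_field S x u "\<lambda>X. tractor_nabla G y (\<lambda>_. X) x u" "\<lambda>z. tractor_sharp (G (y z))" "normal_proj G y"
    by (rule projection_field_normal_proj[OF x])
  \<comment> \<open>The rank n + 2 splits into d contracted and m + 2 free arguments.\<close>
  have deg: "CARD('n) + 2 = d + (CARD('m) + 2)" using dim d by linarith
  define \<Phi> where "\<Phi> z = eps \<kappa> g (f (chart_inv \<psi> z))" for z
  \<comment> \<open>Absorbing the factor 1/d! of the Hodge operator into the volume form makes the
    dual a plain contraction.\<close>
  define r :: real where "r = 1 / fact d"
  have r: "r \<noteq> 0" by (simp add: r_def)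
  have sec: "tform_section A c A id (d + (CARD('m) + 2)) eps"
    and par: "tform_parallel A c A id (d + (CARD('m) + 2)) eps"
    using eps unfolding tractor_volume_form_def deg by blast+
  note \<Phi> = ambient_form_pullback[OF sec par x, folded \<Phi>_def]
  have norm: "form_norm2 (G (y x)) (d + (CARD('m) + 2)) (\<Phi> x) = - fact (d + (CARD('m) + 2))"
    using bspec[OF bspec[OF bspec[OF conjunct2[OF conjunct2[OF
      eps[unfolded tractor_volume_form_def deg]]] g] \<kappa>] loc_map_at(1)[OF x]]
    unfolding loc_map_at(4)[OF x] \<Phi>_def by (rule conjunct1)
  \<comment> \<open>The prescribed length is nonzero, so the volume form does not vanish at this
    point.\<close>
  have "\<exists>es\<in>basis_lists (d + (CARD('m) + 2)). \<Phi> x es \<noteq> 0"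
  proof (rule ccontr)
    assume "\<not> ?thesis"
    then have "form_norm2 (G (y x)) (d + (CARD('m) + 2)) (\<Phi> x) = 0" by (simp add: form_norm2_def)
    then show False unfolding norm by simp
  qed
  then obtain Us where Us: "length Us = d + (CARD('m) + 2)" "\<Phi> x Us \<noteq> 0"
    using length_basis_lists by blast
  have star: "normal_form_star f eps d N \<kappa> g (chart_inv \<psi> z)
      = (\<lambda>Bs. \<Sum>es\<in>basis_lists d. (r * \<Phi> z (map (tractor_sharp (G (y z))) es @ Bs)) * N \<kappa> g (chart_inv \<psi> z) es)"
    if "z \<in> S" for z
    by (rule ext)
      (simp add: normal_form_star_def tractor_hodge_def loc_map_at(4)[OF that] \<Phi>_def r_def sum_divide_distrib)
  have star_cov: "form_cov (\<lambda>X. tractor_nabla G y (\<lambda>_. X) x u) (\<lambda>z. normal_form_star f eps d N \<kappa> g (chart_inv \<psi> z)) x u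
      = form_cov (\<lambda>X. tractor_nabla G y (\<lambda>_. X) x u) (\<lambda>z Bs. \<Sum>es\<in>basis_lists d.
          (r * \<Phi> z (map (tractor_sharp (G (y z))) es @ Bs)) * N \<kappa> g (chart_inv \<psi> z) es) x u"
    by (rule form_cov_cong_open[OF open_S x star])
  have cov: "form_cov (\<lambda>X. tractor_nabla G y (\<lambda>_. X) x u) (\<lambda>z Vs. r * \<Phi> z Vs) x u Vs = 0"
    if "length Vs = d + (CARD('m) + 2)" for Vs
    using form_cov_scale[where \<Phi> = \<Phi>, OF differentiable_form_differentiable[OF \<Phi>(1) that]] \<Phi>(2)[OF that] by simp
  show ?thesis
    unfolding form_nabla_eq_form_cov star_cov
  proof (rule contraction_parallel_iff[where \<epsilon> = "\<lambda>z Vs. r * \<Phi> z Vs", OF differentiable_form_scale[OF \<Phi>(1)] cov Us(1)])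
    show "r * \<Phi> x Us \<noteq> 0" using Us(2) r by simp
    show "DIM('n tractor) = d + (CARD('m) + 2)" using deg by simp
    show "differentiable_form d S x (\<lambda>z. N \<kappa> g (chart_inv \<psi> z))"
      by (rule tform_section_differentiable_form[OF normal_form_section x])
  qed
qed

end

end

theorem theorem1p1:
  fixes A :: "('a::{t2_space,second_countable_topology}, 'n::finite) chart set"
    and B :: "('b::{t2_space,second_countable_topology}, 'm::finite) chart set"
    and c :: "('a, 'n) metric set"
    and \<iota> :: "'b \<Rightarrow> 'a"
    and eps :: "('a, 'n, 'a) tform_field"
    and N :: "('a, 'n, 'b) tform_field"
    and d :: nat
  assumes "oriented_atlas A" and "connected (UNIV :: 'a set)" and "CARD('n) \<ge> 3"
    and "conformal_class A c"
    and "oriented_atlas B" and "smooth_embedding A B \<iota>"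
    and "CARD('m) = CARD('n) - d" and "1 \<le> d" and "d < CARD('n)"
    and "tractor_volume_form A c eps"
    and "tractor_normal_form A c B \<iota> N"
  shows "(tractor_second_ff_zero A c B \<iota> \<longleftrightarrow> normal_proj_parallel A c B \<iota>) \<and>
         (normal_proj_parallel A c B \<iota> \<longleftrightarrow> tform_parallel A c B \<iota> d N) \<and>
         (tform_parallel A c B \<iota> d N \<longleftrightarrow>
            tform_parallel A c B \<iota> (CARD('m) + 2) (normal_form_star \<iota> eps d N))"
proof -
  have setting: "conformal_immersion_setting A B c \<iota> g \<kappa> \<psi>" if "g \<in> c" "\<kappa> \<in> A" "\<psi> \<in> B" for g \<kappa> \<psi>
    using assms that by (simp add: conformal_immersion_setting_def)
  have 1: "(\<forall>X. tractor_second_ff (loc_metric g \<kappa>) (loc_map \<iota> \<kappa> \<psi>) (loc_dom \<iota> \<kappa> \<psi>) x u X = 0)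
      \<longleftrightarrow> (\<forall>X. endo_nabla (loc_metric g \<kappa>) (loc_map \<iota> \<kappa> \<psi>)
            (normal_proj (loc_metric g \<kappa>) (loc_map \<iota> \<kappa> \<psi>)) x u X = 0)"
    and 2: "(\<forall>X. endo_nabla (loc_metric g \<kappa>) (loc_map \<iota> \<kappa> \<psi>)
            (normal_proj (loc_metric g \<kappa>) (loc_map \<iota> \<kappa> \<psi>)) x u X = 0)
      \<longleftrightarrow> (\<forall>Vs. length Vs = d \<longrightarrow>
            form_nabla (loc_metric g \<kappa>) (loc_map \<iota> \<kappa> \<psi>) (\<lambda>z. N \<kappa> g (chart_inv \<psi> z)) x u Vs = 0)"
    and 3: "(\<forall>Vs. length Vs = d \<longrightarrow>
            form_nabla (loc_metric g \<kappa>) (loc_map \<iota> \<kappa> \<psi>) (\<lambda>z. N \<kappa> g (chart_inv \<psi> z)) x u Vs = 0)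
      \<longleftrightarrow> (\<forall>Vs. length Vs = CARD('m) + 2 \<longrightarrow> form_nabla (loc_metric g \<kappa>) (loc_map \<iota> \<kappa> \<psi>)
            (\<lambda>z. normal_form_star \<iota> eps d N \<kappa> g (chart_inv \<psi> z)) x u Vs = 0)"
    if "g \<in> c" "\<kappa> \<in> A" "\<psi> \<in> B" "x \<in> loc_dom \<iota> \<kappa> \<psi>" for g \<kappa> \<psi> x u
  proof -
    interpret conformal_immersion_setting A B c \<iota> g \<kappa> \<psi> by (rule setting[OF that(1-3)])
    show "(\<forall>X. tractor_second_ff G y S x u X = 0) \<longleftrightarrow> (\<forall>X. endo_nabla G y (normal_proj G y) x u X = 0)"
      by (rule tractor_second_ff_zero_iff[OF that(4)])
    show "(\<forall>X. endo_nabla G y (normal_proj G y) x u X = 0) \<longleftrightarrow>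
        (\<forall>Vs. length Vs = d \<longrightarrow> form_nabla G y (\<lambda>z. N \<kappa> g (chart_inv \<psi> z)) x u Vs = 0)"
      by (rule normal_proj_parallel_iff_normal_form_parallel[OF assms(11,7,8,9) that(4)])
    show "(\<forall>Vs. length Vs = d \<longrightarrow> form_nabla G y (\<lambda>z. N \<kappa> g (chart_inv \<psi> z)) x u Vs = 0) \<longleftrightarrow>
        (\<forall>Vs. length Vs = CARD('m) + 2 \<longrightarrow>
          form_nabla G y (\<lambda>z. normal_form_star \<iota> eps d N \<kappa> g (chart_inv \<psi> z)) x u Vs = 0)"
      by (rule normal_form_parallel_iff_star_parallel[OF assms(11,7,8,9) that(4) assms(10)])
  qed
  \<comment> \<open>The equivalences hold for each scale, pair of charts, point and direction
    separately, and so pass under the quantifiers shared by the four conditions.\<close>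
  show ?thesis
    unfolding tractor_second_ff_zero_def normal_proj_parallel_def tform_parallel_def
    by (intro conjI) (intro ball_cong refl iff_allI 1 2 3; assumption)+
qed

end
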